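(* Let $(X,\varphi)$ be a Stone system and endow $\mathsf{H}_0(\varphi)$ with the topology defined by the complete distance $d(g,h)=d_+(g,h)+d_+(g^{-1},h^{-1})$ defined in the context. The group $\mathsf{T}(\varphi)$ is a dense subgroup of $\mathsf{H}_0(\varphi)$. In particular, if $X$ is metrisable, the group $\mathsf{H}_0(\varphi)$ is Polish.
   Context: A Stone system $(X,\varphi)$ is a non-empty totally disconnected compact Hausdorff space $X$ together with a self-homeomorphism $\varphi$ of $X$. Suspension: $Y^\varphi=(X\times\mathbb R)/\mathbb Z$, the quotient by the $\mathbb Z$-action $n\cdot(x,t)=(\varphi^n(x),t-n)$; $[x,t]$ is the class of $(x,t)$, and the suspension flow is $\Phi^t([x,s])=[x,s+t]$. $\mathsf{H}_0(\varphi)$ is the group of homeomorphisms of $Y^\varphi$ that are isotopic to the identity; equivalently (Boyle–Carlsen–Eilers), the homeomorphisms $g$ of $Y^\varphi$ for which there is a continuous $\tau\colon Y^\varphi\to\mathbb R$ with $g(y)=\Phi^{\tau(y)}(y)$ for all $y$; any such $\tau$ is called a displacement function for $g$. For $g,h\in\mathsf{H}_0(\varphi)$ put $d_+(g,h)=\inf_{\tau,\lambda}\sup_{y\in Y^\varphi}|\tau(y)-\lambda(y)|$, the infimum over all displacement functions $\tau$ of $g$ and $\lambda$ of $h$. Charts: for a clopen $C\subset X$ put $\tau_C=\min\{n\ge1:\exists x\in C,\ \varphi^n(x)\in C\}\in\mathbb N\cup\{\infty\}$. For an open interval $J\subset\mathbb R$ of length $|J|<\tau_C$, the map $\pi_{C,J}\colon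 C\times J\to Y^\varphi$, $(x,t)\mapsto[x,t]$, is injective; it is called a chart and its image is denoted $U_{C\times J}$ (a domain). A dyadic rational is a number $p/2^q$ with $p,q\in\mathbb Z$; an interval is dyadic if it is bounded with dyadic rational endpoints; a chart $\pi_{C,J}$ is dyadic if $J$ is. A piecewise linear (PL) homeomorphism between intervals is a homeomorphism that is piecewise affine with finitely many breakpoints; it is dyadic if both intervals are dyadic, the breakpoints are dyadic rationals, and each affine piece has the form $x\mapsto2^mx+b$ with $m\in\mathbb Z$, $b$ a dyadic rational. $\mathsf{T}(\varphi)$ is the group of all $g\in\mathsf{H}_0(\varphi)$ such that for every $y\in Y^\varphi$ there are a dyadic chart $\pi_{C,J}$ with $y\in U_{C\times J}$ and a dyadic PL homeomorphism $f\colon J\to f(J)\subset\mathbb R$ such that $g(U_{C\times J})=U_{C\times f(J)}$ and $\pi_{C,f(J)}^{-1}\circ g\circ\pi_{C,J}$ is the map $(x,t)\mapsto(x,f(t))$. *)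

theory Defs
  imports "HOL-Analysis.Analysis" "HOL-Algebra.Bij"
begin

section \<open>Stone systems and their suspensions\<close>

text \<open>The space \<open>X\<close> is the universe of a type; types are non-empty, and the Hausdorff property is
  the sort constraint.\<close>

definition stone_system :: "('a::t2_space \<Rightarrow> 'a) \<Rightarrow> bool" where
  "stone_system \<phi> \<longleftrightarrow>
     compact (UNIV :: 'a set) \<and>
     (\<forall>x::'a. connected_component_set UNIV x = {x}) \<and>
     homeomorphism UNIV UNIV \<phi> (inv_into UNIV \<phi>)"

definition zpow :: "('a \<Rightarrow> 'a) \<Rightarrow> int \<Rightarrow> 'a \<Rightarrow> 'a" where
  "zpow \<phi> n = (if 0 \<le> n then \<phi> ^^ nat n else inv_into UNIV \<phi> ^^ nat (- n))"

text \<open>The class \<open>[x,t]\<close> is the orbit of \<open>(x,t)\<close> under the action of the integers.\<close>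

definition susp_class :: "('a \<Rightarrow> 'a) \<Rightarrow> 'a \<times> real \<Rightarrow> ('a \<times> real) set" where
  "susp_class \<phi> = (\<lambda>(x, t). {(zpow \<phi> n x, t - of_int n) | n::int. True})"

definition suspension :: "('a \<Rightarrow> 'a) \<Rightarrow> ('a \<times> real) set set" where
  "suspension \<phi> = range (susp_class \<phi>)"

definition susp_top :: "('a::topological_space \<Rightarrow> 'a) \<Rightarrow> ('a \<times> real) set topology" where
  "susp_top \<phi> = topology (\<lambda>U. U \<subseteq> suspension \<phi> \<and> open (susp_class \<phi> -` U))"

lemma openin_susp_top:
  "openin (susp_top \<phi>) U \<longleftrightarrow> U \<subseteq> suspension \<phi> \<and> open (susp_class \<phi> -` U)"
proof -
  have "istopology (\<lambda>U. U \<subseteq> suspension \<phi> \<and> open (susp_class \<phi> -` U))"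
    unfolding istopology_def by (auto simp: vimage_Union)
  then show ?thesis
    by (simp add: susp_top_def)
qed

lemma topspace_susp_top [simp]: "topspace (susp_top \<phi>) = suspension \<phi>"
proof -
  have "susp_class \<phi> -` suspension \<phi> = UNIV"
    by (auto simp: suspension_def)
  then have "openin (susp_top \<phi>) (suspension \<phi>)"
    by (simp add: openin_susp_top)
  then show ?thesis
    by (metis openin_subset openin_susp_top openin_topspace subset_antisym)
qed

lemma quotient_map_susp_class: "quotient_map euclidean (susp_top \<phi>) (susp_class \<phi>)"
  by (auto simp: quotient_map_def openin_susp_top suspension_def vimage_def)

definition susp_flow :: "real \<Rightarrow> ('a \<times> real) set \<Rightarrow> ('a \<times> real) set" where
  "susp_flow t y = (\<lambda>(x, s). (x, s + t)) ` y"

lemma susp_flow_class: "susp_flow t (susp_class \<phi> (x, s)) = susp_class \<phi> (x, s + t)"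
  unfolding susp_flow_def susp_class_def by (force simp: image_iff)


section \<open>The group of homeomorphisms isotopic to the identity\<close>

text \<open>Homeomorphisms are taken extensional on the suspension, so that they form a subset of the
  carrier of \<open>BijGroup\<close>.\<close>

definition H0 :: "('a::topological_space \<Rightarrow> 'a) \<Rightarrow> (('a \<times> real) set \<Rightarrow> ('a \<times> real) set) set" where
  "H0 \<phi> = {g \<in> extensional (suspension \<phi>).
      homeomorphic_map (susp_top \<phi>) (susp_top \<phi>) g \<and>
      homotopic_with (homeomorphic_map (susp_top \<phi>) (susp_top \<phi>))
        (susp_top \<phi>) (susp_top \<phi>) id g}"

definition H0_group ::
    "('a::topological_space \<Rightarrow> 'a) \<Rightarrow> (('a \<times> real) set \<Rightarrow> ('a \<times> real) set) monoid" where
  "H0_group \<phi> = (BijGroup (suspension \<phi>))\<lparr>carrier := H0 \<phi>\<rparr>"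

definition displacement ::
    "('a::topological_space \<Rightarrow> 'a) \<Rightarrow> (('a \<times> real) set \<Rightarrow> ('a \<times> real) set)
      \<Rightarrow> (('a \<times> real) set \<Rightarrow> real) \<Rightarrow> bool" where
  "displacement \<phi> g \<tau> \<longleftrightarrow>
     continuous_map (susp_top \<phi>) euclideanreal \<tau> \<and>
     (\<forall>y\<in>suspension \<phi>. g y = susp_flow (\<tau> y) y)"

text \<open>A displacement function need not be unique when there are periodic flow lines, hence the
  infimum.\<close>

definition dplus ::
    "('a::topological_space \<Rightarrow> 'a) \<Rightarrow> (('a \<times> real) set \<Rightarrow> ('a \<times> real) set)
      \<Rightarrow> (('a \<times> real) set \<Rightarrow> ('a \<times> real) set) \<Rightarrow> real" where
  "dplus \<phi> g h =
     (INF (\<tau>, l) \<in> {(\<tau>, l). displacement \<phi> g \<tau> \<and> displacement \<phi> h l}.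
        SUP y \<in> suspension \<phi>. \<bar>\<tau> y - l y\<bar>)"

text \<open>The value outside \<open>H0\<close> is irrelevant; it is set to 0 because \<open>Metric_space\<close>
  requires a distance to be non-negative everywhere, whereas the infimum of an empty set of reals
  is unspecified.\<close>

definition H0_dist ::
    "('a::topological_space \<Rightarrow> 'a) \<Rightarrow> (('a \<times> real) set \<Rightarrow> ('a \<times> real) set)
      \<Rightarrow> (('a \<times> real) set \<Rightarrow> ('a \<times> real) set) \<Rightarrow> real" where
  "H0_dist \<phi> g h =
     (if g \<in> H0 \<phi> \<and> h \<in> H0 \<phi>
      then dplus \<phi> g h +
           dplus \<phi> (restrict (inv_into (suspension \<phi>) g) (suspension \<phi>))
                   (restrict (inv_into (suspension \<phi>) h) (suspension \<phi>))
      else 0)"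

definition H0_top ::
    "('a::topological_space \<Rightarrow> 'a) \<Rightarrow> (('a \<times> real) set \<Rightarrow> ('a \<times> real) set) topology" where
  "H0_top \<phi> = Metric_space.mtopology (H0 \<phi>) (H0_dist \<phi>)"


section \<open>Dyadic charts and the group T\<close>

definition return_time :: "('a \<Rightarrow> 'a) \<Rightarrow> 'a set \<Rightarrow> enat" where
  "return_time \<phi> C = Inf {enat n | n. 1 \<le> n \<and> (\<exists>x\<in>C. (\<phi> ^^ n) x \<in> C)}"

definition is_chart :: "('a::topological_space \<Rightarrow> 'a) \<Rightarrow> 'a set \<Rightarrow> real set \<Rightarrow> bool" where
  "is_chart \<phi> C J \<longleftrightarrow>
     open C \<and> closed C \<and>
     (\<exists>a b. a < b \<and> J = {a<..<b} \<and> ereal (b - a) < ereal_of_enat (return_time \<phi> C))"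

definition chart_domain :: "('a \<Rightarrow> 'a) \<Rightarrow> 'a set \<Rightarrow> real set \<Rightarrow> ('a \<times> real) set set" where
  "chart_domain \<phi> C J = susp_class \<phi> ` (C \<times> J)"

definition dyadic_rationals :: "real set" where
  "dyadic_rationals = {of_int p / 2 powi q | p q :: int. True}"

definition dyadic_open_interval :: "real set \<Rightarrow> bool" where
  "dyadic_open_interval J \<longleftrightarrow>
     (\<exists>a\<in>dyadic_rationals. \<exists>b\<in>dyadic_rationals. a < b \<and> J = {a<..<b})"

text \<open>\<open>B\<close> is a finite set containing the breakpoints; \<open>f\<close> is affine on each interval avoiding it.\<close>

definition dyadic_PL_homeo :: "real set \<Rightarrow> (real \<Rightarrow> real) \<Rightarrow> bool" where
  "dyadic_PL_homeo J f \<longleftrightarrow>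
     dyadic_open_interval J \<and> dyadic_open_interval (f ` J) \<and>
     (\<exists>f'. homeomorphism J (f ` J) f f') \<and>
     (\<exists>B. finite B \<and> B \<subseteq> dyadic_rationals \<and>
        (\<forall>I. is_interval I \<and> I \<subseteq> J - B \<longrightarrow>
           (\<exists>m::int. \<exists>b\<in>dyadic_rationals. \<forall>x\<in>I. f x = 2 powi m * x + b)))"

definition T_group ::
    "('a::topological_space \<Rightarrow> 'a) \<Rightarrow> (('a \<times> real) set \<Rightarrow> ('a \<times> real) set) set" where
  "T_group \<phi> = {g \<in> H0 \<phi>. \<forall>y\<in>suspension \<phi>. \<exists>C J f.
      is_chart \<phi> C J \<and> dyadic_open_interval J \<and> y \<in> chart_domain \<phi> C J \<and>
      dyadic_PL_homeo J f \<and> is_chart \<phi> C (f ` J) \<and>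
      g ` chart_domain \<phi> C J = chart_domain \<phi> C (f ` J) \<and>
      (\<forall>x\<in>C. \<forall>t\<in>J.
         inv_into (C \<times> f ` J) (susp_class \<phi>) (g (susp_class \<phi> (x, t))) = (x, f t))}"


section \<open>Polish groups\<close>

definition polish_group :: "('g, 'm) monoid_scheme \<Rightarrow> 'g topology \<Rightarrow> bool" where
  "polish_group G \<T> \<longleftrightarrow>
     group G \<and> topspace \<T> = carrier G \<and>
     continuous_map (prod_topology \<T> \<T>) \<T> (\<lambda>(g, h). g \<otimes>\<^bsub>G\<^esub> h) \<and>
     continuous_map \<T> \<T> (\<lambda>g. inv\<^bsub>G\<^esub> g) \<and>
     completely_metrizable_space \<T> \<and> separable_space \<T>"

end

(* Lifting an isotopy through the projection of the suspension to the circle, one short time step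
   after the other, shows that H0 consists of the injective maps y |-> flow(tau y) y with tau
   continuous; on each flow line such a map lifts to the increasing homeomorphism t |-> t + tau[x,t].
   Two displacement functions of the same map differ by an integer at each point. Hence d_+ is a
   quotient seminorm, a Cauchy sequence eventually has uniformly convergent displacement functions,
   and so have the inverses; the two limits are again inverse to each other.

   For density, sample the lifts at the points j / 2^q, replace the sampled values by nearby locally
   constant functions of x with dyadic values, and interpolate by dyadic PL maps of two slopes. If X is
   metrisable it has only countably many clopen sets, so there are only countably many such data,
   which yields separability. *)

theory Submission
  imports Defs
begin

section \<open>The suspension and its flow\<close>

text \<open>Flow lines may be periodic, so a map in \<open>H0\<close> does not determine its
  displacement function, and \<open>X\<close> need not be metrisable. Estimates are therefore made
  along flow lines, for the lifts \<open>F x t = t + \<tau> [x,t]\<close> with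
  \<open>F (\<phi> x) (t - 1) = F x t - 1\<close>; compactness of \<open>X \<times> [0,1]\<close>
  makes them uniform. Ambiguities in time are integers, so closeness below 1/2 singles out one
  displacement function. Inverses enter the distance because a uniform limit of increasing lifts may
  be constant on an interval; convergence of the inverses restores injectivity. For a fixed map,
  compactness gives a positive lower bound on how far the lifts advance over a time step, which
  turns closeness of lifts into closeness of inverses. Charts involve choices, so membership in
  \<open>T\<close> is turned into a condition on one displacement function: locally constant across
  flow lines, dyadic PL along them. The average slope between two dyadic points is in general no
  power of 2, so an interpolating piece must break; \<open>2^(m+1) - 2^m = 2^m\<close> makes the
  break of two lines with these slopes dyadic.\<close>

lemma zpow_0 [simp]: "zpow \<phi> 0 x = x"
  by (simp add: zpow_def)

lemma zpow_succ:
  assumes "bij \<phi>"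
  shows "zpow \<phi> (n + 1) x = \<phi> (zpow \<phi> n x)"
proof (cases "0 \<le> n")
  case True
  then show ?thesis
    by (simp add: zpow_def nat_add_distrib)
next
  case False
  then obtain k where k: "nat (- n) = Suc k" "n = - int (Suc k)"
    by (metis add.inverse_inverse int_nat_eq linorder_not_le neg_0_less_iff_less not0_implies_Suc
        of_nat_0 order_less_irrefl zero_less_nat_eq gr0_conv_Suc less_imp_le)
  then show ?thesis
    using assms by (auto simp: zpow_def bij_is_surj surj_f_inv_f)
qed

lemma zpow_pred:
  assumes "bij \<phi>"
  shows "zpow \<phi> (n - 1) x = inv_into UNIV \<phi> (zpow \<phi> n x)"
  using zpow_succ [OF assms, of "n - 1" x] by (simp add: assms bij_is_inj)

lemma zpow_add:
  assumes "bij \<phi>"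
  shows "zpow \<phi> (m + n) x = zpow \<phi> m (zpow \<phi> n x)"
proof (induction m rule: int_induct [where k = 0])
  case base
  show ?case by simp
next
  case (step1 i)
  then show ?case
    using zpow_succ [OF assms, of "i + n" x] zpow_succ [OF assms, of i] by (simp add: algebra_simps)
next
  case (step2 i)
  then show ?case
    using zpow_pred [OF assms, of "i + n" x] zpow_pred [OF assms, of i]
    by (simp add: algebra_simps)
qed

lemma zpow_1 [simp]: "zpow \<phi> 1 x = \<phi> x"
  by (simp add: zpow_def)

lemma mem_susp_class: "p \<in> susp_class \<phi> p"
  by (cases p) (auto simp: susp_class_def intro!: exI [of _ "0::int"])

lemma susp_class_eq_iff:
  assumes "bij \<phi>"
  shows "susp_class \<phi> (x, t) = susp_class \<phi> (x', t') \<longleftrightarrow> (\<exists>n. x' = zpow \<phi> n x \<and> t' = t - of_int n)"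
proof
  assume "susp_class \<phi> (x, t) = susp_class \<phi> (x', t')"
  then have "(x', t') \<in> susp_class \<phi> (x, t)"
    by (simp add: mem_susp_class)
  then show "\<exists>n. x' = zpow \<phi> n x \<and> t' = t - of_int n"
    by (auto simp: susp_class_def)
next
  assume "\<exists>n. x' = zpow \<phi> n x \<and> t' = t - of_int n"
  then obtain n where n: "x' = zpow \<phi> n x" "t' = t - of_int n" by blast
  have "(zpow \<phi> k x, t - of_int k) = (zpow \<phi> (k - n) x', t' - of_int (k - n))" for k
    using n zpow_add [OF assms, of "k - n" n x] by simp
  moreover have "(zpow \<phi> k x', t' - of_int k) = (zpow \<phi> (k + n) x, t - of_int (k + n))" for k
    using n zpow_add [OF assms, of k n x] by simp
  ultimately show "susp_class \<phi> (x, t) = susp_class \<phi> (x', t')"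
    unfolding susp_class_def by fast
qed

lemma susp_class_mem [simp]: "susp_class \<phi> p \<in> suspension \<phi>"
  by (simp add: suspension_def)

lemma suspension_nonempty: "suspension \<phi> \<noteq> {}"
  by (auto simp: suspension_def)

lemma suspensionE:
  assumes "y \<in> suspension \<phi>"
  obtains x t where "y = susp_class \<phi> (x, t)"
  using assms by (auto simp: suspension_def)

lemma susp_flow_mem [simp]: "y \<in> suspension \<phi> \<Longrightarrow> susp_flow t y \<in> suspension \<phi>"
  by (erule suspensionE) (simp add: susp_flow_class)

lemma susp_flow_0 [simp]: "susp_flow 0 y = y"
  by (simp add: susp_flow_def)

lemma susp_flow_add: "susp_flow s (susp_flow t y) = susp_flow (s + t) y"
  by (force simp: susp_flow_def image_iff)

text \<open>Evaluation at an arbitrary representative, hence meaningful only for functions that are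
  invariant under the action.\<close>

definition susp_descend :: "('a \<times> real \<Rightarrow> 'b) \<Rightarrow> ('a \<times> real) set \<Rightarrow> 'b" where
  "susp_descend f y = f (SOME p. p \<in> y)"

lemma susp_descend_class:
  assumes "\<And>n x t. f (zpow \<phi> n x, t - of_int n) = f (x, t)"
  shows "susp_descend f (susp_class \<phi> (x, t)) = f (x, t)"
proof -
  have "(SOME p. p \<in> susp_class \<phi> (x, t)) \<in> susp_class \<phi> (x, t)"
    by (rule someI [of "\<lambda>p. p \<in> susp_class \<phi> (x, t)"]) (rule mem_susp_class)
  then obtain n where "(SOME p. p \<in> susp_class \<phi> (x, t)) = (zpow \<phi> n x, t - of_int n)"
    by (auto simp: susp_class_def)
  then show ?thesis
    by (simp add: susp_descend_def assms)
qed

lemma continuous_map_susp_top_iff: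
  fixes f :: "('a::topological_space \<times> real) set \<Rightarrow> 'b"
  shows "continuous_map (susp_top \<phi>) T f \<longleftrightarrow> continuous_map euclidean T (f \<circ> susp_class \<phi>)"
  by (rule continuous_compose_quotient_map_eq [OF quotient_map_susp_class, symmetric])

text \<open>Invariance under the generator propagates to all integers; going down, the hypothesis is
  applied at the preceding point and read backwards.\<close>

lemma zpow_invariantI:
  assumes "bij \<phi>" and f: "\<And>x t. f (\<phi> x, t - 1) = f (x, t)"
  shows "f (zpow \<phi> n x, t - of_int n) = f (x, t::real)"
proof (induction n rule: int_induct [where k = 0])
  case base
  show ?case by simp
next
  case (step1 i)
  then show ?case
    using f [of "zpow \<phi> i x" "t - of_int i"] zpow_succ [OF assms(1), of i x]
    by (simp add: algebra_simps)
next
  case (step2 i)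
  then show ?case
    using f [of "zpow \<phi> (i - 1) x" "t - of_int (i - 1)"] zpow_succ [OF assms(1), of "i - 1" x]
    by (simp add: algebra_simps)
qed

text \<open>The projection of the suspension to R/Z, with the circle placed in the complex plane so
  that \<open>Arg\<close> can measure elapsed time. It is well defined because the action changes
  the second coordinate by integers.\<close>

definition circ :: "('a \<times> real) set \<Rightarrow> complex" where
  "circ = susp_descend (\<lambda>(x, t). cis (2 * pi * t))"

lemma circ_class [simp]: "circ (susp_class \<phi> (x, t)) = cis (2 * pi * t)"
proof -
  have "cis (2 * pi * (t - of_int n)) = cis (2 * pi * t)" for t and n :: int
    by (simp add: right_diff_distrib flip: cis_divide)
  then show ?thesis
    unfolding circ_def by (subst susp_descend_class [where \<phi> = \<phi>]) auto
qed

lemma continuous_map_circ: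
  "continuous_map (susp_top (\<phi> :: 'a::topological_space \<Rightarrow> 'a)) euclidean circ"
proof -
  have *: "(circ \<circ> susp_class \<phi>) = (\<lambda>p :: 'a \<times> real. cis (2 * pi * snd p))"
    by (auto simp: fun_eq_iff)
  have "continuous_on UNIV (\<lambda>p :: 'a \<times> real. cis (2 * pi * snd p))"
    by (intro continuous_intros)
  then show ?thesis
    by (simp add: continuous_map_susp_top_iff *)
qed

text \<open>In a compact Hausdorff space components and quasi-components coincide, and points in
  different quasi-components are separated by a clopen set.\<close>

lemma clopen_separation:
  fixes x y :: "'a::t2_space"
  assumes "compact (UNIV :: 'a set)" "\<And>x::'a. connected_component_set UNIV x = {x}" "x \<noteq> y"
  obtains C where "open C" "closed C" "x \<in> C" "y \<notin> C"
proof -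
  have "Hausdorff_space (euclidean :: 'a topology)"
    unfolding Hausdorff_space_def disjnt_def using hausdorff by fastforce
  then have "quasi_component_of euclidean x = connected_component_of (euclidean :: 'a topology) x"
    by (intro quasi_eq_connected_component_of) (simp add: assms(1) compact_space_def)
  moreover have "\<not> connected_component_of (euclidean :: 'a topology) x y"
  proof
    assume "connected_component_of (euclidean :: 'a topology) x y"
    then obtain T :: "'a set" where "connected T" "x \<in> T" "y \<in> T"
      by (auto simp: connected_component_of_def)
    then have "y \<in> connected_component_set UNIV x"
      by (auto simp: connected_component_def)
    then show False
      using assms by auto
  qed
  ultimately have "\<not> quasi_component_of (euclidean :: 'a topology) x y"
    by simp
  then show ?thesis
    using that by (auto simp: quasi_component_of)
qed

text \<open>Each point outside \<open>U\<close> is cut off from \<open>x\<close> by a clopen set;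
  the complement of \<open>U\<close> is compact, so finitely many of these sets are enough and their
  intersection stays open.\<close>

lemma clopen_neighbourhood:
  fixes x :: "'a::t2_space"
  assumes X: "compact (UNIV :: 'a set)" "\<And>x::'a. connected_component_set UNIV x = {x}"
    and U: "open U" "x \<in> U"
  obtains C where "open C" "closed C" "x \<in> C" "C \<subseteq> U"
proof -
  have "\<exists>C. open C \<and> closed C \<and> x \<in> C \<and> y \<notin> C" if "y \<in> - U" for y
    using clopen_separation [OF X, of x y] U that by (metis ComplD)
  then obtain C where C: "\<And>y. y \<in> - U \<Longrightarrow> open (C y) \<and> closed (C y) \<and> x \<in> C y \<and> y \<notin> C y"
    by metis
  have "compact (- U)"
    using X(1) U(1) by (metis compact_Int_closed closed_Compl inf_top_left)
  moreover have "- U \<subseteq> (\<Union>y\<in>- U. - C y)" "\<And>y. y \<in> - U \<Longrightarrow> open (- C y)"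
    using C by (auto simp: open_Compl)
  ultimately obtain D where D: "D \<subseteq> - U" "finite D" "- U \<subseteq> (\<Union>y\<in>D. - C y)"
    using compactE_image [of "- U" "- U" "\<lambda>y. - C y"] by blast
  show ?thesis
  proof
    show "open (\<Inter>y\<in>D. C y)" "closed (\<Inter>y\<in>D. C y)" "x \<in> (\<Inter>y\<in>D. C y)"
      using C D by (auto intro!: open_INT closed_INT)
    show "(\<Inter>y\<in>D. C y) \<subseteq> U"
      using D(3) by auto
  qed
qed

section \<open>Topology of the suspension of a Stone system\<close>

locale stone_suspension =
  fixes \<phi> :: "'a::t2_space \<Rightarrow> 'a"
  assumes stone: "stone_system \<phi>"
begin

abbreviation Y :: "('a \<times> real) set set" where
  "Y \<equiv> suspension \<phi>"

lemma bij_stone: "bij \<phi>"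
  using stone unfolding stone_system_def homeomorphism_def
  by (metis UNIV_I bij_betw_def inj_on_def)

lemma compact_X: "compact (UNIV :: 'a set)"
  using stone by (simp add: stone_system_def)

lemmas class_eq_iff = susp_class_eq_iff [OF bij_stone]

lemma class_shift: "susp_class \<phi> (zpow \<phi> n x, t - of_int n) = susp_class \<phi> (x, t)"
  using class_eq_iff [of x t "zpow \<phi> n x" "t - of_int n"] by auto

lemma continuous_zpow: "continuous_on UNIV (zpow \<phi> n)"
proof -
  have *: "continuous_on UNIV \<phi>" "continuous_on UNIV (inv_into UNIV \<phi>)"
    using stone by (auto simp: stone_system_def homeomorphism_def)
  have "continuous_on UNIV (f ^^ k)" if "continuous_on UNIV f" for f :: "'a \<Rightarrow> 'a" and k
    by (induction k) (auto intro!: continuous_on_compose2 [OF that])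
  then show ?thesis
    using * by (simp add: zpow_def)
qed

lemmas clopen_nbhd = clopen_neighbourhood [OF compact_X]

lemma totally_disconnected: "connected_component_set UNIV x = {x :: 'a}"
  using stone by (simp add: stone_system_def)

text \<open>The saturation of \<open>W\<close> is a union of preimages under the homeomorphisms of
  the action. Openness of the class map supplies product neighbourhoods in the suspension.\<close>

lemma openin_class_image:
  assumes "open W"
  shows "openin (susp_top \<phi>) (susp_class \<phi> ` W)"
proof -
  have "susp_class \<phi> -` susp_class \<phi> ` W = (\<Union>n. (\<lambda>(x, t). (zpow \<phi> n x, t - of_int n)) -` W)"
  proof -
    have "(x, t) \<in> susp_class \<phi> -` susp_class \<phi> ` W \<longleftrightarrow>
        (\<exists>n. (zpow \<phi> n x, t - of_int n) \<in> W)" for x t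
    proof
      assume "(x, t) \<in> susp_class \<phi> -` susp_class \<phi> ` W"
      then obtain a b where "(a, b) \<in> W" "susp_class \<phi> (x, t) = susp_class \<phi> (a, b)"
        by auto
      then show "\<exists>n. (zpow \<phi> n x, t - of_int n) \<in> W"
        using class_eq_iff by auto
    next
      assume "\<exists>n. (zpow \<phi> n x, t - of_int n) \<in> W"
      then show "(x, t) \<in> susp_class \<phi> -` susp_class \<phi> ` W"
        by (metis class_shift image_eqI vimageI)
    qed
    then show ?thesis
      by (simp add: set_eq_iff)
  qed
  moreover have "open ((\<lambda>(x, t). (zpow \<phi> n x, t - of_int n)) -` W)" for n
  proof (rule open_vimage [OF assms])
    have "continuous_on UNIV (\<lambda>p. (zpow \<phi> n (fst p), snd p - real_of_int n))"
      by (intro continuous_intros continuous_on_compose2 [OF continuous_zpow]) auto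
    then show "continuous_on UNIV (\<lambda>(x, t). (zpow \<phi> n x, t - real_of_int n))"
      by (simp add: case_prod_beta)
  qed
  ultimately show ?thesis
    by (auto simp: openin_susp_top)
qed

text \<open>Time and point both depend on a parameter in \<open>Z\<close>, which covers the flow at
  a fixed time, the map with a given displacement and the isotopy from the identity to it. Points
  near \<open>f z\<close> have representatives near a chosen one of \<open>f z\<close> because the
  class map is open.\<close>

lemma continuous_map_flow:
  assumes T: "continuous_map Z euclideanreal T" and f: "continuous_map Z (susp_top \<phi>) f"
  shows "continuous_map Z (susp_top \<phi>) (\<lambda>z. susp_flow (T z) (f z))"
  unfolding continuous_map_eq_topcontinuous_at topcontinuous_at_def
proof (intro ballI conjI allI impI)
  fix z assume z: "z \<in> topspace Z"
  show "z \<in> topspace Z" by fact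
  have fY: "f z \<in> Y" if "z \<in> topspace Z" for z
    using continuous_map_funspace [OF f] that by auto
  then show "(\<lambda>z. susp_flow (T z) (f z)) \<in> topspace Z \<rightarrow> topspace (susp_top \<phi>)"
    by simp
  fix U assume "openin (susp_top \<phi>) U \<and> susp_flow (T z) (f z) \<in> U"
  then have U: "open (susp_class \<phi> -` U)" "susp_flow (T z) (f z) \<in> U"
    by (auto simp: openin_susp_top)
  obtain x s where xs: "f z = susp_class \<phi> (x, s)"
    using fY [OF z] by (rule suspensionE)
  then have "(x, s + T z) \<in> susp_class \<phi> -` U"
    using U by (simp add: susp_flow_class)
  then obtain A B where AB: "open A" "open B" "x \<in> A" "s + T z \<in> B" "A \<times> B \<subseteq> susp_class \<phi> -` U"
    using U(1) by (metis open_prod_elim mem_Sigma_iff)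
  then obtain e where e: "e > 0" "ball (s + T z) e \<subseteq> B"
    by (meson open_contains_ball)
  define V where "V = {w \<in> topspace Z. T w \<in> ball (T z) (e/2)} \<inter>
      {w \<in> topspace Z. f w \<in> susp_class \<phi> ` (A \<times> ball s (e/2))}"
  have "openin Z V"
    unfolding V_def using AB
    by (intro openin_Int openin_continuous_map_preimage [OF T]
        openin_continuous_map_preimage [OF f] openin_class_image open_Times) auto
  moreover have "z \<in> V"
    using z e AB by (auto simp: V_def xs)
  moreover have "susp_flow (T w) (f w) \<in> U" if w: "w \<in> V" for w
  proof -
    obtain a b where ab: "a \<in> A" "b \<in> ball s (e/2)" "f w = susp_class \<phi> (a, b)"
      using w by (auto simp: V_def)
    moreover have "T w \<in> ball (T z) (e/2)"
      using w by (simp add: V_def)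
    ultimately have "b + T w \<in> ball (s + T z) e"
      using dist_triangle_add [of s "T z" b "T w"] by (auto simp: dist_real_def)
    then have "(a, b + T w) \<in> A \<times> B"
      using ab(1) e(2) by auto
    then show ?thesis
      using AB(5) ab(3) by (auto simp: susp_flow_class)
  qed
  ultimately show "\<exists>V. openin Z V \<and> z \<in> V \<and> (\<forall>y\<in>V. susp_flow (T y) (f y) \<in> U)"
    by blast
qed

text \<open>The compact set \<open>X \<times> [0,1]\<close> meets every orbit: shift
  \<open>t\<close> by its integer part.\<close>

lemma compact_space_susp: "compact_space (susp_top \<phi>)"
proof -
  have "susp_class \<phi> ` (UNIV \<times> {0..1}) = Y"
  proof -
    have "susp_class \<phi> (x, t) \<in> susp_class \<phi> ` (UNIV \<times> {0..1})" for x and t :: real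
    proof -
      have "(zpow \<phi> \<lfloor>t\<rfloor> x, t - of_int \<lfloor>t\<rfloor>) \<in> UNIV \<times> {0..1}"
        by simp linarith
      then have "susp_class \<phi> (zpow \<phi> \<lfloor>t\<rfloor> x, t - of_int \<lfloor>t\<rfloor>) \<in> susp_class \<phi> ` (UNIV \<times> {0..1})"
        by (rule imageI)
      then show ?thesis
        by (simp only: class_shift)
    qed
    then show ?thesis
      by (auto elim!: suspensionE)
  qed
  moreover have "compactin euclidean ((UNIV :: 'a set) \<times> {0..1::real})"
    by (simp add: compact_Times compact_X)
  ultimately show ?thesis
    using image_compactin [OF _ quotient_imp_continuous_map [OF quotient_map_susp_class]]
    by (metis compact_space_def topspace_susp_top)
qed

lemma suspension_unit_interval:
  assumes "y \<in> Y"
  obtains x t where "y = susp_class \<phi> (x, t)" "t \<in> {0..<1}"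
proof -
  obtain x t where "y = susp_class \<phi> (x, t)"
    using assms by (rule suspensionE)
  then have "y = susp_class \<phi> (zpow \<phi> \<lfloor>t\<rfloor> x, t - of_int \<lfloor>t\<rfloor>)"
    by (simp add: class_shift)
  moreover have "t - of_int \<lfloor>t\<rfloor> \<in> {0..<1}"
    by (simp, linarith)
  ultimately show ?thesis
    using that by blast
qed

lemma continuous_on_class_comp:
  "continuous_map (susp_top \<phi>) euclidean f \<Longrightarrow> continuous_on UNIV (\<lambda>p. f (susp_class \<phi> p))"
  for f :: "('a \<times> real) set \<Rightarrow> 'b::topological_space"
  by (simp add: continuous_map_susp_top_iff o_def)

lemma susp_bounded:
  assumes "continuous_map (susp_top \<phi>) euclideanreal f"
  obtains B where "\<And>y. y \<in> Y \<Longrightarrow> \<bar>f y\<bar> \<le> B"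
proof -
  have "compact (f ` Y)"
    using image_compactin [OF _ assms] compact_space_susp
    by (metis compact_space_def compactin_euclidean_iff topspace_susp_top)
  then show ?thesis
    using compact_imp_bounded bounded_iff that by (metis image_eqI real_norm_def)
qed

text \<open>This takes the place of uniform continuity, for the suspension carries no metric.
  Continuity in \<open>s\<close> at 0 is uniform over the compact set
  \<open>X \<times> [0,1]\<close>, and every class has a representative there.\<close>

lemma uniform_along_flow:
  assumes f: "continuous_map (susp_top \<phi>) euclideanreal f" and "e > 0"
  obtains d where "d > 0" "\<And>y s. y \<in> Y \<Longrightarrow> \<bar>s\<bar> < d \<Longrightarrow> \<bar>f (susp_flow s y) - f y\<bar> < e"
proof -
  define F where "F = (\<lambda>(s, x, t). f (susp_class \<phi> (x, t + s)))"
  have "continuous_on UNIV F"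
    unfolding F_def case_prod_beta
    by (rule continuous_on_compose2 [OF continuous_on_class_comp [OF f]]) (auto intro!: continuous_intros)
  then have "continuous_on (UNIV \<times> (UNIV \<times> {0..1})) F"
    by (rule continuous_on_subset) auto
  moreover have "compact ((UNIV :: 'a set) \<times> {0..1::real})"
    by (simp add: compact_Times compact_X)
  ultimately obtain V where V: "(0::real) \<in> V" "open V"
    "\<forall>s\<in>V \<inter> UNIV. \<forall>p\<in>UNIV \<times> {0..1}. dist (F (s, p)) (F (0, p)) \<le> e/2"
    using continuous_on_prod_compactE [of UNIV "UNIV \<times> {0..1}" F 0 "e/2"] \<open>e > 0\<close> by auto
  obtain d where d: "d > 0" "ball 0 d \<subseteq> V"
    using V by (meson open_contains_ball)
  show ?thesis
  proof (rule that [OF d(1)])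
    fix y s assume y: "y \<in> Y" and s: "\<bar>s\<bar> < d"
    obtain x t where xt: "y = susp_class \<phi> (x, t)" "t \<in> {0..<1}"
      using suspension_unit_interval [OF y] .
    have "s \<in> V"
      using s d by (auto simp: dist_real_def)
    then have "dist (F (s, x, t)) (F (0, x, t)) \<le> e/2"
      using V(3) xt by auto
    then show "\<bar>f (susp_flow s y) - f y\<bar> < e"
      using \<open>e > 0\<close> by (simp add: F_def xt susp_flow_class dist_real_def)
  qed
qed

end

section \<open>Displacement functions\<close>

text \<open>\<open>Arg\<close> jumps on the negative reals; two points of the unit circle have their
  quotient there only if they are antipodal, at distance 2.\<close>

lemma not_nonpos_Reals_of_dist:
  fixes u v :: complex
  assumes "norm u = 1" "norm v = 1" "dist u v < 2"
  shows "u / v \<notin> \<real>\<^sub>\<le>\<^sub>0"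
proof
  assume "u / v \<in> \<real>\<^sub>\<le>\<^sub>0"
  then obtain r where r: "r \<le> 0" "u / v = of_real r"
    by (auto elim!: nonpos_Reals_cases)
  have "norm (u / v) = 1"
    by (simp add: norm_divide assms)
  then have "r = - 1"
    using r by simp
  moreover have "v \<noteq> 0"
    using assms by auto
  ultimately have "u = - v"
    using r by (simp add: field_simps)
  then have "dist u v = norm (2 * v)"
    by (simp add: dist_norm norm_minus_commute flip: mult_2)
  then show False
    using assms by (simp add: norm_mult)
qed

lemma norm_circ: "y \<in> suspension \<phi> \<Longrightarrow> norm (circ y) = 1"
  by (erule suspensionE) simp

text \<open>For the inverse \<open>E\<close> of a family of increasing lifts,
  \<open>E x u < a\<close> unfolds to a condition on the lift at the fixed time \<open>a\<close>;
  preimages of rays are therefore easier to handle than those of arbitrary open sets.\<close>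

lemma continuous_on_realI_rays:
  fixes f :: "'b::topological_space \<Rightarrow> real"
  assumes "\<And>a. open {x. f x < a}" "\<And>a. open {x. a < f x}"
  shows "continuous_on UNIV f"
proof -
  have "(f \<longlongrightarrow> f x) (at x)" for x
  proof (rule order_tendstoI)
    fix a assume "a < f x"
    then show "\<forall>\<^sub>F y in at x. a < f y"
      unfolding eventually_at_topological
      by (intro exI [of _ "{y. a < f y}"]) (simp add: assms)
  next
    fix a assume "f x < a"
    then show "\<forall>\<^sub>F y in at x. f y < a"
      unfolding eventually_at_topological
      by (intro exI [of _ "{y. f y < a}"]) (simp add: assms)
  qed
  then show ?thesis
    by (simp add: continuous_on_def)
qed

context stone_suspension
begin

text \<open>A path avoiding the antipode of its starting point in the circle stays in one product of \<open>X\<close>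
  with an interval of length 1, where its first coordinate is constant because \<open>X\<close> is totally
  disconnected.\<close>

lemma flow_path_step:
  fixes a b :: real
  assumes c: "continuous_map (top_of_set {a..b}) (susp_top \<phi>) c" and "a \<le> b"
    and near: "\<And>t. t \<in> {a..b} \<Longrightarrow> dist (circ (c t)) (circ (c a)) < 2"
  shows "c b = susp_flow (Arg (circ (c b) / circ (c a)) / (2 * pi)) (c a)"
proof -
  have cY: "c t \<in> Y" if "t \<in> {a..b}" for t
    using continuous_map_funspace [OF c] that by auto
  obtain x0 s0 where x0: "c a = susp_class \<phi> (x0, s0)"
    using cY [of a] \<open>a \<le> b\<close> by (auto elim: suspensionE)
  define W where "W = (\<lambda>C. susp_class \<phi> ` (C \<times> ball s0 (1/2)))"
  have inW: "c t \<in> W UNIV" if t: "t \<in> {a..b}" for t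
  proof -
    obtain x s where xs: "c t = susp_class \<phi> (x, s)"
      using cY [OF t] by (rule suspensionE)
    \<comment> \<open>This shift puts the time into \<open>[s0 - 1/2, s0 + 1/2)\<close>. The left
      end would be antipodal to \<open>s0\<close> on the circle, which \<open>near\<close>
      excludes.\<close>
    define n where "n = \<lfloor>s - s0 + 1/2\<rfloor>"
    have ct: "c t = susp_class \<phi> (zpow \<phi> n x, s - of_int n)"
      by (simp add: xs class_shift)
    have "s - of_int n \<noteq> s0 - 1/2"
    proof
      assume "s - of_int n = s0 - 1/2"
      then have "2 * pi * (s - of_int n) = 2 * pi * s0 - pi"
        by (simp add: right_diff_distrib)
      then have "circ (c t) = cis (2 * pi * s0 - pi)"
        using ct by simp
      also have "\<dots> = - circ (c a)"
        by (simp add: x0 flip: cis_divide)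
      finally have "dist (circ (c t)) (circ (c a)) = norm (2 * circ (c a))"
        by (simp add: dist_norm norm_minus_commute flip: mult_2)
      also have "\<dots> = 2"
        using norm_circ [OF cY, of a] \<open>a \<le> b\<close> by (simp add: norm_mult)
      finally show False
        using near [OF t] by simp
    qed
    moreover have "s0 - 1/2 \<le> s - of_int n" "s - of_int n < s0 + 1/2"
      unfolding n_def by linarith+
    ultimately have "s - of_int n \<in> ball s0 (1/2)"
      unfolding mem_ball dist_real_def by linarith
    then show ?thesis
      using ct by (auto simp: W_def)
  qed
  have unique: "x = x' \<and> s = s'" if "susp_class \<phi> (x, s) = susp_class \<phi> (x', s')" "s \<in> ball s0 (1/2)"
    "s' \<in> ball s0 (1/2)" for x x' s s'
  proof -
    have "\<exists>n. x' = zpow \<phi> n x \<and> s' = s - of_int n"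
      using class_eq_iff that(1) by simp
    then obtain n where n: "x' = zpow \<phi> n x" "s' = s - of_int n"
      by blast
    moreover have "\<bar>s' - s\<bar> < 1"
      using that(2,3) unfolding mem_ball dist_real_def by linarith
    ultimately have "n = 0"
      by auto
    then show ?thesis
      using n by simp
  qed
  \<comment> \<open>A path that ends outside \<open>C\<close> would split \<open>{a..b}\<close> into
    two non-empty open sets, the times spent over \<open>C\<close> and over its complement;
    \<open>unique\<close> makes them disjoint.\<close>
  have inWC: "c b \<in> W C" if C: "open C" "closed C" "x0 \<in> C" for C
  proof (rule ccontr)
    assume not: "c b \<notin> W C"
    define E where "E = (\<lambda>C. {t \<in> {a..b}. c t \<in> W C})"
    have "openin (top_of_set {a..b}) (E C')" if "open C'" for C'
      using openin_continuous_map_preimage [OF c openin_class_image [of "C' \<times> ball s0 (1/2)"]] that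
      by (simp add: E_def W_def open_Times)
    then have op: "openin (top_of_set {a..b}) (E C)" "openin (top_of_set {a..b}) (E (- C))"
      using C by (auto simp: open_Compl)
    have "W UNIV = W C \<union> W (- C)"
      by (auto simp: W_def)
    then have "{a..b} \<subseteq> E C \<union> E (- C)"
      using inW unfolding E_def by blast
    moreover have "W C \<inter> W (- C) = {}"
      by (auto simp: W_def dest: unique)
    then have "E C \<inter> E (- C) = {}"
      by (auto simp: E_def)
    moreover have "a \<in> E C"
      using x0 C \<open>a \<le> b\<close> by (auto simp: E_def W_def)
    moreover have "b \<in> E (- C)"
      using not inW [of b] \<open>a \<le> b\<close> \<open>W UNIV = W C \<union> W (- C)\<close> by (auto simp: E_def)
    moreover have "connected {a..b}"
      by simp
    ultimately show False
      using op unfolding connected_openin by blast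
  qed
  obtain x1 s1 where x1: "c b = susp_class \<phi> (x1, s1)" "s1 \<in> ball s0 (1/2)"
    using inW [of b] \<open>a \<le> b\<close> by (auto simp: W_def)
  have "x1 \<in> C" if C: "open C" "closed C" "x0 \<in> C" for C
    using inWC [OF that] x1 by (auto simp: W_def dest: unique)
  then have "x1 = x0"
    using clopen_separation [OF compact_X totally_disconnected, of x0 x1] by metis
  have "circ (c b) / circ (c a) = cis (2 * pi * (s1 - s0))"
    by (simp add: x0 x1 cis_divide algebra_simps)
  moreover have "2 * pi * (s1 - s0) \<in> {-pi<..pi}"
  proof -
    have "\<bar>s1 - s0\<bar> < 1/2"
      using x1 by (simp add: dist_real_def abs_minus_commute)
    then have "s1 - s0 < 1/2" "- (1/2) < s1 - s0"
      by linarith+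
    from this [THEN mult_strict_left_mono, of "2 * pi"] show ?thesis
      by simp
  qed
  ultimately have "Arg (circ (c b) / circ (c a)) / (2 * pi) = s1 - s0"
    by (simp add: Arg_cis)
  then show ?thesis
    by (simp add: x0 x1 \<open>x1 = x0\<close> susp_flow_class)
qed

text \<open>Over times closer than \<open>d\<close> the circle coordinate of every point moves by at
  most 1, uniformly by compactness, which stays below the antipodal distance 2. Hence
  \<open>flow_path_step\<close> applies on each of \<open>N\<close> intervals and every summand
  \<open>a i\<close> is continuous; the sum records the winding that a single argument would
  lose.\<close>

lemma isotopy_displacement:
  assumes "homotopic_with P (susp_top \<phi>) (susp_top \<phi>) id g"
  obtains \<tau> where "displacement \<phi> g \<tau>"
proof -
  obtain h where h: "continuous_map (prod_topology (top_of_set {0..1::real}) (susp_top \<phi>)) (susp_top \<phi>) h"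
    "\<And>y. h (0, y) = y" "\<And>y. h (1, y) = g y"
    using assms by (auto simp: homotopic_with_def)
  \<comment> \<open>Clamping extends the isotopy to all times, so that \<open>G\<close> is
    continuous on a full product and compactness can be applied at \<open>s = 0\<close>.\<close>
  define clamp :: "real \<Rightarrow> real" where "clamp r = max 0 (min 1 r)" for r
  define G where "G = (\<lambda>(s, t, p). circ (h (clamp (t + s), susp_class \<phi> p)))"
  have "continuous_map euclidean (prod_topology (top_of_set {0..1::real}) (susp_top \<phi>))
     (\<lambda>q :: real \<times> real \<times> 'a \<times> real. (clamp (fst (snd q) + fst q), susp_class \<phi> (snd (snd q))))"
  proof (intro continuous_map_pairedI)
    show "continuous_map euclidean (top_of_set {0..1::real})
        (\<lambda>q :: real \<times> real \<times> 'a \<times> real. clamp (fst (snd q) + fst q))"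
      unfolding clamp_def continuous_map_in_subtopology
      by (auto intro!: continuous_intros)
    have "continuous_map euclidean euclidean (\<lambda>q :: real \<times> real \<times> 'a \<times> real. snd (snd q))"
      by (auto intro!: continuous_intros)
    from continuous_map_compose [OF this quotient_imp_continuous_map [OF quotient_map_susp_class [of \<phi>]]]
    show "continuous_map euclidean (susp_top \<phi>) (\<lambda>q :: real \<times> real \<times> 'a \<times> real. susp_class \<phi> (snd (snd q)))"
      by (simp add: o_def)
  qed
  from continuous_map_compose [OF continuous_map_compose [OF this h(1)] continuous_map_circ]
  have "continuous_on UNIV G"
    by (simp add: G_def o_def case_prod_beta)
  then have "continuous_on (UNIV \<times> ({0..1} \<times> UNIV \<times> {0..1})) G"
    by (rule continuous_on_subset) auto
  moreover have "compact ({0..1::real} \<times> (UNIV :: 'a set) \<times> {0..1::real})"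
    by (simp add: compact_Times compact_X)
  ultimately obtain V where V: "(0::real) \<in> V" "open V"
    "\<forall>s\<in>V \<inter> UNIV. \<forall>p\<in>{0..1} \<times> UNIV \<times> {0..1}. dist (G (s, p)) (G (0, p)) \<le> 1"
    using continuous_on_prod_compactE [of UNIV "{0..1} \<times> UNIV \<times> {0..1}" G 0 1] by auto
  obtain d where d: "d > 0" "ball 0 d \<subseteq> V"
    using V by (meson open_contains_ball)
  have near: "dist (circ (h (t', y))) (circ (h (t, y))) \<le> 1"
    if t: "t \<in> {0..1}" "t' \<in> {0..1}" "\<bar>t' - t\<bar> < d" and y: "y \<in> Y" for t t' y
  proof -
    obtain x u where xu: "y = susp_class \<phi> (x, u)" "u \<in> {0..<1}"
      using suspension_unit_interval [OF y] .
    have "t' - t \<in> V"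
      using t d by (auto simp: dist_real_def)
    then have "dist (G (t' - t, t, x, u)) (G (0, t, x, u)) \<le> 1"
      using V(3) t xu by auto
    moreover have "clamp t' = t'" "clamp t = t"
      using t by (auto simp: clamp_def)
    ultimately show ?thesis
      by (simp add: G_def xu)
  qed
  obtain N where N: "N > 0" "1 / real N < d"
    using d(1) by (metis nat_approx_posE of_nat_0_less_iff zero_less_Suc)
  define a where "a i y = Arg (circ (h (real (Suc i) / N, y)) / circ (h (real i / N, y))) / (2 * pi)" for i y
  define \<tau> where "\<tau> k y = (\<Sum>i<k. a i y)" for k y
  have unit: "real i / N \<in> {0..1}" if "i \<le> N" for i
    using that N by simp
  have hY: "h (t, y) \<in> Y" if "t \<in> {0..1}" "y \<in> Y" for t y
    using continuous_map_funspace [OF h(1)] that by auto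
  have gap: "real (Suc i) / N - real i / N = 1 / N" for i
    using N by (simp add: field_simps)
  have flow: "h (real k / N, y) = susp_flow (\<tau> k y) y" if "k \<le> N" "y \<in> Y" for k y
    using that(1)
  proof (induction k)
    case 0
    then show ?case
      by (simp add: \<tau>_def h)
  next
    case (Suc k)
    have "0 \<le> real k / N" "real (Suc k) / N \<le> 1"
      using unit [of "Suc k"] Suc.prems by auto
    then have sub: "{real k / N..real (Suc k) / N} \<subseteq> {0..1}"
      by (intro subsetI) (simp only: atLeastAtMost_iff, linarith)
    have "continuous_map (top_of_set {real k / N..real (Suc k) / N})
        (prod_topology (top_of_set {0..1::real}) (susp_top \<phi>)) (\<lambda>t. (t, y))"
    proof (intro continuous_map_pairedI)
      show "continuous_map (top_of_set {real k / N..real (Suc k) / N}) (top_of_set {0..1}) (\<lambda>t. t)"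
        by (intro continuous_map_into_subtopology continuous_map_into_fulltopology [OF continuous_map_id [unfolded id_def]])
          (use sub in \<open>simp only: topspace_euclidean_subtopology Pi_iff, blast\<close>)
      show "continuous_map (top_of_set {real k / N..real (Suc k) / N}) (susp_top \<phi>) (\<lambda>t. y)"
        using that(2) by simp
    qed
    from continuous_map_compose [OF this h(1)]
    have cont: "continuous_map (top_of_set {real k / N..real (Suc k) / N}) (susp_top \<phi>) (\<lambda>t. h (t, y))"
      by (simp add: o_def)
    have "h (real (Suc k) / N, y) = susp_flow (a k y) (h (real k / N, y))"
      unfolding a_def
    proof (rule flow_path_step [OF cont])
      show "real k / N \<le> real (Suc k) / N"
        by (simp add: divide_right_mono)
      fix t assume t: "t \<in> {real k / N..real (Suc k) / N}"
      then have "\<bar>t - real k / N\<bar> < d"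
        using gap [of k] N(2) by auto
      moreover have "real k / N \<in> {0..1}"
        using unit Suc.prems by simp
      ultimately have "dist (circ (h (t, y))) (circ (h (real k / N, y))) \<le> 1"
        using near that(2) sub t by blast
      then show "dist (circ (h (t, y))) (circ (h (real k / N, y))) < 2"
        by simp
    qed
    then show ?case
      using Suc by (simp add: \<tau>_def susp_flow_add add.commute)
  qed
  have cont_a: "continuous_map (susp_top \<phi>) euclideanreal (a i)" if "i < N" for i
  proof -
    have cont: "continuous_on UNIV (\<lambda>p. circ (h (r, susp_class \<phi> p)))" if "r \<in> {0..1}" for r
    proof -
      have "continuous_map (susp_top \<phi>) (susp_top \<phi>) (h \<circ> Pair r)"
        using continuous_map_o_Pair [OF h(1)] that by simp
      from continuous_map_compose [OF this continuous_map_circ] show ?thesis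
        by (simp add: continuous_map_susp_top_iff o_def)
    qed
    have "circ (h (real (Suc i) / N, y)) / circ (h (real i / N, y)) \<notin> \<real>\<^sub>\<le>\<^sub>0"
      if "y \<in> Y" for y
    proof (rule not_nonpos_Reals_of_dist)
      have u: "real (Suc i) / N \<in> {0..1}" "real i / N \<in> {0..1}"
        using unit \<open>i < N\<close> by auto
      show "norm (circ (h (real (Suc i) / N, y))) = 1" "norm (circ (h (real i / N, y))) = 1"
        using hY [OF u(1) that] hY [OF u(2) that] by (simp_all add: norm_circ)
      have "dist (circ (h (real (Suc i) / N, y))) (circ (h (real i / N, y))) \<le> 1"
        using near [OF u(2,1) _ that] gap [of i] N(2) by simp
      then show "dist (circ (h (real (Suc i) / N, y))) (circ (h (real i / N, y))) < 2"
        by simp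
    qed
    moreover have "circ (h (r, y)) \<noteq> 0" if "r \<in> {0..1}" "y \<in> Y" for r y
      using norm_circ [OF hY [OF that]] by auto
    ultimately have "continuous_on UNIV (\<lambda>p. a i (susp_class \<phi> p))"
      unfolding a_def using that unit [of i] unit [of "Suc i"]
      by (intro continuous_intros cont) auto
    then show ?thesis
      by (simp add: continuous_map_susp_top_iff o_def)
  qed
  have "continuous_map (susp_top \<phi>) euclideanreal (\<tau> N)"
    unfolding \<tau>_def by (intro continuous_map_sum) (use cont_a in auto)
  moreover have "g y = susp_flow (\<tau> N y) y" if "y \<in> Y" for y
    using flow [of N y] that h(3) N by simp
  ultimately show ?thesis
    using that by (auto simp: displacement_def)
qed

lemma H0_displacement:
  assumes "g \<in> H0 \<phi>"
  obtains \<tau> where "displacement \<phi> g \<tau>"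
  using assms isotopy_displacement by (auto simp: H0_def)

section \<open>Lifts to the flow lines and the description of \<open>H0\<close>\<close>

lemma continuous_flow_line:
  assumes "continuous_map (susp_top \<phi>) euclideanreal \<tau>"
  shows "continuous_on UNIV (\<lambda>t. t + \<tau> (susp_class \<phi> (x, t)))"
proof -
  have "continuous_on UNIV (\<lambda>p. \<tau> (susp_class \<phi> p))"
    using assms by (simp add: continuous_map_susp_top_iff o_def)
  then have "continuous_on UNIV (\<lambda>t. \<tau> (susp_class \<phi> (x, t)))"
    by (rule continuous_on_compose2) (auto intro!: continuous_intros)
  then show ?thesis
    by (intro continuous_intros)
qed

text \<open>An injective continuous lift is monotone, and bounded displacement sends it to minus
  infinity on the left, which excludes a decrease.\<close>

lemma displacement_strict_mono:
  assumes "inj_on g Y" and \<tau>: "displacement \<phi> g \<tau>"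
  shows "strict_mono (\<lambda>t. t + \<tau> (susp_class \<phi> (x, t)))"
proof -
  define F where "F t = t + \<tau> (susp_class \<phi> (x, t))" for t
  have cont: "continuous_on UNIV F"
    unfolding F_def using continuous_flow_line \<tau> by (auto simp: displacement_def)
  obtain B where B: "\<And>y. y \<in> Y \<Longrightarrow> \<bar>\<tau> y\<bar> \<le> B"
    using susp_bounded \<tau> unfolding displacement_def by metis
  have g: "g (susp_class \<phi> (x, t)) = susp_class \<phi> (x, F t)" for t
    using \<tau> by (simp add: displacement_def susp_flow_class F_def)
  \<comment> \<open>On a periodic flow line equal classes do not give \<open>s = t\<close>. They do
    give equal values of \<open>\<tau>\<close>, and then \<open>F s = F t\<close> forces
    \<open>s = t\<close>.\<close>
  have inj: "s = t" if "F s = F t" for s t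
  proof -
    have "susp_class \<phi> (x, s) = susp_class \<phi> (x, t)"
      using assms(1) g that by (metis inj_onD susp_class_mem)
    then show ?thesis
      using that by (simp add: F_def)
  qed
  have "F s < F t" if "s < t" for s t
  proof (rule ccontr)
    assume "\<not> F s < F t"
    \<comment> \<open>Then \<open>F s' \<le> s' + B \<le> F t \<le> F s\<close>, so the value
      \<open>F t\<close> is also taken somewhere to the left of \<open>s\<close>.\<close>
    define s' where "s' = min s (F t - B)"
    have "F s' \<le> F t"
      using B [of "susp_class \<phi> (x, s')"] by (simp add: F_def s'_def)
    then obtain u where "u \<le> s" "F u = F t"
      using IVT' [of F s' "F t" s] \<open>\<not> F s < F t\<close> continuous_on_subset [OF cont]
      by (auto simp: s'_def)
    then show False
      using inj [of u t] that by simp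
  qed
  then show ?thesis
    by (simp add: strict_mono_def F_def)
qed

text \<open>Inverting the lifts line by line keeps their equivariance, so \<open>E x u - u\<close>
  descends to the suspension. Joint continuity of \<open>E\<close> comes from monotonicity:
  \<open>E x u < a\<close> means \<open>u < F x a\<close>, an open condition on
  \<open>(x, u)\<close>.\<close>

lemma displacement_inverse:
  assumes \<tau>: "continuous_map (susp_top \<phi>) euclideanreal \<tau>"
    and mono: "\<And>x. strict_mono (\<lambda>t. t + \<tau> (susp_class \<phi> (x, t)))"
  obtains \<sigma> where "continuous_map (susp_top \<phi>) euclideanreal \<sigma>"
    "\<And>y. y \<in> Y \<Longrightarrow> \<sigma> (susp_flow (\<tau> y) y) = - \<tau> y"
    "\<And>y. y \<in> Y \<Longrightarrow> \<tau> (susp_flow (\<sigma> y) y) = - \<sigma> y"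
proof -
  define F where "F x t = t + \<tau> (susp_class \<phi> (x, t))" for x t
  have cont: "continuous_on UNIV (F x)" for x
    unfolding F_def using continuous_flow_line [OF \<tau>] .
  have cont2: "continuous_on UNIV (\<lambda>x. F x t)" for t
    unfolding F_def
    by (intro continuous_intros continuous_on_compose2 [OF continuous_on_class_comp [OF \<tau>]]) auto
  obtain B where B: "\<And>y. y \<in> Y \<Longrightarrow> \<bar>\<tau> y\<bar> \<le> B"
    using susp_bounded [OF \<tau>] by blast
  have less: "F x s < F x t \<longleftrightarrow> s < t" for x s t
    using strict_mono_less [OF mono [of x], of s t] by (simp add: F_def)
  have eq: "F x s = F x t \<longleftrightarrow> s = t" for x s t
    using less by (metis linorder_neq_iff)
  have "\<exists>t. F x t = u" for x u
  proof -
    have "F x (u - B) \<le> u" "u \<le> F x (u + B)"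
      using B [of "susp_class \<phi> (x, u - B)"] B [of "susp_class \<phi> (x, u + B)"] by (auto simp: F_def)
    moreover have "u - B \<le> u + B"
      using B [of "susp_class \<phi> (x, 0)"] by simp
    ultimately show ?thesis
      using IVT' [of "F x" "u - B" u "u + B"] continuous_on_subset [OF cont] by auto
  qed
  then obtain E where E: "\<And>x u. F x (E x u) = u"
    by metis
  have EF: "E x (F x t) = t" for x t
    using E [of x "F x t"] eq by simp
  define S where "S = (\<lambda>(x, u). E x u - u)"
  have "susp_class \<phi> (\<phi> x, t - 1) = susp_class \<phi> (x, t)" for x t
    using class_shift [of 1 x t] by simp
  then have "F (\<phi> x) (t - 1) = F x t - 1" for x t
    by (simp add: F_def)
  then have "E (\<phi> x) (u - 1) = E x u - 1" for x u
    by (metis E EF)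
  then have S: "susp_descend S (susp_class \<phi> (x, t)) = S (x, t)" for x t
    by (intro susp_descend_class zpow_invariantI [OF bij_stone]) (simp add: S_def)
  have "continuous_on UNIV (\<lambda>p. E (fst p) (snd p))"
  proof (rule continuous_on_realI_rays)
    fix a
    have "E x u < a \<longleftrightarrow> u < F x a" "a < E x u \<longleftrightarrow> F x a < u" for x u
      using less [of x "E x u" a] less [of x a "E x u"] by (simp_all add: E)
    moreover have c: "continuous_on UNIV (\<lambda>p :: 'a \<times> real. F (fst p) a)"
      by (rule continuous_on_compose2 [OF cont2]) (auto intro!: continuous_intros)
    ultimately show "open {p. E (fst p) (snd p) < a}" "open {p. a < E (fst p) (snd p)}"
      by (auto intro!: open_Collect_less continuous_intros)
  qed
  then have "continuous_on UNIV S"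
    unfolding S_def case_prod_beta by (intro continuous_intros)
  moreover have "susp_descend S \<circ> susp_class \<phi> = S"
    using S by (auto simp: fun_eq_iff)
  ultimately have "continuous_map (susp_top \<phi>) euclideanreal (susp_descend S)"
    by (simp add: continuous_map_susp_top_iff)
  moreover have "susp_descend S (susp_flow (\<tau> y) y) = - \<tau> y" if "y \<in> Y" for y
  proof -
    obtain x t where y: "y = susp_class \<phi> (x, t)"
      using \<open>y \<in> Y\<close> by (rule suspensionE)
    have F: "t + \<tau> y = F x t"
      by (simp add: F_def y)
    have "susp_descend S (susp_flow (\<tau> y) y) = S (x, F x t)"
      unfolding F [symmetric] y susp_flow_class by (rule S)
    then show ?thesis
      by (simp add: S_def EF) (simp add: F_def y)
  qed
  moreover have "\<tau> (susp_flow (susp_descend S y) y) = - susp_descend S y" if "y \<in> Y" for y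
  proof -
    obtain x t where y: "y = susp_class \<phi> (x, t)"
      using \<open>y \<in> Y\<close> by (rule suspensionE)
    show ?thesis
      unfolding y susp_flow_class S using E [of x t] by (simp add: S_def F_def)
  qed
  ultimately show ?thesis
    using that by blast
qed

lemma homeomorphic_map_flow:
  assumes \<tau>: "continuous_map (susp_top \<phi>) euclideanreal \<tau>"
    and mono: "\<And>x. strict_mono (\<lambda>t. t + \<tau> (susp_class \<phi> (x, t)))"
  shows "homeomorphic_map (susp_top \<phi>) (susp_top \<phi>) (\<lambda>y. susp_flow (\<tau> y) y)"
proof -
  obtain \<sigma> where \<sigma>: "continuous_map (susp_top \<phi>) euclideanreal \<sigma>"
    "\<And>y. y \<in> Y \<Longrightarrow> \<sigma> (susp_flow (\<tau> y) y) = - \<tau> y"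
    "\<And>y. y \<in> Y \<Longrightarrow> \<tau> (susp_flow (\<sigma> y) y) = - \<sigma> y"
    using displacement_inverse [OF assms] by blast
  have "homeomorphic_maps (susp_top \<phi>) (susp_top \<phi>) (\<lambda>y. susp_flow (\<tau> y) y) (\<lambda>y. susp_flow (\<sigma> y) y)"
    unfolding homeomorphic_maps_def using \<sigma>
    by (auto intro!: continuous_map_flow \<tau> simp: susp_flow_add)
  then show ?thesis
    using homeomorphic_map_maps by blast
qed

text \<open>The isotopy scales the displacement by \<open>s\<close>. Its lifts are convex
  combinations of the identity and the increasing lift of \<open>g\<close>, hence again
  increasing.\<close>

lemma H0_intro:
  assumes ext: "g \<in> extensional Y" and \<tau>: "displacement \<phi> g \<tau>"
    and mono: "\<And>x. strict_mono (\<lambda>t. t + \<tau> (susp_class \<phi> (x, t)))"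
  shows "g \<in> H0 \<phi>"
proof -
  have cont: "continuous_map (susp_top \<phi>) euclideanreal \<tau>"
    and g: "\<And>y. y \<in> Y \<Longrightarrow> g y = susp_flow (\<tau> y) y"
    using \<tau> by (auto simp: displacement_def)
  have homeo: "homeomorphic_map (susp_top \<phi>) (susp_top \<phi>) (\<lambda>y. susp_flow (s * \<tau> y) y)"
    if s: "s \<in> {0..1}" for s
  proof (rule homeomorphic_map_flow)
    show "continuous_map (susp_top \<phi>) euclideanreal (\<lambda>y. s * \<tau> y)"
      by (intro continuous_intros cont)
    fix x
    have "t + s * \<tau> (susp_class \<phi> (x, t)) = (1 - s) * t + s * (t + \<tau> (susp_class \<phi> (x, t)))" for t
      by (simp add: algebra_simps)
    moreover have "(1 - s) * t + s * (t + \<tau> (susp_class \<phi> (x, t)))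
         < (1 - s) * u + s * (u + \<tau> (susp_class \<phi> (x, u)))" if "t < u" for t u
    \<comment> \<open>At \<open>s = 0\<close> the lift of \<open>g\<close> drops out and strictness
      comes from the identity alone.\<close>
    proof (cases "s = 0")
      case False
      then have "s * (t + \<tau> (susp_class \<phi> (x, t))) < s * (u + \<tau> (susp_class \<phi> (x, u)))"
        using mono [of x] that s by (auto simp: strict_mono_def)
      moreover have "(1 - s) * t \<le> (1 - s) * u"
        using that s by (intro mult_left_mono) auto
      ultimately show ?thesis by linarith
    qed (use that in simp)
    ultimately show "strict_mono (\<lambda>t. t + s * \<tau> (susp_class \<phi> (x, t)))"
      by (simp add: strict_mono_def)
  qed
  have "homotopic_with (homeomorphic_map (susp_top \<phi>) (susp_top \<phi>)) (susp_top \<phi>) (susp_top \<phi>) id g"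
  proof (subst homotopic_with)
    show "homeomorphic_map (susp_top \<phi>) (susp_top \<phi>) h = homeomorphic_map (susp_top \<phi>) (susp_top \<phi>) k"
      if "\<And>x. x \<in> topspace (susp_top \<phi>) \<Longrightarrow> h x = k x" for h k
      using homeomorphic_map_eq that by metis
    let ?h = "\<lambda>p. susp_flow (fst p * \<tau> (snd p)) (snd p)"
    have snd: "continuous_map (prod_topology (top_of_set {0..1}) (susp_top \<phi>)) (susp_top \<phi>)
         (snd :: real \<times> _ \<Rightarrow> _)"
      by (rule continuous_map_snd)
    have fst: "continuous_map (prod_topology (top_of_set {0..1}) (susp_top \<phi>)) euclideanreal fst"
      using continuous_map_into_fulltopology [OF continuous_map_fst] .
    have "continuous_map (prod_topology (top_of_set {0..1}) (susp_top \<phi>)) (susp_top \<phi>) ?h"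
      using continuous_map_compose [OF snd cont]
      by (intro continuous_map_flow continuous_map_real_mult fst snd) (simp add: o_def)
    then show "\<exists>h. continuous_map (prod_topology (top_of_set {0..1::real}) (susp_top \<phi>)) (susp_top \<phi>) h \<and>
       (\<forall>x\<in>topspace (susp_top \<phi>). h (0, x) = id x) \<and> (\<forall>x\<in>topspace (susp_top \<phi>). h (1, x) = g x) \<and>
       (\<forall>t\<in>{0..1}. homeomorphic_map (susp_top \<phi>) (susp_top \<phi>) (\<lambda>x. h (t, x)))"
      using homeo g by - (rule exI [of _ ?h], simp)
  qed
  moreover have "homeomorphic_map (susp_top \<phi>) (susp_top \<phi>) g"
    using homeomorphic_map_eq [OF homeo [of 1]] g by simp
  ultimately show ?thesis
    using ext by (simp add: H0_def)
qed

text \<open>Membership can now be checked without an isotopy: injectivity makes the lifts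
  increasing, which \<open>H0_intro\<close> turns into a homeomorphism isotopic to the
  identity.\<close>

lemma H0_iff:
  "g \<in> H0 \<phi> \<longleftrightarrow> g \<in> extensional Y \<and> inj_on g Y \<and> (\<exists>\<tau>. displacement \<phi> g \<tau>)"
proof
  assume g: "g \<in> H0 \<phi>"
  then have "inj_on g Y"
    by (metis (no_types, lifting) H0_def homeomorphic_imp_injective_map mem_Collect_eq topspace_susp_top)
  then show "g \<in> extensional Y \<and> inj_on g Y \<and> (\<exists>\<tau>. displacement \<phi> g \<tau>)"
    using g H0_displacement by (auto simp: H0_def)
qed (use H0_intro displacement_strict_mono in blast)

section \<open>The group structure of \<open>H0\<close>\<close>

lemma H0_inj_on: "g \<in> H0 \<phi> \<Longrightarrow> inj_on g Y"
  by (simp add: H0_iff)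

lemma H0_extensional: "g \<in> H0 \<phi> \<Longrightarrow> g \<in> extensional Y"
  by (simp add: H0_def)

lemma H0_image: "g \<in> H0 \<phi> \<Longrightarrow> g ` Y = Y"
  using homeomorphic_imp_surjective_map by (fastforce simp: H0_def)

lemma H0_Bij: "g \<in> H0 \<phi> \<Longrightarrow> g \<in> Bij Y"
  by (simp add: Bij_def bij_betw_def H0_inj_on H0_image H0_extensional)

lemma H0_continuous: "g \<in> H0 \<phi> \<Longrightarrow> continuous_map (susp_top \<phi>) (susp_top \<phi>) g"
  by (simp add: H0_def homeomorphic_imp_continuous_map)

lemma displacement_mem: "displacement \<phi> g \<tau> \<Longrightarrow> y \<in> Y \<Longrightarrow> g y \<in> Y"
  by (simp add: displacement_def)

text \<open>Displacements form a cocycle: the time to \<open>h y\<close> plus the time from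
  there.\<close>

lemma displacement_compose:
  assumes "displacement \<phi> g \<tau>" "displacement \<phi> h \<sigma>" "continuous_map (susp_top \<phi>) (susp_top \<phi>) h"
  shows "displacement \<phi> (compose Y g h) (\<lambda>y. \<tau> (h y) + \<sigma> y)"
proof -
  have "continuous_map (susp_top \<phi>) euclideanreal (\<lambda>y. \<tau> (h y))"
    using continuous_map_compose [OF assms(3), of euclideanreal \<tau>] assms(1)
    by (simp add: displacement_def o_def)
  moreover have "g (h y) = susp_flow (\<tau> (h y) + \<sigma> y) y" if "y \<in> Y" for y
    using assms(1,2) that displacement_mem [OF assms(2) that]
    by (simp add: displacement_def susp_flow_add)
  ultimately show ?thesis
    using assms(2) by (auto simp: displacement_def compose_def intro!: continuous_map_add)
qed

text \<open>The flow segment that ends at \<open>y\<close> is run backwards; continuity comes from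
  the inverse homeomorphism \<open>k\<close>.\<close>

lemma displacement_inv:
  assumes g: "g \<in> H0 \<phi>" and "displacement \<phi> g \<tau>"
  shows "displacement \<phi> (restrict (inv_into Y g) Y)
           (\<lambda>y. - \<tau> (inv_into Y g y))"
proof -
  obtain k where k: "homeomorphic_maps (susp_top \<phi>) (susp_top \<phi>) g k"
    using g by (auto simp: H0_def homeomorphic_map_maps)
  have inv: "inv_into Y g y = k y" if "y \<in> Y" for y
  proof (rule inv_into_f_eq [OF H0_inj_on [OF g]])
    show "k y \<in> Y" "g (k y) = y"
      using k that continuous_map_funspace [of "susp_top \<phi>" "susp_top \<phi>" k]
      by (auto simp: homeomorphic_maps_def)
  qed
  have ck: "continuous_map (susp_top \<phi>) (susp_top \<phi>) k"
    using k by (simp add: homeomorphic_maps_def)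
  have "continuous_map (susp_top \<phi>) euclideanreal (\<lambda>y. - \<tau> (k y))"
    using continuous_map_compose [OF ck] assms(2)
    by (auto simp: displacement_def o_def intro!: continuous_map_minus)
  then have "continuous_map (susp_top \<phi>) euclideanreal (\<lambda>y. - \<tau> (inv_into Y g y))"
    by (rule continuous_map_eq) (simp add: inv)
  moreover have "k y = susp_flow (- \<tau> (k y)) y" if "y \<in> Y" for y
  proof -
    have "k y \<in> Y" "y = g (k y)"
      using k that continuous_map_funspace [OF ck] by (auto simp: homeomorphic_maps_def)
    then have "y = susp_flow (\<tau> (k y)) (k y)"
      using assms(2) by (simp add: displacement_def)
    then have "susp_flow (- \<tau> (k y)) y = susp_flow (- \<tau> (k y)) (susp_flow (\<tau> (k y)) (k y))"
      by simp
    then show ?thesis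
      by (simp add: susp_flow_add)
  qed
  ultimately show ?thesis
    by (auto simp: displacement_def inv)
qed

lemma H0_restrict_inv_into:
  assumes "g \<in> H0 \<phi>"
  shows "restrict (inv_into Y g) Y \<in> H0 \<phi>"
proof -
  obtain \<tau> where "displacement \<phi> g \<tau>"
    using assms by (rule H0_displacement)
  moreover have "inj_on (inv_into Y g) Y"
    using inj_on_inv_into [of "Y" g "Y"] H0_image [OF assms] by simp
  ultimately show ?thesis
    using displacement_inv [OF assms] by (auto simp: H0_iff)
qed

lemma H0_compose:
  assumes g: "g \<in> H0 \<phi>" and h: "h \<in> H0 \<phi>"
  shows "compose Y g h \<in> H0 \<phi>"
proof -
  have "inj_on (compose Y g h) Y"
    using Bij_def bij_betw_def compose_Bij [OF H0_Bij [OF g] H0_Bij [OF h]] by blast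
  moreover have "\<exists>\<tau>. displacement \<phi> (compose Y g h) \<tau>"
    using displacement_compose H0_displacement [OF g] H0_displacement [OF h] H0_continuous [OF h] by metis
  ultimately show ?thesis
    by (simp add: H0_iff)
qed

lemma H0_subgroup: "subgroup (H0 \<phi>) (BijGroup Y)"
proof (rule group.subgroupI [OF group_BijGroup])
  show "H0 \<phi> \<subseteq> carrier (BijGroup Y)"
    using H0_Bij by (auto simp: BijGroup_def)
  have "displacement \<phi> (\<lambda>y\<in>Y. y) (\<lambda>y. 0)"
    by (simp add: displacement_def)
  then have "(\<lambda>y\<in>Y. y) \<in> H0 \<phi>"
    by (auto simp: H0_iff inj_on_def)
  then show "H0 \<phi> \<noteq> {}"
    by auto
  show "inv\<^bsub>BijGroup Y\<^esub> g \<in> H0 \<phi>" if "g \<in> H0 \<phi>" for g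
    using that by (simp add: inv_BijGroup H0_Bij H0_restrict_inv_into)
  show "g \<otimes>\<^bsub>BijGroup Y\<^esub> h \<in> H0 \<phi>" if "g \<in> H0 \<phi>" "h \<in> H0 \<phi>" for g h
    using that by (simp add: BijGroup_def H0_Bij H0_compose)
qed

end

section \<open>The distance\<close>

abbreviation susp_inv ::
    "('a \<Rightarrow> 'a) \<Rightarrow> (('a \<times> real) set \<Rightarrow> ('a \<times> real) set) \<Rightarrow> ('a \<times> real) set \<Rightarrow> ('a \<times> real) set" where
  "susp_inv \<phi> g \<equiv> restrict (inv_into (suspension \<phi>) g) (suspension \<phi>)"

context stone_suspension
begin

text \<open>Representatives of one class have second coordinates that differ by an integer; in
  particular every period of a flow line is an integer.\<close>

lemma flow_eq_int:
  assumes "y \<in> Y" "susp_flow s y = susp_flow t y"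
  obtains n :: int where "s - t = of_int n"
proof -
  obtain x u where y: "y = susp_class \<phi> (x, u)"
    using assms(1) by (rule suspensionE)
  then obtain n where "u + t = u + s - real_of_int n"
    using assms(2) class_eq_iff by (auto simp: susp_flow_class)
  then show ?thesis
    using that [of n] by simp
qed

lemma displacement_diff_int:
  assumes "displacement \<phi> g \<tau>" "displacement \<phi> g \<tau>'" "y \<in> Y"
  obtains n :: int where "\<tau> y - \<tau>' y = of_int n"
proof -
  have "susp_flow (\<tau> y) y = susp_flow (\<tau>' y) y"
    using assms by (simp add: displacement_def)
  from flow_eq_int [OF assms(3) this] show ?thesis
    using that by blast
qed

text \<open>Times leading from \<open>y\<close> to \<open>z\<close> differ by integers, so at most
  one of them lies below 1/2 in modulus; if arbitrarily small ones exist, it is 0. This is how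
  equalities survive in limits, also on periodic lines.\<close>

lemma flow_small_eq:
  assumes y: "y \<in> Y" and small: "\<And>e. e > 0 \<Longrightarrow> \<exists>s. \<bar>s\<bar> < e \<and> z = susp_flow s y"
  shows "z = y"
proof -
  obtain s where s: "\<bar>s\<bar> < 1/2" "z = susp_flow s y"
    using small [of "1/2"] by auto
  have "s = 0"
  proof (rule ccontr)
    assume "s \<noteq> 0"
    then obtain s' where s': "\<bar>s'\<bar> < \<bar>s\<bar>" "z = susp_flow s' y"
      using small [of "\<bar>s\<bar>"] by auto
    obtain n :: int where n: "s - s' = of_int n"
      using flow_eq_int [OF y, of s s'] s(2) s'(2) by auto
    have "\<bar>s - s'\<bar> < 1"
      using s(1) s'(1) by linarith
    then have "n = 0"
      using n by auto
    then show False
      using n s' by simp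
  qed
  then show ?thesis
    using s by simp
qed

section \<open>The seminorm \<open>dplus\<close> and the metric\<close>

lemma displacement_diff_bdd:
  assumes "displacement \<phi> g \<tau>" "displacement \<phi> h \<sigma>"
  shows "bdd_above ((\<lambda>y. \<bar>\<tau> y - \<sigma> y\<bar>) ` Y)"
proof -
  have "continuous_map (susp_top \<phi>) euclideanreal (\<lambda>y. \<tau> y - \<sigma> y)"
    using assms by (auto simp: displacement_def intro: continuous_map_diff)
  then obtain B where "\<And>y. y \<in> Y \<Longrightarrow> \<bar>\<tau> y - \<sigma> y\<bar> \<le> B"
    using susp_bounded by metis
  then show ?thesis
    by (rule bdd_aboveI2)
qed

lemma SUP_displacement_nonneg:
  assumes "displacement \<phi> g \<tau>" "displacement \<phi> h \<sigma>"
  shows "0 \<le> (SUP y\<in>Y. \<bar>\<tau> y - \<sigma> y\<bar>)"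
proof -
  obtain y where "y \<in> Y"
    using suspension_nonempty by (metis ex_in_conv)
  from cSUP_upper [OF this displacement_diff_bdd [OF assms]] show ?thesis
    by linarith
qed

lemma dplus_le:
  assumes "displacement \<phi> g \<tau>" "displacement \<phi> h \<sigma>"
    and "\<And>y. y \<in> Y \<Longrightarrow> \<bar>\<tau> y - \<sigma> y\<bar> \<le> e"
  shows "dplus \<phi> g h \<le> e"
  unfolding dplus_def
proof (rule cINF_lower2)
  show "(\<tau>, \<sigma>) \<in> {(\<tau>, l). displacement \<phi> g \<tau> \<and> displacement \<phi> h l}"
    using assms by simp
  show "(case (\<tau>, \<sigma>) of (\<tau>, l) \<Rightarrow> SUP y\<in>Y. \<bar>\<tau> y - l y\<bar>) \<le> e"
    using assms(3) by (auto intro!: cSUP_least simp: suspension_nonempty)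
  show "bdd_below ((\<lambda>(\<tau>, l). SUP y\<in>Y. \<bar>\<tau> y - l y\<bar>) `
      {(\<tau>, l). displacement \<phi> g \<tau> \<and> displacement \<phi> h l})"
    by (rule bdd_belowI [of _ 0]) (auto intro: SUP_displacement_nonneg)
qed

lemma dplus_nonneg:
  assumes "displacement \<phi> g \<tau>" "displacement \<phi> h \<sigma>"
  shows "0 \<le> dplus \<phi> g h"
  unfolding dplus_def using assms
  by (intro cINF_greatest) (auto intro: SUP_displacement_nonneg)

text \<open>Two displacement functions of \<open>g\<close> differ by a period of each point, and such a difference
  may be added to any displacement function of \<open>h\<close>.\<close>

lemma dplus_lessE:
  assumes "dplus \<phi> g h < e" and \<tau>: "displacement \<phi> g \<tau>" and "displacement \<phi> h \<sigma>'"
  obtains \<sigma> where "displacement \<phi> h \<sigma>" "\<And>y. y \<in> Y \<Longrightarrow> \<bar>\<tau> y - \<sigma> y\<bar> < e"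
proof -
  have "{(\<tau>, l). displacement \<phi> g \<tau> \<and> displacement \<phi> h l} \<noteq> {}"
    using assms by auto
  then obtain \<tau>1 \<sigma>1 where 1: "displacement \<phi> g \<tau>1" "displacement \<phi> h \<sigma>1"
    and sup: "(SUP y\<in>Y. \<bar>\<tau>1 y - \<sigma>1 y\<bar>) < e"
    using cInf_lessD [OF _ assms(1) [unfolded dplus_def]] by auto
  show ?thesis
  proof (rule that)
    show "displacement \<phi> h (\<lambda>y. \<sigma>1 y + (\<tau> y - \<tau>1 y))"
      unfolding displacement_def
    proof (intro conjI ballI)
      show "continuous_map (susp_top \<phi>) euclideanreal (\<lambda>y. \<sigma>1 y + (\<tau> y - \<tau>1 y))"
        using 1 \<tau> by (auto simp: displacement_def intro!: continuous_map_add continuous_map_diff)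
      fix y assume y: "y \<in> Y"
      have "susp_flow (\<sigma>1 y + (\<tau> y - \<tau>1 y)) y = susp_flow (\<sigma>1 y - \<tau>1 y) (susp_flow (\<tau> y) y)"
        by (simp add: susp_flow_add algebra_simps)
      also have "susp_flow (\<tau> y) y = susp_flow (\<tau>1 y) y"
        using 1 \<tau> y by (simp add: displacement_def)
      also have "susp_flow (\<sigma>1 y - \<tau>1 y) (susp_flow (\<tau>1 y) y) = h y"
        using 1 y by (simp add: susp_flow_add displacement_def)
      finally show "h y = susp_flow (\<sigma>1 y + (\<tau> y - \<tau>1 y)) y" ..
    qed
    fix y assume "y \<in> Y"
    from cSUP_upper [OF this displacement_diff_bdd [OF 1]] sup
    show "\<bar>\<tau> y - (\<sigma>1 y + (\<tau> y - \<tau>1 y))\<bar> < e"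
      by simp
  qed
qed

text \<open>Displacement functions of \<open>h\<close> differ by integers at each point, so that at most one of them
  is close to a given \<open>\<tau>\<close>.\<close>

lemma dplus_rigid:
  assumes "dplus \<phi> g h < e" "e \<le> 1/2" and \<tau>: "displacement \<phi> g \<tau>" and \<sigma>: "displacement \<phi> h \<sigma>"
    and near: "\<And>y. y \<in> Y \<Longrightarrow> \<bar>\<tau> y - \<sigma> y\<bar> \<le> 1/2" and y: "y \<in> Y"
  shows "\<bar>\<tau> y - \<sigma> y\<bar> < e"
proof -
  obtain \<sigma>' where \<sigma>': "displacement \<phi> h \<sigma>'" "\<bar>\<tau> y - \<sigma>' y\<bar> < e"
    using dplus_lessE [OF assms(1) \<tau> \<sigma>] y by metis
  obtain n :: int where n: "\<sigma> y - \<sigma>' y = of_int n"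
    using displacement_diff_int [OF \<sigma> \<sigma>'(1) y] .
  have "\<bar>\<sigma> y - \<sigma>' y\<bar> < 1"
    using near [OF y] \<sigma>'(2) assms(2) by linarith
  then have "n = 0"
    using n by auto
  then show ?thesis
    using \<sigma>' n by simp
qed

lemma dplus_commute_le:
  assumes \<tau>: "displacement \<phi> g \<tau>" and \<sigma>: "displacement \<phi> h \<sigma>"
  shows "dplus \<phi> h g \<le> dplus \<phi> g h"
proof (rule field_le_epsilon)
  fix e :: real assume "e > 0"
  then have "dplus \<phi> g h < dplus \<phi> g h + e" by simp
  then obtain \<sigma>' where \<sigma>': "displacement \<phi> h \<sigma>'"
      "\<And>y. y \<in> Y \<Longrightarrow> \<bar>\<tau> y - \<sigma>' y\<bar> < dplus \<phi> g h + e"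
    using dplus_lessE [OF _ \<tau> \<sigma>] by metis
  show "dplus \<phi> h g \<le> dplus \<phi> g h + e"
    by (rule dplus_le [OF \<sigma>'(1) \<tau>]) (use \<sigma>'(2) in \<open>simp add: abs_minus_commute less_imp_le\<close>)
qed

text \<open>The infima for \<open>(g, h)\<close> and \<open>(h, k)\<close> may be approached with
  different displacement functions of \<open>h\<close>; \<open>dplus_lessE\<close> lets the second
  estimate start from the function that the first one produced.\<close>

lemma dplus_triangle:
  assumes \<tau>: "displacement \<phi> g \<tau>" and \<sigma>: "displacement \<phi> h \<sigma>" and \<rho>: "displacement \<phi> k \<rho>"
  shows "dplus \<phi> g k \<le> dplus \<phi> g h + dplus \<phi> h k"
proof (rule field_le_epsilon)
  fix e :: real assume "e > 0"
  then have "dplus \<phi> g h < dplus \<phi> g h + e/2" "dplus \<phi> h k < dplus \<phi> h k + e/2" by simp_all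
  note lt = this
  obtain \<sigma>' where \<sigma>': "displacement \<phi> h \<sigma>'"
      "\<And>y. y \<in> Y \<Longrightarrow> \<bar>\<tau> y - \<sigma>' y\<bar> < dplus \<phi> g h + e/2"
    using dplus_lessE [OF lt(1) \<tau> \<sigma>] by blast
  obtain \<rho>' where \<rho>': "displacement \<phi> k \<rho>'"
      "\<And>y. y \<in> Y \<Longrightarrow> \<bar>\<sigma>' y - \<rho>' y\<bar> < dplus \<phi> h k + e/2"
    using dplus_lessE [OF lt(2) \<sigma>'(1) \<rho>] by blast
  show "dplus \<phi> g k \<le> dplus \<phi> g h + dplus \<phi> h k + e"
  proof (rule dplus_le [OF \<tau> \<rho>'(1)])
    fix y assume "y \<in> Y"
    from \<sigma>'(2) [OF this] \<rho>'(2) [OF this]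
    show "\<bar>\<tau> y - \<rho>' y\<bar> \<le> dplus \<phi> g h + dplus \<phi> h k + e"
      by linarith
  qed
qed

lemma dplus_self:
  assumes "displacement \<phi> g \<tau>"
  shows "dplus \<phi> g g = 0"
  using dplus_le [OF assms assms, of 0] dplus_nonneg [OF assms assms] by simp

text \<open>For every \<open>e\<close> the two images of \<open>y\<close> are joined by a flow time
  below \<open>e\<close>, and \<open>flow_small_eq\<close> identifies them.\<close>

lemma dplus_eq_0:
  assumes "dplus \<phi> g h = 0" and \<tau>: "displacement \<phi> g \<tau>" and \<sigma>: "displacement \<phi> h \<sigma>"
    and y: "y \<in> Y"
  shows "g y = h y"
proof (rule flow_small_eq)
  show "h y \<in> Y"
    using displacement_mem [OF \<sigma> y] .
  fix e :: real assume "e > 0"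
  then obtain \<sigma>' where \<sigma>': "displacement \<phi> h \<sigma>'" "\<bar>\<tau> y - \<sigma>' y\<bar> < e"
    using dplus_lessE [OF _ \<tau> \<sigma>] assms(1) y by metis
  have "g y = susp_flow (\<tau> y - \<sigma>' y) (h y)"
    using \<tau> \<sigma>'(1) y by (simp add: displacement_def susp_flow_add)
  then show "\<exists>s. \<bar>s\<bar> < e \<and> g y = susp_flow s (h y)"
    using \<sigma>'(2) by blast
qed

lemma H0_inv_inv:
  assumes "g \<in> H0 \<phi>"
  shows "susp_inv \<phi> (susp_inv \<phi> g) = g"
proof
  fix y
  show "susp_inv \<phi> (susp_inv \<phi> g) y = g y"
  proof (cases "y \<in> Y")
    case True
    have gy: "g y \<in> Y"
      using H0_image [OF assms] True by blast
    have "inv_into Y (susp_inv \<phi> g) y = g y"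
    proof (rule inv_into_f_eq)
      show "inj_on (susp_inv \<phi> g) Y"
        using H0_restrict_inv_into [OF assms] by (rule H0_inj_on)
      show "susp_inv \<phi> g (g y) = y"
        using gy True by (simp add: H0_inj_on [OF assms])
    qed (rule gy)
    then show ?thesis
      using True by simp
  next
    case False
    then show ?thesis
      using H0_extensional [OF assms] by (simp add: extensional_def)
  qed
qed

lemma H0_inv_eqI:
  assumes g: "g \<in> H0 \<phi>" and "k \<in> extensional Y"
    and "\<And>y. y \<in> Y \<Longrightarrow> k y \<in> Y \<and> g (k y) = y"
  shows "susp_inv \<phi> g = k"
proof
  fix y
  show "susp_inv \<phi> g y = k y"
    using inv_into_f_eq [OF H0_inj_on [OF g], of "k y" y] assms(2,3)
    by (cases "y \<in> Y") (auto simp: extensional_def)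
qed

lemma dplus_nonneg_H0:
  assumes "g \<in> H0 \<phi>" "h \<in> H0 \<phi>"
  shows "0 \<le> dplus \<phi> g h"
proof -
  obtain \<tau> \<sigma> where "displacement \<phi> g \<tau>" "displacement \<phi> h \<sigma>"
    using H0_displacement [OF assms(1)] H0_displacement [OF assms(2)] by metis
  then show ?thesis
    by (rule dplus_nonneg)
qed

lemma dplus_commute_H0:
  assumes "g \<in> H0 \<phi>" "h \<in> H0 \<phi>"
  shows "dplus \<phi> g h = dplus \<phi> h g"
proof -
  obtain \<tau> \<sigma> where "displacement \<phi> g \<tau>" "displacement \<phi> h \<sigma>"
    using H0_displacement [OF assms(1)] H0_displacement [OF assms(2)] by metis
  then show ?thesis
    by (intro antisym dplus_commute_le)
qed

text \<open>Inversion swaps the two summands of the distance.\<close>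

lemma H0_dist_inv:
  assumes "g \<in> H0 \<phi>" "h \<in> H0 \<phi>"
  shows "H0_dist \<phi> (susp_inv \<phi> g) (susp_inv \<phi> h) = H0_dist \<phi> g h"
  using assms H0_restrict_inv_into
  by (simp add: H0_dist_def H0_inv_inv)

lemma Metric_space_H0: "Metric_space (H0 \<phi>) (H0_dist \<phi>)"
proof
  fix g h k
  show "0 \<le> H0_dist \<phi> g h"
    unfolding H0_dist_def
    by (simp add: dplus_nonneg_H0 H0_restrict_inv_into)
  show "H0_dist \<phi> g h = H0_dist \<phi> h g"
    unfolding H0_dist_def
    by (simp add: dplus_commute_H0 [of g h] dplus_commute_H0 [of "susp_inv \<phi> g" "susp_inv \<phi> h"]
        H0_restrict_inv_into)
  assume g: "g \<in> H0 \<phi>" and h: "h \<in> H0 \<phi>"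
  then have g': "susp_inv \<phi> g \<in> H0 \<phi>" and h': "susp_inv \<phi> h \<in> H0 \<phi>"
    using H0_restrict_inv_into by auto
  obtain \<tau> \<sigma> \<tau>' \<sigma>' where disp: "displacement \<phi> g \<tau>" "displacement \<phi> h \<sigma>"
      "displacement \<phi> (susp_inv \<phi> g) \<tau>'" "displacement \<phi> (susp_inv \<phi> h) \<sigma>'"
    using H0_displacement [OF g] H0_displacement [OF h]
      H0_displacement [OF g'] H0_displacement [OF h'] by metis
  show "H0_dist \<phi> g h = 0 \<longleftrightarrow> g = h"
  proof
    assume "H0_dist \<phi> g h = 0"
    then have "dplus \<phi> g h = 0"
      using dplus_nonneg [OF disp(1,2)] dplus_nonneg [OF disp(3,4)] g h by (simp add: H0_dist_def)
    then show "g = h"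
      using dplus_eq_0 [OF _ disp(1,2)] H0_extensional [OF g] H0_extensional [OF h]
      by (metis extensionalityI)
  next
    assume "g = h"
    then show "H0_dist \<phi> g h = 0"
      using dplus_self disp g by (simp add: H0_dist_def)
  qed
  assume k: "k \<in> H0 \<phi>"
  then obtain \<rho> \<rho>' where \<rho>: "displacement \<phi> k \<rho>" "displacement \<phi> (susp_inv \<phi> k) \<rho>'"
    using H0_displacement [OF k] H0_displacement [OF H0_restrict_inv_into [OF k]]
    by metis
  show "H0_dist \<phi> g k \<le> H0_dist \<phi> g h + H0_dist \<phi> h k"
    using dplus_triangle [OF disp(1,2) \<rho>(1)] dplus_triangle [OF disp(3,4) \<rho>(2)] g h k
    by (simp add: H0_dist_def)
qed

section \<open>Completeness\<close>

lemma dplus_le_H0_dist: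
  assumes "g \<in> H0 \<phi>" "h \<in> H0 \<phi>"
  shows "dplus \<phi> g h \<le> H0_dist \<phi> g h" "dplus \<phi> (susp_inv \<phi> g) (susp_inv \<phi> h) \<le> H0_dist \<phi> g h"
proof -
  have "0 \<le> dplus \<phi> g h" "0 \<le> dplus \<phi> (susp_inv \<phi> g) (susp_inv \<phi> h)"
    using assms by (simp_all add: dplus_nonneg_H0 H0_restrict_inv_into)
  then show "dplus \<phi> g h \<le> H0_dist \<phi> g h"
      "dplus \<phi> (susp_inv \<phi> g) (susp_inv \<phi> h) \<le> H0_dist \<phi> g h"
    using assms by (auto simp: H0_dist_def)
qed

text \<open>A Cauchy sequence for \<open>dplus\<close> need not give one of displacement functions
  if these are chosen arbitrarily. All of them are chosen near one \<open>\<tau>0\<close>;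
  \<open>dplus_rigid\<close> then turns each smaller bound on \<open>dplus\<close> into a bound on
  the chosen functions.\<close>

lemma dplus_Cauchy_limit:
  fixes g :: "nat \<Rightarrow> ('a \<times> real) set \<Rightarrow> ('a \<times> real) set"
  assumes disp: "\<And>n. \<exists>\<tau>. displacement \<phi> (g n) \<tau>"
    and Cauchy: "\<And>e. e > 0 \<Longrightarrow> \<exists>N. \<forall>m n. N \<le> m \<longrightarrow> N \<le> n \<longrightarrow> dplus \<phi> (g m) (g n) < e"
  obtains N \<tau> l where "\<And>n. N \<le> n \<Longrightarrow> displacement \<phi> (g n) (\<tau> n)"
    "continuous_map (susp_top \<phi>) euclideanreal l"
    "\<And>e. e > 0 \<Longrightarrow> \<exists>M. N \<le> M \<and> (\<forall>n\<ge>M. \<forall>y\<in>Y. \<bar>\<tau> n y - l y\<bar> < e)"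
proof -
  \<comment> \<open>Functions within 1/4 of \<open>\<tau>0\<close> are within 1/2 of each other, the
    range in which \<open>dplus_rigid\<close> applies.\<close>
  obtain N where N: "\<And>m n. N \<le> m \<Longrightarrow> N \<le> n \<Longrightarrow> dplus \<phi> (g m) (g n) < 1/4"
    using Cauchy [of "1/4"] by auto
  obtain \<tau>0 where \<tau>0: "displacement \<phi> (g N) \<tau>0"
    using disp by blast
  have "\<exists>\<sigma>. N \<le> n \<longrightarrow> displacement \<phi> (g n) \<sigma> \<and> (\<forall>y\<in>Y. \<bar>\<tau>0 y - \<sigma> y\<bar> < 1/4)" for n
  proof (cases "N \<le> n")
    case True
    obtain \<sigma>' where "displacement \<phi> (g n) \<sigma>'"
      using disp by blast
    from dplus_lessE [OF N [OF order_refl True] \<tau>0 this] show ?thesis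
      by metis
  qed auto
  then obtain \<tau> where \<tau>: "\<And>n. N \<le> n \<Longrightarrow> displacement \<phi> (g n) (\<tau> n)"
      "\<And>n y. N \<le> n \<Longrightarrow> y \<in> Y \<Longrightarrow> \<bar>\<tau>0 y - \<tau> n y\<bar> < 1/4"
    by metis
  have unif: "\<exists>M. N \<le> M \<and> (\<forall>m\<ge>M. \<forall>n\<ge>M. \<forall>y\<in>Y. \<bar>\<tau> m y - \<tau> n y\<bar> < e)" if "e > 0" for e
  proof -
    obtain M where M: "\<And>m n. M \<le> m \<Longrightarrow> M \<le> n \<Longrightarrow> dplus \<phi> (g m) (g n) < min e (1/2)"
      using Cauchy [of "min e (1/2)"] \<open>e > 0\<close> by auto
    have "\<bar>\<tau> m y - \<tau> n y\<bar> < min e (1/2)" if "max M N \<le> m" "max M N \<le> n" "y \<in> Y" for m n y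
    proof (rule dplus_rigid)
      show "dplus \<phi> (g m) (g n) < min e (1/2)"
        using M [of m n] that by simp
      show "displacement \<phi> (g m) (\<tau> m)" "displacement \<phi> (g n) (\<tau> n)"
        using \<tau> that by simp_all
      show "\<bar>\<tau> m y - \<tau> n y\<bar> \<le> 1/2" if "y \<in> Y" for y
      proof -
        have "N \<le> m" "N \<le> n"
          using \<open>max M N \<le> m\<close> \<open>max M N \<le> n\<close> by simp_all
        from \<tau>(2) [OF this(1) that] \<tau>(2) [OF this(2) that] show ?thesis
          by linarith
      qed
    qed (use that in auto)
    then show ?thesis
      by (intro exI [of _ "max M N"]) auto
  qed
  define l where "l y = lim (\<lambda>n. \<tau> n y)" for y
  have lim: "(\<lambda>n. \<tau> n y) \<longlonglongrightarrow> l y" if "y \<in> Y" for y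
  proof -
    have "Cauchy (\<lambda>n. \<tau> n y)"
      unfolding Cauchy_def dist_real_def using unif that by meson
    then show ?thesis
      unfolding l_def by (simp add: Cauchy_convergent_iff convergent_LIMSEQ_iff)
  qed
  have close: "\<exists>M. N \<le> M \<and> (\<forall>n\<ge>M. \<forall>y\<in>Y. \<bar>\<tau> n y - l y\<bar> < e)" if "e > 0" for e
  proof -
    obtain M where M: "N \<le> M" "\<And>m n y. M \<le> m \<Longrightarrow> M \<le> n \<Longrightarrow> y \<in> Y \<Longrightarrow> \<bar>\<tau> m y - \<tau> n y\<bar> < e/2"
      using unif [of "e/2"] \<open>e > 0\<close> by auto
    have "\<bar>\<tau> n y - l y\<bar> < e" if "M \<le> n" "y \<in> Y" for n y
    proof -
      have "\<bar>\<tau> n y - l y\<bar> \<le> e/2"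
      proof (rule LIMSEQ_le_const2)
        show "(\<lambda>m. \<bar>\<tau> n y - \<tau> m y\<bar>) \<longlonglongrightarrow> \<bar>\<tau> n y - l y\<bar>"
          using lim that by (intro tendsto_intros) auto
        show "\<exists>K. \<forall>m\<ge>K. \<bar>\<tau> n y - \<tau> m y\<bar> \<le> e/2"
          using M(2) that by (meson less_imp_le)
      qed
      then show ?thesis
        using \<open>e > 0\<close> by linarith
    qed
    then show ?thesis
      using M(1) by blast
  qed
  have unif_lim: "uniform_limit UNIV (\<lambda>n p. \<tau> n (susp_class \<phi> p)) (\<lambda>p. l (susp_class \<phi> p)) sequentially"
    unfolding uniform_limit_iff eventually_sequentially dist_real_def
    using close by (meson susp_class_mem)
  have "\<forall>\<^sub>F n in sequentially. continuous_on UNIV (\<lambda>p. \<tau> n (susp_class \<phi> p))"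
    unfolding eventually_sequentially
    using \<tau>(1) continuous_on_class_comp unfolding displacement_def by blast
  from uniform_limit_theorem [OF this unif_lim trivial_limit_sequentially]
  have "continuous_on UNIV (\<lambda>p. l (susp_class \<phi> p))" .
  then have "continuous_map (susp_top \<phi>) euclideanreal l"
    by (simp add: continuous_map_susp_top_iff o_def)
  then show ?thesis
    using that \<tau>(1) close by blast
qed

text \<open>The relation \<open>g n (k n y) = y\<close> passes to the limit with an error in flow
  time only: continuity of \<open>l\<close> along the flow, uniform in the point, compares
  \<open>l z\<close> with \<open>l w\<close>, and uniform convergence controls the other two
  differences. \<open>flow_small_eq\<close> removes the error.\<close>

lemma flow_limit_inverse:
  fixes N :: nat
  assumes g: "\<And>n. N \<le> n \<Longrightarrow> displacement \<phi> (g n) (\<tau> n)"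
    and k: "\<And>n. N \<le> n \<Longrightarrow> displacement \<phi> (k n) (\<sigma> n)"
    and inv: "\<And>n. N \<le> n \<Longrightarrow> g n (k n y) = y"
    and l: "continuous_map (susp_top \<phi>) euclideanreal l"
    and \<tau>: "\<And>e. e > 0 \<Longrightarrow> \<exists>M. N \<le> M \<and> (\<forall>n\<ge>M. \<forall>y\<in>Y. \<bar>\<tau> n y - l y\<bar> < e)"
    and \<sigma>: "\<And>e. e > 0 \<Longrightarrow> \<exists>M. N \<le> M \<and> (\<forall>n\<ge>M. \<forall>y\<in>Y. \<bar>\<sigma> n y - l' y\<bar> < e)"
    and y: "y \<in> Y"
  shows "susp_flow (l (susp_flow (l' y) y)) (susp_flow (l' y) y) = y"
proof (rule flow_small_eq [OF y])
  fix e :: real assume "e > 0"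
  define z where "z = susp_flow (l' y) y"
  obtain d where d: "d > 0" "\<And>y s. y \<in> Y \<Longrightarrow> \<bar>s\<bar> < d \<Longrightarrow> \<bar>l (susp_flow s y) - l y\<bar> < e/3"
    using uniform_along_flow [OF l, of "e/3"] \<open>e > 0\<close> by auto
  obtain M where M: "N \<le> M" "\<And>n y. n \<ge> M \<Longrightarrow> y \<in> Y \<Longrightarrow> \<bar>\<tau> n y - l y\<bar> < e/3"
    using \<tau> [of "e/3"] \<open>e > 0\<close> by auto
  obtain M' where M': "N \<le> M'" "\<And>n y. n \<ge> M' \<Longrightarrow> y \<in> Y \<Longrightarrow> \<bar>\<sigma> n y - l' y\<bar> < min d (e/3)"
    using \<sigma> [of "min d (e/3)"] \<open>e > 0\<close> d(1) by auto
  define n where "n = max M M'"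
  define w where "w = k n y"
  have n: "N \<le> n" "M \<le> n" "M' \<le> n"
    using M(1) by (auto simp: n_def)
  have w: "w = susp_flow (\<sigma> n y) y" "w \<in> Y"
    using k [OF n(1)] y by (auto simp: w_def displacement_def)
  have "w = susp_flow (\<sigma> n y - l' y) z"
    by (simp add: w z_def susp_flow_add)
  moreover have "z \<in> Y"
    using y by (simp add: z_def)
  ultimately have 1: "\<bar>l w - l z\<bar> < e/3"
    using d(2) M'(2) [OF n(3) y] by simp
  have "y = susp_flow (\<tau> n w) w"
    using inv [OF n(1)] g [OF n(1)] w(2) by (simp add: displacement_def w_def)
  then have "y = susp_flow (\<tau> n w + \<sigma> n y) y"
    unfolding w(1) susp_flow_add .
  then have "susp_flow (- (\<tau> n w + \<sigma> n y)) y = susp_flow (- (\<tau> n w + \<sigma> n y)) (susp_flow (\<tau> n w + \<sigma> n y) y)"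
    by simp
  \<comment> \<open>The round trip takes a period of \<open>y\<close>, possibly a nonzero one;
    subtracting it leaves only small differences of times.\<close>
  then have "susp_flow (- (\<tau> n w + \<sigma> n y)) y = y"
    by (simp add: susp_flow_add)
  then have "susp_flow (l z) z = susp_flow (l z + l' y) (susp_flow (- (\<tau> n w + \<sigma> n y)) y)"
    by (simp add: z_def susp_flow_add)
  also have "\<dots> = susp_flow (l z - \<tau> n w + (l' y - \<sigma> n y)) y"
    by (simp add: susp_flow_add algebra_simps)
  finally have "susp_flow (l z) z = susp_flow (l z - \<tau> n w + (l' y - \<sigma> n y)) y" .
  moreover have "\<bar>l z - \<tau> n w + (l' y - \<sigma> n y)\<bar> < e"
    using 1 M(2) [OF n(2) w(2)] M'(2) [OF n(3) y] by linarith
  ultimately show "\<exists>s. \<bar>s\<bar> < e \<and> susp_flow (l (susp_flow (l' y) y)) (susp_flow (l' y) y) = susp_flow s y"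
    unfolding z_def by blast
qed

text \<open>The limit of the lifts alone is only weakly increasing. The Cauchy condition on the
  inverses provides a second limit map \<open>k0\<close>, and being inverse to \<open>k0\<close>
  makes \<open>g0\<close> injective.\<close>

lemma mcomplete_H0: "Metric_space.mcomplete (H0 \<phi>) (H0_dist \<phi>)"
proof -
  interpret Metric_space "H0 \<phi>" "H0_dist \<phi>"
    by (rule Metric_space_H0)
  have "\<exists>x. limitin mtopology g x sequentially" if "MCauchy g" for g
  proof -
    have g: "g n \<in> H0 \<phi>" for n
      using that by (auto simp: MCauchy_def)
    define k where "k n = susp_inv \<phi> (g n)" for n
    have k: "k n \<in> H0 \<phi>" for n
      using H0_restrict_inv_into [OF g] by (simp add: k_def)
    have "\<exists>N. \<forall>m n. N \<le> m \<longrightarrow> N \<le> n \<longrightarrow> H0_dist \<phi> (g m) (g n) < e" if "e > 0" for e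
      using \<open>MCauchy g\<close> that by (auto simp: MCauchy_def)
    then have Cauchy: "\<exists>N. \<forall>m n. N \<le> m \<longrightarrow> N \<le> n \<longrightarrow> dplus \<phi> (g m) (g n) < e"
      "\<exists>N. \<forall>m n. N \<le> m \<longrightarrow> N \<le> n \<longrightarrow> dplus \<phi> (k m) (k n) < e" if "e > 0" for e
      using that dplus_le_H0_dist [OF g g] unfolding k_def by (meson le_less_trans)+
    have disp_ex: "\<exists>\<tau>. displacement \<phi> (g n) \<tau>" "\<exists>\<tau>. displacement \<phi> (k n) \<tau>" for n
      using g k by (auto simp: H0_iff)
    obtain N \<tau> l where \<tau>: "\<And>n. N \<le> n \<Longrightarrow> displacement \<phi> (g n) (\<tau> n)"
      "continuous_map (susp_top \<phi>) euclideanreal l"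
      "\<And>e. e > 0 \<Longrightarrow> \<exists>M. N \<le> M \<and> (\<forall>n\<ge>M. \<forall>y\<in>Y. \<bar>\<tau> n y - l y\<bar> < e)"
      using dplus_Cauchy_limit [OF disp_ex(1) Cauchy(1)] by blast
    obtain N' \<sigma> l' where \<sigma>: "\<And>n. N' \<le> n \<Longrightarrow> displacement \<phi> (k n) (\<sigma> n)"
      "continuous_map (susp_top \<phi>) euclideanreal l'"
      "\<And>e. e > 0 \<Longrightarrow> \<exists>M. N' \<le> M \<and> (\<forall>n\<ge>M. \<forall>y\<in>Y. \<bar>\<sigma> n y - l' y\<bar> < e)"
      using dplus_Cauchy_limit [OF disp_ex(2) Cauchy(2)] by blast
    define K where "K = max N N'"
    have ev: "\<exists>M. K \<le> M \<and> (\<forall>n\<ge>M. Q n)" if "\<exists>M. L \<le> M \<and> (\<forall>n\<ge>M. Q n)" for L and Q :: "nat \<Rightarrow> bool"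
      using that by (meson le_trans nat_le_linear)
    have \<tau>K: "\<exists>M. K \<le> M \<and> (\<forall>n\<ge>M. \<forall>y\<in>Y. \<bar>\<tau> n y - l y\<bar> < e)"
      and \<sigma>K: "\<exists>M. K \<le> M \<and> (\<forall>n\<ge>M. \<forall>y\<in>Y. \<bar>\<sigma> n y - l' y\<bar> < e)" if "e > 0" for e
      using ev [OF \<tau>(3) [OF that]] ev [OF \<sigma>(3) [OF that]] by auto
    have disp: "displacement \<phi> (g n) (\<tau> n)" "displacement \<phi> (k n) (\<sigma> n)" if "K \<le> n" for n
      using \<tau>(1) \<sigma>(1) that by (auto simp: K_def)
    have gk: "g n (k n y) = y" "k n (g n y) = y" if "y \<in> Y" for n y
      using that H0_image [OF g, of n] H0_inj_on [OF g, of n]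
      by (auto simp: k_def f_inv_into_f)
    define g0 where "g0 = (\<lambda>y\<in>Y. susp_flow (l y) y)"
    define k0 where "k0 = (\<lambda>y\<in>Y. susp_flow (l' y) y)"
    have disp0: "displacement \<phi> g0 l" "displacement \<phi> k0 l'"
      using \<tau>(2) \<sigma>(2) by (auto simp: displacement_def g0_def k0_def)
    have gk0: "g0 (k0 y) = y" "k0 (g0 y) = y" if "y \<in> Y" for y
      using flow_limit_inverse [OF disp gk(1) \<tau>(2) \<tau>K \<sigma>K that]
        flow_limit_inverse [OF disp(2,1) gk(2) \<sigma>(2) \<sigma>K \<tau>K that] that
      by (simp_all add: g0_def k0_def)
    have "inj_on g0 Y"
      using gk0(2) by (metis inj_on_inverseI)
    then have g0: "g0 \<in> H0 \<phi>"
      using disp0 by (auto simp: H0_iff g0_def)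
    have inv_g0: "susp_inv \<phi> g0 = k0"
      by (rule H0_inv_eqI [OF g0]) (use gk0 in \<open>auto simp: k0_def\<close>)
    have "\<exists>M. \<forall>n\<ge>M. g n \<in> H0 \<phi> \<and> H0_dist \<phi> (g n) g0 < e" if "e > 0" for e
    proof -
      obtain M where M: "K \<le> M" "\<And>n y. n\<ge>M \<Longrightarrow> y\<in>Y \<Longrightarrow> \<bar>\<tau> n y - l y\<bar> < e/3"
        using \<tau>K [of "e/3"] \<open>e > 0\<close> by auto
      obtain M' where M': "K \<le> M'" "\<And>n y. n\<ge>M' \<Longrightarrow> y\<in>Y \<Longrightarrow> \<bar>\<sigma> n y - l' y\<bar> < e/3"
        using \<sigma>K [of "e/3"] \<open>e > 0\<close> by auto
      have "H0_dist \<phi> (g n) g0 < e" if "n \<ge> max M M'" for n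
      proof -
        have n: "K \<le> n" "M \<le> n" "M' \<le> n"
          using that M(1) by auto
        have "dplus \<phi> (g n) g0 \<le> e/3"
          by (rule dplus_le [OF disp(1) [OF n(1)] disp0(1)]) (use M(2) [OF n(2)] in \<open>simp add: less_imp_le\<close>)
        moreover have "dplus \<phi> (k n) k0 \<le> e/3"
          by (rule dplus_le [OF disp(2) [OF n(1)] disp0(2)]) (use M'(2) [OF n(3)] in \<open>simp add: less_imp_le\<close>)
        ultimately show ?thesis
          using \<open>e > 0\<close> g g0 by (simp add: H0_dist_def inv_g0 k_def)
      qed
      then show ?thesis
        using g by blast
    qed
    then have "limitin mtopology g g0 sequentially"
      using g0 by (simp add: limit_metric_sequentially)
    then show ?thesis
      using exI [of "\<lambda>x. limitin mtopology g x sequentially" g0] by blast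
  qed
  then show ?thesis
    by (simp add: mcomplete_def)
qed

end

section \<open>Dyadic germs and the group T\<close>

lemma dyadic_rationals_iff: "r \<in> dyadic_rationals \<longleftrightarrow> (\<exists>(p::int) (n::nat). r = of_int p / 2 ^ n)"
proof
  assume "r \<in> dyadic_rationals"
  then obtain p q :: int where r: "r = of_int p / 2 powi q"
    by (auto simp: dyadic_rationals_def)
  show "\<exists>(p::int) (n::nat). r = of_int p / 2 ^ n"
  proof (cases "q \<ge> 0")
    case True
    then show ?thesis
      using r by (auto simp: power_int_def)
  next
    case False
    then have "r = of_int (p * 2 ^ nat (- q)) / 2 ^ 0"
      using r by (simp add: power_int_def field_simps)
    then show ?thesis by blast
  qed
next
  assume "\<exists>(p::int) (n::nat). r = of_int p / 2 ^ n"
  then obtain p :: int and n :: nat where "r = of_int p / 2 powi (int n)"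
    by (auto simp: power_int_of_nat)
  then show "r \<in> dyadic_rationals"
    unfolding dyadic_rationals_def by blast
qed

lemma dyadic_add:
  assumes "r \<in> dyadic_rationals" "s \<in> dyadic_rationals"
  shows "r + s \<in> dyadic_rationals"
proof -
  obtain p q :: int and m n :: nat where "r = of_int p / 2 ^ m" "s = of_int q / 2 ^ n"
    using assms by (auto simp: dyadic_rationals_iff)
  then have "r + s = of_int (p * 2 ^ n + q * 2 ^ m) / 2 ^ (m + n)"
    by (simp add: add_divide_distrib power_add)
  then show ?thesis
    unfolding dyadic_rationals_iff by blast
qed

lemma dyadic_of_int [simp]: "of_int n \<in> dyadic_rationals"
  unfolding dyadic_rationals_iff by (intro exI [of _ n] exI [of _ 0]) simp

lemma dyadic_0 [simp]: "0 \<in> dyadic_rationals"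
  using dyadic_of_int [of 0] by simp

lemma dyadic_uminus:
  assumes "r \<in> dyadic_rationals"
  shows "- r \<in> dyadic_rationals"
proof -
  obtain p :: int and n :: nat where "r = of_int p / 2 ^ n"
    using assms by (auto simp: dyadic_rationals_iff)
  then have "- r = of_int (- p) / 2 ^ n"
    by simp
  then show ?thesis
    unfolding dyadic_rationals_iff by blast
qed

lemma dyadic_diff: "r \<in> dyadic_rationals \<Longrightarrow> s \<in> dyadic_rationals \<Longrightarrow> r - s \<in> dyadic_rationals"
  using dyadic_add [of r "- s"] by (simp add: dyadic_uminus)

lemma dyadic_powi_mult:
  assumes "r \<in> dyadic_rationals"
  shows "2 powi k * r \<in> dyadic_rationals"
proof -
  obtain p :: int and n :: nat where r: "r = of_int p / 2 ^ n"
    using assms by (auto simp: dyadic_rationals_iff)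
  show ?thesis
  proof (cases "k \<ge> 0")
    case True
    then have "2 powi k * r = of_int (2 ^ nat k * p) / 2 ^ n"
      using r by (simp add: power_int_def)
    then show ?thesis
      unfolding dyadic_rationals_iff by blast
  next
    case False
    then have "2 powi k * r = of_int p / 2 ^ (n + nat (- k))"
      using r by (simp add: power_int_def field_simps power_add)
    then show ?thesis
      unfolding dyadic_rationals_iff by blast
  qed
qed

lemma dyadic_powi_mult_iff: "2 powi k * r \<in> dyadic_rationals \<longleftrightarrow> r \<in> dyadic_rationals"
proof
  assume "2 powi k * r \<in> dyadic_rationals"
  then have "2 powi (- k) * (2 powi k * r) \<in> dyadic_rationals"
    by (rule dyadic_powi_mult)
  then show "r \<in> dyadic_rationals"
    by (simp add: power_int_minus flip: mult.assoc)
qed (rule dyadic_powi_mult)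

text \<open>Affine maps whose slope is a power of 2 reflect dyadic numbers as well as preserve them,
  so a break at a dyadic image point pulls back to a dyadic point.\<close>

lemma dyadic_affine_iff:
  assumes "b \<in> dyadic_rationals"
  shows "2 powi k * r + b \<in> dyadic_rationals \<longleftrightarrow> r \<in> dyadic_rationals"
  using assms dyadic_add dyadic_diff dyadic_powi_mult_iff by (metis add_diff_cancel_right')

lemma dyadic_between:
  fixes u v :: real
  assumes "u < v"
  obtains r where "r \<in> dyadic_rationals" "u < r" "r < v"
proof -
  obtain n :: nat where "1 / (v - u) < 2 ^ n"
    using real_arch_pow [of 2 "1 / (v - u)"] by auto
  then have n: "1 < (v - u) * 2 ^ n"
    using assms by (simp add: field_simps)
  define p where "p = \<lfloor>u * 2 ^ n\<rfloor> + 1"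
  have "u * 2 ^ n < of_int p" "of_int p \<le> u * 2 ^ n + 1"
    unfolding p_def by linarith+
  then have "u < of_int p / 2 ^ n" "of_int p / 2 ^ n < v"
    using n by (simp_all add: field_simps)
  moreover have "of_int p / 2 ^ n \<in> dyadic_rationals"
    unfolding dyadic_rationals_iff by blast
  ultimately show ?thesis
    using that by blast
qed

text \<open>The local form of a dyadic PL map: one affine piece on each side, both valid at
  \<open>t\<close> itself, which builds in continuity, and a genuine break only at a dyadic
  \<open>t\<close>. Being local, the condition survives composition, inversion and changes of chart
  without bookkeeping of breakpoint sets.\<close>

definition dyadic_germ :: "(real \<Rightarrow> real) \<Rightarrow> real \<Rightarrow> bool" where
  "dyadic_germ f t \<longleftrightarrow> (\<exists>e m m' b b'. e > 0 \<and> b \<in> dyadic_rationals \<and> b' \<in> dyadic_rationals \<and>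
     (t \<in> dyadic_rationals \<or> (m = m' \<and> b = b')) \<and>
     (\<forall>s. t - e < s \<and> s \<le> t \<longrightarrow> f s = 2 powi m * s + b) \<and>
     (\<forall>s. t \<le> s \<and> s < t + e \<longrightarrow> f s = 2 powi m' * s + b'))"

lemma dyadic_germI:
  assumes "e > 0" "b \<in> dyadic_rationals" "b' \<in> dyadic_rationals"
    "t \<in> dyadic_rationals \<or> (m = m' \<and> b = b')"
    "\<And>s. t - e < s \<Longrightarrow> s \<le> t \<Longrightarrow> f s = 2 powi m * s + b"
    "\<And>s. t \<le> s \<Longrightarrow> s < t + e \<Longrightarrow> f s = 2 powi m' * s + b'"
  shows "dyadic_germ f t"
  unfolding dyadic_germ_def using assms by blast

lemma dyadic_germ_affine:
  assumes "b \<in> dyadic_rationals"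
  shows "dyadic_germ (\<lambda>s. 2 powi m * s + b) t"
  by (rule dyadic_germI [of 1 b b t m m]) (use assms in auto)

lemma dyadic_germ_translation: "b \<in> dyadic_rationals \<Longrightarrow> dyadic_germ (\<lambda>s. s + b) t"
  using dyadic_germ_affine [of b 0 t] by simp

lemma dyadic_germ_cong:
  assumes f: "dyadic_germ f t" and "d > 0" "\<And>s. \<bar>s - t\<bar> < d \<Longrightarrow> g s = f s"
  shows "dyadic_germ g t"
proof -
  obtain e m m' b b' where "e > 0" "b \<in> dyadic_rationals" "b' \<in> dyadic_rationals"
     "t \<in> dyadic_rationals \<or> (m = m' \<and> b = b')"
     "\<And>s. t - e < s \<and> s \<le> t \<Longrightarrow> f s = 2 powi m * s + b"
     "\<And>s. t \<le> s \<and> s < t + e \<Longrightarrow> f s = 2 powi m' * s + b'"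
    using f unfolding dyadic_germ_def by blast
  then show ?thesis
    using assms(2,3) by (intro dyadic_germI [of "min e d" b b' t m m']) auto
qed

text \<open>Slopes are positive, so \<open>f\<close> respects the two sides of \<open>t\<close> and
  left pieces meet left pieces, right pieces right pieces.\<close>

lemma dyadic_germ_compose:
  assumes f: "dyadic_germ f t" and g: "dyadic_germ g (f t)"
  shows "dyadic_germ (\<lambda>s. g (f s)) t"
proof -
  obtain e m m' b b' where e: "e > 0" and b: "b \<in> dyadic_rationals" "b' \<in> dyadic_rationals"
    and br: "t \<in> dyadic_rationals \<or> (m = m' \<and> b = b')"
    and l: "\<And>s. t - e < s \<Longrightarrow> s \<le> t \<Longrightarrow> f s = 2 powi m * s + b"
    and r: "\<And>s. t \<le> s \<Longrightarrow> s < t + e \<Longrightarrow> f s = 2 powi m' * s + b'"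
    using f unfolding dyadic_germ_def by blast
  obtain d n n' c c' where d: "d > 0" and c: "c \<in> dyadic_rationals" "c' \<in> dyadic_rationals"
    and br': "f t \<in> dyadic_rationals \<or> (n = n' \<and> c = c')"
    and l': "\<And>s. f t - d < s \<Longrightarrow> s \<le> f t \<Longrightarrow> g s = 2 powi n * s + c"
    and r': "\<And>s. f t \<le> s \<Longrightarrow> s < f t + d \<Longrightarrow> g s = 2 powi n' * s + c'"
    using g unfolding dyadic_germ_def by blast
  have ft: "f t = 2 powi m * t + b" "f t = 2 powi m' * t + b'"
    using l [of t] r [of t] e by auto
  \<comment> \<open>The two quotients keep \<open>f s\<close> within \<open>d\<close> of
    \<open>f t\<close> on either side.\<close>
  define k where "k = min e (min (d / 2 powi m) (d / 2 powi m'))"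
  have "k > 0"
    using e d by (simp add: k_def)
  have 1: "g (f s) = 2 powi (n + m) * s + (2 powi n * b + c)" if "t - k < s" "s \<le> t" for s
  proof -
    have "f s = 2 powi m * s + b"
      using l that by (simp add: k_def)
    moreover have "t - s < d / 2 powi m"
      using that unfolding k_def by linarith
    then have "(t - s) * 2 powi m < d"
      by (simp add: pos_less_divide_eq)
    moreover have "2 powi m * s \<le> 2 powi m * t"
      using that by simp
    ultimately show ?thesis
      using l' [of "f s"] ft(1) by (simp add: algebra_simps power_int_add)
  qed
  have 2: "g (f s) = 2 powi (n' + m') * s + (2 powi n' * b' + c')" if "t \<le> s" "s < t + k" for s
  proof -
    have "f s = 2 powi m' * s + b'"
      using r that by (simp add: k_def)
    moreover have "s - t < d / 2 powi m'"
      using that unfolding k_def by linarith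
    then have "(s - t) * 2 powi m' < d"
      by (simp add: pos_less_divide_eq)
    moreover have "2 powi m' * t \<le> 2 powi m' * s"
      using that by simp
    ultimately show ?thesis
      using r' [of "f s"] ft(2) by (simp add: algebra_simps power_int_add)
  qed
  \<comment> \<open>If \<open>t\<close> is not dyadic, then \<open>f\<close> has no break at
    \<open>t\<close>, and \<open>f t\<close> is not dyadic either, so that \<open>g\<close> has none
    at \<open>f t\<close>.\<close>
  have "t \<in> dyadic_rationals \<or> n + m = n' + m' \<and> 2 powi n * b + c = 2 powi n' * b' + c'"
    using br br' ft(1) dyadic_affine_iff [OF b(1)] by auto
  moreover have "2 powi n * b + c \<in> dyadic_rationals" "2 powi n' * b' + c' \<in> dyadic_rationals"
    using b c by (auto intro: dyadic_add dyadic_powi_mult)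
  ultimately show ?thesis
    unfolding dyadic_germ_def using \<open>k > 0\<close> 1 2 by blast
qed

text \<open>The affine pieces of \<open>f\<close> yield a preimage of every \<open>v\<close> near
  \<open>f t\<close>; there \<open>g\<close> is the inverse affine map, whose slope is again a power
  of 2.\<close>

lemma dyadic_germ_inverse:
  assumes f: "dyadic_germ f t" and gf: "\<And>s. g (f s) = s"
  shows "dyadic_germ g (f t)"
proof -
  obtain e m m' b b' where e: "e > 0" and b: "b \<in> dyadic_rationals" "b' \<in> dyadic_rationals"
    and br: "t \<in> dyadic_rationals \<or> (m = m' \<and> b = b')"
    and l: "\<And>s. t - e < s \<Longrightarrow> s \<le> t \<Longrightarrow> f s = 2 powi m * s + b"
    and r: "\<And>s. t \<le> s \<Longrightarrow> s < t + e \<Longrightarrow> f s = 2 powi m' * s + b'"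
    using f unfolding dyadic_germ_def by blast
  have ft: "f t = 2 powi m * t + b" "f t = 2 powi m' * t + b'"
    using l [of t] r [of t] e by auto
  define k where "k = min (e * 2 powi m) (e * 2 powi m')"
  have "k > 0"
    using e by (simp add: k_def)
  have inv: "g v = 2 powi (- n) * v + (- (2 powi (- n) * a))" if "f s = v" "v = 2 powi n * s + a" for n v a s
  proof -
    have "g v = s"
      using gf that by blast
    moreover have "2 powi (- n) * v - 2 powi (- n) * a = s"
      by (simp add: that(2) power_int_minus field_simps)
    ultimately show ?thesis
      by simp
  qed
  have 1: "g v = 2 powi (- m) * v + (- (2 powi (- m) * b))" if "f t - k < v" "v \<le> f t" for v
  proof (rule inv)
    define s where "s = (v - b) / 2 powi m"
    show v: "v = 2 powi m * s + b"
      by (simp add: s_def)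
    have "f t - v < e * 2 powi m"
      using that by (simp add: k_def)
    then have "t - s < e" "s \<le> t"
      using that(2) ft(1) by (simp_all add: s_def field_simps)
    then show "f s = v"
      using l v by simp
  qed
  have 2: "g v = 2 powi (- m') * v + (- (2 powi (- m') * b'))" if "f t \<le> v" "v < f t + k" for v
  proof (rule inv)
    define s where "s = (v - b') / 2 powi m'"
    show v: "v = 2 powi m' * s + b'"
      by (simp add: s_def)
    have "v - f t < e * 2 powi m'"
      using that by (simp add: k_def)
    then have "s - t < e" "t \<le> s"
      using that(1) ft(2) by (simp_all add: s_def field_simps)
    then show "f s = v"
      using r v by simp
  qed
  have "f t \<in> dyadic_rationals \<or> - m = - m' \<and> - (2 powi (- m) * b) = - (2 powi (- m') * b')"
    using br ft(1) dyadic_affine_iff [OF b(1)] by auto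
  moreover have "- (2 powi (- m) * b) \<in> dyadic_rationals" "- (2 powi (- m') * b') \<in> dyadic_rationals"
    using b by (auto intro: dyadic_uminus dyadic_powi_mult)
  ultimately show ?thesis
    unfolding dyadic_germ_def using \<open>k > 0\<close> 1 2 by blast
qed

text \<open>Off the breakpoints a whole ball is affine. At a breakpoint affineness is given only on
  the two open sides, and continuity of \<open>f\<close> extends both formulas to
  \<open>t\<close>.\<close>

lemma dyadic_PL_homeo_germ:
  assumes "dyadic_PL_homeo J f" "t \<in> J"
  shows "dyadic_germ f t"
proof -
  obtain f' where f': "homeomorphism J (f ` J) f f'"
    using assms by (auto simp: dyadic_PL_homeo_def)
  obtain p q where J: "J = {p<..<q}"
    using assms by (auto simp: dyadic_PL_homeo_def dyadic_open_interval_def)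
  obtain B where B: "finite B" "B \<subseteq> dyadic_rationals"
     "\<And>I. is_interval I \<Longrightarrow> I \<subseteq> J - B \<Longrightarrow>
           (\<exists>m::int. \<exists>b\<in>dyadic_rationals. \<forall>x\<in>I. f x = 2 powi m * x + b)"
    using assms by (auto simp: dyadic_PL_homeo_def)
  \<comment> \<open>All breakpoints except possibly \<open>t\<close> are removed, so each punctured
    side of a small ball is free of them.\<close>
  have "open (J - (B - {t}))"
    using B(1) J by (simp add: finite_imp_closed open_Diff)
  then obtain e where e: "e > 0" "ball t e \<subseteq> J - (B - {t})"
    using assms(2) open_contains_ball by (metis DiffD2 DiffI insertI1)
  have sub: "I \<subseteq> J - B" if "I \<subseteq> ball t e" "t \<notin> I \<or> t \<notin> B" for I
    using that e by blast
  have ball: "ball t e = {t - e<..<t + e}"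
    by (simp add: ball_eq_greaterThanLessThan)
  show ?thesis
  proof (cases "t \<in> B")
    case False
    then have "\<exists>m::int. \<exists>b\<in>dyadic_rationals. \<forall>x\<in>ball t e. f x = 2 powi m * x + b"
      by (intro B(3) sub) (auto simp: is_interval_convex_1)
    then obtain m :: int and b where "b \<in> dyadic_rationals" "\<And>x. x \<in> ball t e \<Longrightarrow> f x = 2 powi m * x + b"
      by blast
    then show ?thesis
      unfolding ball using e(1) by (intro dyadic_germI [of e b b t m m]) auto
  next
    case True
    have "\<exists>m::int. \<exists>b\<in>dyadic_rationals. \<forall>x\<in>{t-e<..<t}. f x = 2 powi m * x + b"
      "\<exists>m::int. \<exists>b\<in>dyadic_rationals. \<forall>x\<in>{t<..<t+e}. f x = 2 powi m * x + b"
      using e(1) by (intro B(3) sub; auto simp: is_interval_convex_1 ball)+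
    then obtain m m' :: int and b b'
      where l: "b \<in> dyadic_rationals" "\<And>x. x \<in> {t-e<..<t} \<Longrightarrow> f x = 2 powi m * x + b"
        and r: "b' \<in> dyadic_rationals" "\<And>x. x \<in> {t<..<t+e} \<Longrightarrow> f x = 2 powi m' * x + b'"
      by blast
    have "isCont f t"
      using f' assms(2) J by (auto simp: homeomorphism_def continuous_on_eq_continuous_at)
    then have lim: "(f \<longlongrightarrow> f t) (at_left t)" "(f \<longlongrightarrow> f t) (at_right t)"
      by (auto simp: isCont_def intro: tendsto_mono [OF at_le])
    have "((\<lambda>s. 2 powi m * s + b) \<longlongrightarrow> f t) (at_left t)"
    proof (rule Lim_transform_eventually [OF lim(1)])
      show "\<forall>\<^sub>F s in at_left t. f s = 2 powi m * s + b"
        using e(1) l(2) by (intro eventually_at_leftI [of "t - e"]) auto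
    qed
    moreover have "((\<lambda>s. 2 powi m * s + b) \<longlongrightarrow> 2 powi m * t + b) (at_left t)"
      by (intro tendsto_intros)
    ultimately have ftl: "f t = 2 powi m * t + b"
      using tendsto_unique trivial_limit_at_left_real by blast
    have "((\<lambda>s. 2 powi m' * s + b') \<longlongrightarrow> f t) (at_right t)"
    proof (rule Lim_transform_eventually [OF lim(2)])
      show "\<forall>\<^sub>F s in at_right t. f s = 2 powi m' * s + b'"
        using e(1) r(2) by (intro eventually_at_rightI [of _ "t + e"]) auto
    qed
    moreover have "((\<lambda>s. 2 powi m' * s + b') \<longlongrightarrow> 2 powi m' * t + b') (at_right t)"
      by (intro tendsto_intros)
    ultimately have ftr: "f t = 2 powi m' * t + b'"
      using tendsto_unique trivial_limit_at_right_real by blast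
    have "f s = 2 powi m * s + b" if "t - e < s" "s \<le> t" for s
      using that l(2) ftl by (cases "s = t") auto
    moreover have "f s = 2 powi m' * s + b'" if "t \<le> s" "s < t + e" for s
      using that r(2) ftr by (cases "s = t") auto
    moreover have "t \<in> dyadic_rationals"
      using True B(2) by blast
    ultimately show ?thesis
      unfolding dyadic_germ_def using e(1) l(1) r(1) by blast
  qed
qed

section \<open>From charts to displacement functions\<close>

lemma one_le_return_time: "1 \<le> return_time \<phi> C"
  unfolding return_time_def by (rule Inf_greatest) (auto simp: one_enat_def)

text \<open>Return times are at least 1, so intervals shorter than 1 give charts over any clopen
  set.\<close>

lemma is_chartI:
  assumes "open C" "closed C" "a < b" "b - a < 1"
  shows "is_chart \<phi> C {a<..<b}"
proof -
  have "ereal_of_enat 1 \<le> ereal_of_enat (return_time \<phi> C)"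
    using one_le_return_time by simp
  moreover have "ereal (b - a) < ereal_of_enat 1"
    using assms(4) by (simp add: one_enat_def)
  ultimately have "ereal (b - a) < ereal_of_enat (return_time \<phi> C)"
    by (rule less_le_trans [rotated])
  then show ?thesis
    using assms by (auto simp: is_chart_def)
qed

text \<open>The map \<open>s \<mapsto> s + \<tau> [x,s]\<close> lifts \<open>g\<close> to the flow line through \<open>x\<close>. Membership in \<open>T\<close> only
  concerns these lifts locally: lifts read in different charts differ by integer translations,
  which preserve dyadic germs.\<close>

definition dyadic_displacement ::
    "('a::topological_space \<Rightarrow> 'a) \<Rightarrow> (('a \<times> real) set \<Rightarrow> real) \<Rightarrow> bool" where
  "dyadic_displacement \<phi> \<tau> \<longleftrightarrow> (\<forall>x t.
     (\<exists>C e. open C \<and> x \<in> C \<and> e > 0 \<and> (\<forall>x'\<in>C. \<forall>s. \<bar>s - t\<bar> < e \<longrightarrow>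
        \<tau> (susp_class \<phi> (x', s)) = \<tau> (susp_class \<phi> (x, s)))) \<and>
     dyadic_germ (\<lambda>s. s + \<tau> (susp_class \<phi> (x, s))) t)"

lemma dyadic_displacement_locally_const:
  assumes "dyadic_displacement \<phi> \<tau>"
  obtains C e where "open C" "x \<in> C" "e > 0"
    "\<And>x' s. x' \<in> C \<Longrightarrow> \<bar>s - t\<bar> < e \<Longrightarrow> \<tau> (susp_class \<phi> (x', s)) = \<tau> (susp_class \<phi> (x, s))"
  using assms [unfolded dyadic_displacement_def, rule_format, THEN conjunct1, of x t] by blast

lemma dyadic_displacement_germ:
  "dyadic_displacement \<phi> \<tau> \<Longrightarrow> dyadic_germ (\<lambda>s. s + \<tau> (susp_class \<phi> (x, s))) t"
  unfolding dyadic_displacement_def by blast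

lemma isCont_real_eps_delta:
  fixes f :: "real \<Rightarrow> real"
  assumes "isCont f t" "d > 0"
  obtains e where "e > 0" "\<And>s. \<bar>s - t\<bar> < e \<Longrightarrow> \<bar>f s - f t\<bar> < d"
  using assms unfolding continuous_at_eps_delta dist_real_def by blast

context stone_suspension
begin

lemma class_inj_unit:
  assumes "susp_class \<phi> (x, s) = susp_class \<phi> (x', s')" "\<bar>s - s'\<bar> < 1"
  shows "x = x' \<and> s = s'"
proof -
  obtain n where n: "x' = zpow \<phi> n x" "s' = s - of_int n"
    using assms(1) class_eq_iff by auto
  then have "n = 0"
    using assms(2) by simp
  then show ?thesis
    using n by simp
qed

text \<open>In a chart the lift of \<open>g\<close> and the map \<open>f\<close> describe the same
  point, so their difference is an integer, and by continuity it is constant nearby. Thus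
  \<open>\<tau>\<close> is locally independent of the base point and the lift has the germ of
  \<open>f\<close> up to integer translations.\<close>

lemma T_group_dyadic_displacement:
  assumes "g \<in> T_group \<phi>" and \<tau>: "displacement \<phi> g \<tau>"
  shows "dyadic_displacement \<phi> \<tau>"
  unfolding dyadic_displacement_def
proof (intro allI)
  fix x t
  define q where "q x' s = s + \<tau> (susp_class \<phi> (x', s))" for x' s
  obtain C J f where chart: "is_chart \<phi> C J" "susp_class \<phi> (x, t) \<in> chart_domain \<phi> C J"
      "dyadic_PL_homeo J f" and image: "g ` chart_domain \<phi> C J = chart_domain \<phi> C (f ` J)"
    and inv: "\<And>x s. x \<in> C \<Longrightarrow> s \<in> J \<Longrightarrow> inv_into (C \<times> f ` J) (susp_class \<phi>) (g (susp_class \<phi> (x, s))) = (x, f s)"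
    using bspec [OF conjunct2 [OF assms(1) [unfolded T_group_def mem_Collect_eq]] susp_class_mem [of \<phi> "(x, t)"]]
    by (elim exE conjE) blast
  have g: "g (susp_class \<phi> (x, s)) = susp_class \<phi> (x, f s)" if "x \<in> C" "s \<in> J" for x s
  proof -
    have "g (susp_class \<phi> (x, s)) \<in> susp_class \<phi> ` (C \<times> f ` J)"
      using image that by (auto simp: chart_domain_def)
    from f_inv_into_f [OF this] show ?thesis
      using inv that by simp
  qed
  have int: "\<exists>n::int. q x s - f s = of_int n" if xs: "x \<in> C" "s \<in> J" for x s
  proof -
    have "susp_class \<phi> (x, q x s) = susp_class \<phi> (x, f s)"
      using g [OF xs] \<tau> by (simp add: q_def displacement_def susp_flow_class)
    then obtain n where "f s = q x s - of_int n"
      using class_eq_iff by auto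
    then show ?thesis
      by (intro exI [of _ n]) simp
  qed
  obtain x0 t0 where x0: "x0 \<in> C" "t0 \<in> J" "susp_class \<phi> (x, t) = susp_class \<phi> (x0, t0)"
    using chart(2) by (auto simp: chart_domain_def)
  then obtain n where n: "x0 = zpow \<phi> n x" "t0 = t - of_int n"
    using class_eq_iff by auto
  have shift: "susp_class \<phi> (zpow \<phi> n x', s - of_int n) = susp_class \<phi> (x', s)" for x' s
    using class_shift .
  obtain n0 :: int where n0: "q x0 t0 - f t0 = of_int n0"
    using int x0 by blast
  have openCJ: "open (C \<times> J)"
    using chart(1) by (auto simp: is_chart_def open_Times)
  obtain f' where "homeomorphism J (f ` J) f f'"
    using chart(3) by (auto simp: dyadic_PL_homeo_def)
  then have contf: "continuous_on J f"
    by (simp add: homeomorphism_def)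
  have "continuous_on UNIV (\<lambda>p. \<tau> (susp_class \<phi> p))"
    using continuous_on_class_comp \<tau> by (auto simp: displacement_def)
  then have "continuous_on (C \<times> J) (\<lambda>p. snd p + \<tau> (susp_class \<phi> p) - f (snd p))"
    by (intro continuous_intros continuous_on_compose2 [OF contf]) (auto intro: continuous_on_subset)
  \<comment> \<open>The ball of radius 1 contains \<open>n0\<close> as its only integer.\<close>
  then have "open ((\<lambda>p. snd p + \<tau> (susp_class \<phi> p) - f (snd p)) -` ball (of_int n0) 1 \<inter> C \<times> J)"
    using continuous_on_open_vimage [OF openCJ] open_ball by blast
  moreover have "(x0, t0) \<in> (\<lambda>p. snd p + \<tau> (susp_class \<phi> p) - f (snd p)) -` ball (of_int n0) 1 \<inter> C \<times> J"
    using x0 n0 by (simp add: q_def)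
  ultimately have "\<exists>A I. open A \<and> open I \<and> (x0, t0) \<in> A \<times> I \<and>
    A \<times> I \<subseteq> (\<lambda>p. snd p + \<tau> (susp_class \<phi> p) - f (snd p)) -` ball (of_int n0) 1 \<inter> C \<times> J"
    unfolding open_prod_def by blast
  then obtain A I where AI: "open A" "open I" "x0 \<in> A" "t0 \<in> I"
    "A \<times> I \<subseteq> (\<lambda>p. snd p + \<tau> (susp_class \<phi> p) - f (snd p)) -` ball (of_int n0) 1 \<inter> C \<times> J"
    by auto
  obtain e where e: "e > 0" "ball t0 e \<subseteq> I"
    using AI open_contains_ball by metis
  have near: "q x' s = f s + of_int n0" if "x' \<in> A" "\<bar>s - t0\<bar> < e" for x' s
  proof -
    have "s \<in> I"
      using e that by (auto simp: dist_real_def)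
    then have *: "x' \<in> C" "s \<in> J" "\<bar>q x' s - f s - of_int n0\<bar> < 1"
      using AI(5) that by (auto simp: q_def dist_real_def)
    then obtain k :: int where "q x' s - f s = of_int k"
      using int by blast
    moreover from this have "k = n0"
      using *(3) by linarith
    ultimately show ?thesis
      by simp
  qed
  have "open (zpow \<phi> n -` A)"
    using continuous_zpow AI(1) by (rule open_vimage [rotated])
  moreover have "x \<in> zpow \<phi> n -` A"
    using AI(3) n by simp
  moreover have "\<tau> (susp_class \<phi> (x', s)) = \<tau> (susp_class \<phi> (x, s))"
    if x': "x' \<in> zpow \<phi> n -` A" and s: "\<bar>s - t\<bar> < e" for x' s
  proof -
    have "\<bar>(s - of_int n) - t0\<bar> < e"
      using n(2) s by simp
    then have "q (zpow \<phi> n x') (s - of_int n) = q x0 (s - of_int n)"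
      using near x' AI(3) by simp
    then show ?thesis
      using n(1) by (simp add: q_def shift)
  qed
  ultimately have "\<exists>C e. open C \<and> x \<in> C \<and> e > 0 \<and> (\<forall>x'\<in>C. \<forall>s. \<bar>s - t\<bar> < e \<longrightarrow>
        \<tau> (susp_class \<phi> (x', s)) = \<tau> (susp_class \<phi> (x, s)))"
    using e(1) by blast
  moreover have "dyadic_germ (\<lambda>s. s + \<tau> (susp_class \<phi> (x, s))) t"
  proof (rule dyadic_germ_cong [OF _ e(1)])
    \<comment> \<open>The chart uses the representative
      \<open>(zpow \<phi> n x, t - of_int n)\<close>: going there subtracts \<open>n\<close>, coming
      back adds \<open>n\<close> to the integer \<open>n0\<close>.\<close>
    have "dyadic_germ (\<lambda>s. f (s + of_int (- n))) t"
      by (rule dyadic_germ_compose [OF dyadic_germ_translation])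
        (use dyadic_PL_homeo_germ [OF chart(3) x0(2)] n(2) dyadic_of_int [of "- n"] in \<open>simp_all del: dyadic_of_int\<close>)
    from dyadic_germ_compose [OF this dyadic_germ_translation [OF dyadic_of_int [of "n0 + n"]]]
    show "dyadic_germ (\<lambda>s. f (s + of_int (- n)) + of_int (n0 + n)) t" .
    fix s assume s: "\<bar>s - t\<bar> < e"
    have "q x0 (s - of_int n) = f (s - of_int n) + of_int n0"
      using near [OF AI(3), of "s - of_int n"] n(2) s by simp
    then show "s + \<tau> (susp_class \<phi> (x, s)) = f (s + of_int (- n)) + of_int (n0 + n)"
      using n(1) by (simp add: q_def shift)
  qed
  ultimately show "(\<exists>C e. open C \<and> x \<in> C \<and> e > 0 \<and> (\<forall>x'\<in>C. \<forall>s. \<bar>s - t\<bar> < e \<longrightarrow>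
        \<tau> (susp_class \<phi> (x', s)) = \<tau> (susp_class \<phi> (x, s)))) \<and>
     dyadic_germ (\<lambda>s. s + \<tau> (susp_class \<phi> (x, s))) t"
    by blast
qed

text \<open>The germ at \<open>t\<close> has at most one break, at \<open>t\<close> itself. A chart
  is cut out at dyadic points \<open>p\<close> and \<open>q\<close> on either side, whose images are
  dyadic because they lie on the affine pieces.\<close>

lemma dyadic_displacement_T_group:
  assumes g: "g \<in> H0 \<phi>" and \<tau>: "displacement \<phi> g \<tau>" and dyadic: "dyadic_displacement \<phi> \<tau>"
  shows "g \<in> T_group \<phi>"
proof -
  have "\<exists>C J f. is_chart \<phi> C J \<and> dyadic_open_interval J \<and> y \<in> chart_domain \<phi> C J \<and>
      dyadic_PL_homeo J f \<and> is_chart \<phi> C (f ` J) \<and>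
      g ` chart_domain \<phi> C J = chart_domain \<phi> C (f ` J) \<and>
      (\<forall>x\<in>C. \<forall>t\<in>J.
         inv_into (C \<times> f ` J) (susp_class \<phi>) (g (susp_class \<phi> (x, t))) = (x, f t))"
    if "y \<in> Y" for y
  proof -
    obtain x t where y: "y = susp_class \<phi> (x, t)"
      using \<open>y \<in> Y\<close> by (rule suspensionE)
    define F where "F s = s + \<tau> (susp_class \<phi> (x, s))" for s
    have mono: "strict_mono F"
      unfolding F_def by (rule displacement_strict_mono [OF H0_inj_on [OF g] \<tau>])
    have cont: "continuous_on UNIV F"
      unfolding F_def using continuous_flow_line \<tau> by (auto simp: displacement_def)
    obtain C0 e0 where C0: "open C0" "x \<in> C0" "e0 > 0" "\<And>x' s. x' \<in> C0 \<Longrightarrow> \<bar>s - t\<bar> < e0 \<Longrightarrow>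
        \<tau> (susp_class \<phi> (x', s)) = \<tau> (susp_class \<phi> (x, s))"
      using dyadic_displacement_locally_const [OF dyadic, of x t] by blast
    have "dyadic_germ F t"
      unfolding F_def by (rule dyadic_displacement_germ [OF dyadic])
    then obtain e1 m m' b b' where e1: "e1 > 0" and b: "b \<in> dyadic_rationals" "b' \<in> dyadic_rationals"
      and br: "t \<in> dyadic_rationals \<or> (m = m' \<and> b = b')"
      and l: "\<And>s. t - e1 < s \<Longrightarrow> s \<le> t \<Longrightarrow> F s = 2 powi m * s + b"
      and r: "\<And>s. t \<le> s \<Longrightarrow> s < t + e1 \<Longrightarrow> F s = 2 powi m' * s + b'"
      unfolding dyadic_germ_def by blast
    have "isCont F t"
      using cont by (simp add: continuous_on_eq_continuous_at)
    then obtain e2 where e2: "e2 > 0" "\<And>s. \<bar>s - t\<bar> < e2 \<Longrightarrow> \<bar>F s - F t\<bar> < 1/2"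
      using isCont_real_eps_delta [of t F "1/2"] by auto
    \<comment> \<open>Within \<open>e0\<close> the displacement does not depend on the base point,
      within \<open>e1\<close> the lift is affine on each side, within \<open>e2\<close> its image
      is shorter than 1, and 1/2 achieves the same for the interval \<open>J\<close>.\<close>
    define e where "e = min (min e0 e1) (min e2 (1/2))"
    have e: "e > 0" "e \<le> e0" "e \<le> e1" "e \<le> e2" "e \<le> 1/2"
      using C0(3) e1 e2(1) by (auto simp: e_def)
    obtain p where p: "p \<in> dyadic_rationals" "t - e < p" "p < t"
      using dyadic_between [of "t - e" t] e(1) by auto
    obtain q where q: "q \<in> dyadic_rationals" "t < q" "q < t + e"
      using dyadic_between [of t "t + e"] e(1) by auto
    obtain C where C: "open C" "closed C" "x \<in> C" "C \<subseteq> C0"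
      using clopen_nbhd [OF totally_disconnected C0(1,2)] .
    define J where "J = {p<..<q}"
    have tJ: "t \<in> J"
      using p q by (simp add: J_def)
    have FJ: "F ` J = {F p<..<F q}"
    proof (intro equalityI subsetI)
      fix v assume "v \<in> F ` J"
      then show "v \<in> {F p<..<F q}"
        using mono by (auto simp: J_def strict_mono_less)
    next
      fix v assume v: "v \<in> {F p<..<F q}"
      then obtain s where "F s = v"
        using IVT' [of F p v q] continuous_on_subset [OF cont] p q by force
      then show "v \<in> F ` J"
        using v mono by (auto simp: J_def strict_mono_less)
    qed
    have pF: "F p \<in> dyadic_rationals"
      using l [of p] p e(3) b(1) dyadic_affine_iff by auto
    have qF: "F q \<in> dyadic_rationals"
      using r [of q] q e(3) b(2) dyadic_affine_iff by auto
    have Fpq: "F p < F q" "F q - F p < 1"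
    proof -
      show "F p < F q"
        using mono p q by (simp add: strict_mono_less)
      have "\<bar>F p - F t\<bar> < 1/2" "\<bar>F q - F t\<bar> < 1/2"
        using e2(2) p q e(4) by auto
      then show "F q - F p < 1"
        by linarith
    qed
    have chart: "is_chart \<phi> C J" "is_chart \<phi> C (F ` J)"
      unfolding FJ unfolding J_def using C p q e(5) Fpq by (auto intro!: is_chartI)
    have dyJ: "dyadic_open_interval J" "dyadic_open_interval (F ` J)"
      unfolding FJ unfolding J_def dyadic_open_interval_def
    proof -
      show "\<exists>a\<in>dyadic_rationals. \<exists>b\<in>dyadic_rationals. a < b \<and> {p<..<q} = {a<..<b}"
        using p q by (intro bexI [of _ p] bexI [of _ q]) auto
      show "\<exists>a\<in>dyadic_rationals. \<exists>b\<in>dyadic_rationals. a < b \<and> {F p<..<F q} = {a<..<b}"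
        using pF qF Fpq by (intro bexI [of _ "F p"] bexI [of _ "F q"]) auto
    qed
    have "\<exists>f'. homeomorphism J (F ` J) F f'"
    proof -
      have "open J" "continuous_on J F" "inj_on F J"
        using continuous_on_subset [OF cont] inj_on_subset [OF strict_mono_imp_inj_on [OF mono]]
        by (auto simp: J_def)
      then obtain f' where "homeomorphism J (F ` J) F f'"
        using invariance_of_domain_homeomorphism [of J F] by auto
      then show ?thesis
        by blast
    qed
    moreover have "\<exists>B. finite B \<and> B \<subseteq> dyadic_rationals \<and>
        (\<forall>I. is_interval I \<and> I \<subseteq> J - B \<longrightarrow>
           (\<exists>m::int. \<exists>b\<in>dyadic_rationals. \<forall>x\<in>I. F x = 2 powi m * x + b))"
    \<comment> \<open>For a \<open>t\<close> that is not dyadic the two affine formulas coincide, so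
      the breakpoint set can be empty.\<close>
    proof (intro exI [of _ "if t \<in> dyadic_rationals then {t} else {}"] conjI allI impI)
      fix I assume I: "is_interval I \<and> I \<subseteq> J - (if t \<in> dyadic_rationals then {t} else {})"
      have left: "F s = 2 powi m * s + b" if "s \<in> I" "s \<le> t" for s
        using l [of s] that I p e(3) by (auto simp: J_def)
      have right: "F s = 2 powi m' * s + b'" if "s \<in> I" "t \<le> s" for s
        using r [of s] that I q e(3) by (auto simp: J_def)
      show "\<exists>m::int. \<exists>b\<in>dyadic_rationals. \<forall>x\<in>I. F x = 2 powi m * x + b"
      proof (cases "t \<in> dyadic_rationals")
        case True
        have "(\<forall>s\<in>I. s \<le> t) \<or> (\<forall>s\<in>I. t \<le> s)"
        proof (rule ccontr)
          assume "\<not> ?thesis"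
          then obtain s s' where "s \<in> I" "s' \<in> I" "s \<le> t" "t \<le> s'"
            by (meson linear)
          moreover have "is_interval I"
            using I by blast
          ultimately have "t \<in> I"
            unfolding is_interval_1 by blast
          then show False
            using I True by auto
        qed
        then show ?thesis
          using left right b by blast
      next
        case False
        then show ?thesis
          using left right b br by (metis linear)
      qed
    qed auto
    ultimately have PL: "dyadic_PL_homeo J F"
      using dyJ by (simp add: dyadic_PL_homeo_def)
    have g: "g (susp_class \<phi> (x', s)) = susp_class \<phi> (x', F s)" if "x' \<in> C" "s \<in> J" for x' s
    proof -
      have "\<bar>s - t\<bar> < e0"
        using that(2) p q e(2) by (auto simp: J_def)
      then have "\<tau> (susp_class \<phi> (x', s)) = \<tau> (susp_class \<phi> (x, s))"
        using C0(4) C(4) that(1) by blast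
      then show ?thesis
        using \<tau> by (simp add: displacement_def susp_flow_class F_def)
    qed
    have "g ` chart_domain \<phi> C J = chart_domain \<phi> C (F ` J)"
    proof -
      have "g ` chart_domain \<phi> C J = (\<lambda>(x', s). g (susp_class \<phi> (x', s))) ` (C \<times> J)"
        by (auto simp: chart_domain_def image_image case_prod_beta)
      also have "\<dots> = (\<lambda>(x', s). susp_class \<phi> (x', F s)) ` (C \<times> J)"
        by (rule image_cong) (auto simp: g)
      also have "\<dots> = chart_domain \<phi> C (F ` J)"
        by (force simp: chart_domain_def image_iff)
      finally show ?thesis .
    qed
    moreover have "inv_into (C \<times> F ` J) (susp_class \<phi>) (g (susp_class \<phi> (x', s))) = (x', F s)"
      if "x' \<in> C" "s \<in> J" for x' s
    proof (rule inv_into_f_eq)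
      show "inj_on (susp_class \<phi>) (C \<times> F ` J)"
      proof (rule inj_onI)
        fix u v assume uv: "u \<in> C \<times> F ` J" "v \<in> C \<times> F ` J" "susp_class \<phi> u = susp_class \<phi> v"
        then have "\<bar>snd u - snd v\<bar> < 1"
          using Fpq(2) unfolding FJ by auto
        then show "u = v"
          using class_inj_unit [of "fst u" "snd u" "fst v" "snd v"] uv(3) by (simp add: prod_eq_iff)
      qed
      show "(x', F s) \<in> C \<times> F ` J" "susp_class \<phi> (x', F s) = g (susp_class \<phi> (x', s))"
        using that g by auto
    qed
    moreover have "y \<in> chart_domain \<phi> C J"
      using y C(3) tJ by (auto simp: chart_domain_def)
    ultimately show ?thesis
      using chart dyJ PL by blast
  qed
  then show ?thesis
    using g by (simp add: T_group_def)
qed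

section \<open>Closure of \<open>T\<close> under composition and inversion\<close>

lemma T_group_subset_H0: "T_group \<phi> \<subseteq> H0 \<phi>"
  unfolding T_group_def by blast

text \<open>Any displacement function of \<open>g\<close> may be tested, so composites and inverses
  can use those of \<open>displacement_compose\<close> and \<open>displacement_inv\<close>.\<close>

lemma T_group_iff:
  assumes "displacement \<phi> g \<tau>"
  shows "g \<in> T_group \<phi> \<longleftrightarrow> g \<in> H0 \<phi> \<and> dyadic_displacement \<phi> \<tau>"
proof
  assume "g \<in> T_group \<phi>"
  then show "g \<in> H0 \<phi> \<and> dyadic_displacement \<phi> \<tau>"
    using T_group_dyadic_displacement [OF _ assms] T_group_subset_H0 by blast
next
  assume "g \<in> H0 \<phi> \<and> dyadic_displacement \<phi> \<tau>"
  then show "g \<in> T_group \<phi>"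
    using dyadic_displacement_T_group assms by blast
qed

text \<open>Where \<open>\<sigma>\<close> does not depend on the base point, neither does the time
  \<open>F x s\<close> at which \<open>\<tau>\<close> is evaluated.\<close>

lemma dyadic_displacement_compose:
  assumes \<tau>: "displacement \<phi> g \<tau>" "dyadic_displacement \<phi> \<tau>"
    and \<sigma>: "displacement \<phi> h \<sigma>" "dyadic_displacement \<phi> \<sigma>"
  shows "dyadic_displacement \<phi> (\<lambda>y. \<tau> (h y) + \<sigma> y)"
  unfolding dyadic_displacement_def
proof (intro allI conjI)
  fix x t
  define F where "F x s = s + \<sigma> (susp_class \<phi> (x, s))" for x s
  have h: "h (susp_class \<phi> (x, s)) = susp_class \<phi> (x, F x s)" for x s
    using \<sigma>(1) by (simp add: displacement_def F_def susp_flow_class)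
  have cont: "continuous_on UNIV (F x)"
    unfolding F_def using continuous_flow_line \<sigma>(1) by (auto simp: displacement_def)
  obtain C e where C: "open C" "x \<in> C" "e > 0" "\<And>x' s. x' \<in> C \<Longrightarrow> \<bar>s - t\<bar> < e \<Longrightarrow>
        \<sigma> (susp_class \<phi> (x', s)) = \<sigma> (susp_class \<phi> (x, s))"
    using dyadic_displacement_locally_const [OF \<sigma>(2), of x t] by blast
  obtain D d where D: "open D" "x \<in> D" "d > 0" "\<And>x' s. x' \<in> D \<Longrightarrow> \<bar>s - F x t\<bar> < d \<Longrightarrow>
        \<tau> (susp_class \<phi> (x', s)) = \<tau> (susp_class \<phi> (x, s))"
    using dyadic_displacement_locally_const [OF \<tau>(2), of x "F x t"] by blast
  have "isCont (F x) t"
    using cont by (simp add: continuous_on_eq_continuous_at)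
  then obtain k where k: "k > 0" "\<And>s. \<bar>s - t\<bar> < k \<Longrightarrow> \<bar>F x s - F x t\<bar> < d"
    using isCont_real_eps_delta [OF _ D(3)] by blast
  have const: "\<tau> (h (susp_class \<phi> (x', s))) + \<sigma> (susp_class \<phi> (x', s)) =
      \<tau> (h (susp_class \<phi> (x, s))) + \<sigma> (susp_class \<phi> (x, s))" if "x' \<in> C \<inter> D" "\<bar>s - t\<bar> < min e k" for x' s
  proof -
    have *: "\<sigma> (susp_class \<phi> (x', s)) = \<sigma> (susp_class \<phi> (x, s))"
      using that by (intro C(4)) auto
    then have "F x' s = F x s"
      by (simp add: F_def)
    then show ?thesis
      using * D(4) [of x' "F x s"] k(2) [of s] that by (simp add: h)
  qed
  show "\<exists>C e. open C \<and> x \<in> C \<and> e > 0 \<and> (\<forall>x'\<in>C. \<forall>s. \<bar>s - t\<bar> < e \<longrightarrow>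
       \<tau> (h (susp_class \<phi> (x', s))) + \<sigma> (susp_class \<phi> (x', s)) =
       \<tau> (h (susp_class \<phi> (x, s))) + \<sigma> (susp_class \<phi> (x, s)))"
  proof -
    have "open (C \<inter> D)" "x \<in> C \<inter> D" "0 < min e k"
      using C(1-3) D(1,2) k(1) by auto
    then show ?thesis
      using const by blast
  qed
  have "dyadic_germ (\<lambda>s. F x s + \<tau> (susp_class \<phi> (x, F x s))) t"
  proof (rule dyadic_germ_compose [of "F x" t "\<lambda>s. s + \<tau> (susp_class \<phi> (x, s))"])
    show "dyadic_germ (F x) t"
      unfolding F_def by (rule dyadic_displacement_germ [OF \<sigma>(2)])
    show "dyadic_germ (\<lambda>s. s + \<tau> (susp_class \<phi> (x, s))) (F x t)"
      by (rule dyadic_displacement_germ [OF \<tau>(2)])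
  qed
  then show "dyadic_germ (\<lambda>s. s + (\<tau> (h (susp_class \<phi> (x, s))) + \<sigma> (susp_class \<phi> (x, s)))) t"
    by (simp add: h F_def algebra_simps)
qed

text \<open>The lifts are inverse exactly, not just up to integers, because \<open>\<sigma>\<close>
  is minus \<open>\<tau>\<close> at the very same point of the suspension.\<close>

lemma displacement_inv_line:
  assumes g: "g \<in> H0 \<phi>" and \<tau>: "displacement \<phi> g \<tau>"
  defines "\<sigma> \<equiv> \<lambda>y. - \<tau> (inv_into Y g y)"
  shows "s + \<tau> (susp_class \<phi> (x, s)) + \<sigma> (susp_class \<phi> (x, s + \<tau> (susp_class \<phi> (x, s)))) = s"
    and "s + \<sigma> (susp_class \<phi> (x, s)) + \<tau> (susp_class \<phi> (x, s + \<sigma> (susp_class \<phi> (x, s)))) = s"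
proof -
  have "susp_class \<phi> (x, s + \<tau> (susp_class \<phi> (x, s))) = g (susp_class \<phi> (x, s))"
    using \<tau> by (simp add: displacement_def susp_flow_class)
  then show "s + \<tau> (susp_class \<phi> (x, s)) + \<sigma> (susp_class \<phi> (x, s + \<tau> (susp_class \<phi> (x, s)))) = s"
    using H0_inj_on [OF g] by (simp add: \<sigma>_def)
  have "displacement \<phi> (susp_inv \<phi> g) \<sigma>"
    unfolding \<sigma>_def by (rule displacement_inv [OF g \<tau>])
  then have "susp_class \<phi> (x, s + \<sigma> (susp_class \<phi> (x, s))) = inv_into Y g (susp_class \<phi> (x, s))"
    by (simp add: displacement_def susp_flow_class)
  then show "s + \<sigma> (susp_class \<phi> (x, s)) + \<tau> (susp_class \<phi> (x, s + \<sigma> (susp_class \<phi> (x, s)))) = s"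
    by (simp add: \<sigma>_def)
qed

lemma dyadic_displacement_inv:
  assumes g: "g \<in> H0 \<phi>" and \<tau>: "displacement \<phi> g \<tau>" "dyadic_displacement \<phi> \<tau>"
  shows "dyadic_displacement \<phi> (\<lambda>y. - \<tau> (inv_into Y g y))"
  unfolding dyadic_displacement_def
proof (intro allI conjI)
  fix x u
  define \<sigma> where "\<sigma> = (\<lambda>y. - \<tau> (inv_into Y g y))"
  define F where "F x s = s + \<tau> (susp_class \<phi> (x, s))" for x s
  define E where "E x s = s + \<sigma> (susp_class \<phi> (x, s))" for x s
  have EF: "E x (F x s) = s" and FE: "F x (E x s) = s" for x s
    using displacement_inv_line [OF g \<tau>(1)] by (auto simp: E_def F_def \<sigma>_def)
  have "continuous_map (susp_top \<phi>) euclideanreal \<sigma>"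
    using displacement_inv [OF g \<tau>(1)] unfolding displacement_def \<sigma>_def by blast
  from continuous_flow_line [OF this] have "continuous_on UNIV (E x)"
    unfolding E_def .
  then have "isCont (E x) u"
    by (simp add: continuous_on_eq_continuous_at)
  obtain C e where C: "open C" "x \<in> C" "e > 0" "\<And>x' s. x' \<in> C \<Longrightarrow> \<bar>s - E x u\<bar> < e \<Longrightarrow>
        \<tau> (susp_class \<phi> (x', s)) = \<tau> (susp_class \<phi> (x, s))"
    using dyadic_displacement_locally_const [OF \<tau>(2), of x "E x u"] by blast
  obtain k where k: "k > 0" "\<And>s. \<bar>s - u\<bar> < k \<Longrightarrow> \<bar>E x s - E x u\<bar> < e"
    using isCont_real_eps_delta [OF \<open>isCont (E x) u\<close> C(3)] by blast
  have "\<sigma> (susp_class \<phi> (x', s)) = \<sigma> (susp_class \<phi> (x, s))" if "x' \<in> C" "\<bar>s - u\<bar> < k" for x' s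
  proof -
    \<comment> \<open>Near \<open>E x u\<close> the lifts over \<open>x\<close> and
      \<open>x'\<close> agree; applying \<open>E x'\<close> carries the agreement over to the
      inverses.\<close>
    have "F x' (E x s) = F x (E x s)"
      using C(4) [of x' "E x s"] k(2) that by (simp add: F_def)
    then have "F x' (E x s) = s"
      by (simp add: FE)
    from arg_cong [OF this, of "E x'"] have "E x' s = E x s"
      by (simp add: EF)
    then show ?thesis
      by (simp add: E_def)
  qed
  then show "\<exists>C e. open C \<and> x \<in> C \<and> e > 0 \<and> (\<forall>x'\<in>C. \<forall>s. \<bar>s - u\<bar> < e \<longrightarrow>
       - \<tau> (inv_into Y g (susp_class \<phi> (x', s))) =
       - \<tau> (inv_into Y g (susp_class \<phi> (x, s))))"
    using C(1,2) k(1) unfolding \<sigma>_def by blast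
  have "dyadic_germ (F x) (E x u)"
    unfolding F_def by (rule dyadic_displacement_germ [OF \<tau>(2)])
  from dyadic_germ_inverse [OF this EF]
  show "dyadic_germ (\<lambda>s. s + - \<tau> (inv_into Y g (susp_class \<phi> (x, s)))) u"
    by (simp add: FE) (simp add: E_def \<sigma>_def)
qed

lemma T_group_subgroup: "subgroup (T_group \<phi>) (BijGroup Y)"
proof (rule group.subgroupI [OF group_BijGroup])
  have H0: "H0 \<phi> \<subseteq> carrier (BijGroup Y)"
    using H0_subgroup by (rule subgroup.subset)
  then show "T_group \<phi> \<subseteq> carrier (BijGroup Y)"
    using T_group_subset_H0 by blast
  have id: "displacement \<phi> (\<lambda>y\<in>Y. y) (\<lambda>y. 0)"
    by (simp add: displacement_def)
  then have "(\<lambda>y\<in>Y. y) \<in> H0 \<phi>"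
    by (auto simp: H0_iff inj_on_def)
  moreover have "dyadic_displacement \<phi> (\<lambda>y. 0)"
    using dyadic_germ_translation [of 0]
    by (auto simp: dyadic_displacement_def intro!: exI [of _ UNIV] exI [of _ "1::real"])
  ultimately show "T_group \<phi> \<noteq> {}"
    using T_group_iff [OF id] by blast
  show "inv\<^bsub>BijGroup Y\<^esub> g \<in> T_group \<phi>" if "g \<in> T_group \<phi>" for g
  proof -
    have g: "g \<in> H0 \<phi>"
      using that T_group_subset_H0 by blast
    obtain \<tau> where \<tau>: "displacement \<phi> g \<tau>"
      using H0_displacement [OF g] .
    then have "dyadic_displacement \<phi> \<tau>"
      using that T_group_iff by blast
    then have "susp_inv \<phi> g \<in> T_group \<phi>"
      using T_group_iff [OF displacement_inv [OF g \<tau>]] dyadic_displacement_inv [OF g \<tau>]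
        H0_restrict_inv_into [OF g] by blast
    then show ?thesis
      by (simp add: inv_BijGroup H0_Bij [OF g])
  qed
  show "g \<otimes>\<^bsub>BijGroup Y\<^esub> h \<in> T_group \<phi>" if "g \<in> T_group \<phi>" "h \<in> T_group \<phi>" for g h
  proof -
    have g: "g \<in> H0 \<phi>" and h: "h \<in> H0 \<phi>"
      using that T_group_subset_H0 by auto
    obtain \<tau> \<sigma> where \<tau>: "displacement \<phi> g \<tau>" and \<sigma>: "displacement \<phi> h \<sigma>"
      using H0_displacement [OF g] H0_displacement [OF h] by metis
    then have "dyadic_displacement \<phi> \<tau>" "dyadic_displacement \<phi> \<sigma>"
      using that T_group_iff by blast+
    then have "compose Y g h \<in> T_group \<phi>"
      using T_group_iff [OF displacement_compose [OF \<tau> \<sigma> H0_continuous [OF h]]]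
        dyadic_displacement_compose [OF \<tau> _ \<sigma>] H0_compose [OF g h] by blast
    then show ?thesis
      by (simp add: BijGroup_def H0_Bij g h)
  qed
qed

end

section \<open>Approximation by dyadic maps\<close>

text \<open>Affine pieces with two consecutive powers of 2 as slopes suffice to map one dyadic interval
  onto another: with \<open>2^m (b - a) \<le> d - c < 2^(m+1) (b - a)\<close>, the line of slope \<open>2^m\<close> through
  \<open>(a, c)\<close> and the line of slope \<open>2^(m+1)\<close> through \<open>(b, d)\<close> cross over \<open>]a, b]\<close>.\<close>

definition two_slope :: "real \<Rightarrow> real \<Rightarrow> real \<Rightarrow> real \<Rightarrow> real \<Rightarrow> real" where
  "two_slope a b c d t = (let m = \<lfloor>log 2 ((d - c) / (b - a))\<rfloor> in
     max (2 powi m * (t - a) + c) (2 powi (m + 1) * (t - b) + d))"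

lemma two_slope_exponent:
  assumes "a < b" "c < d"
  defines "m \<equiv> \<lfloor>log 2 ((d - c) / (b - a))\<rfloor>"
  shows "2 powi m * (b - a) \<le> d - c" "d - c < 2 powi (m + 1) * (b - a)"
proof -
  define r where "r = (d - c) / (b - a)"
  have r: "r > 0" "d - c = r * (b - a)"
    using assms by (auto simp: r_def)
  have powi: "(2::real) powi n = 2 powr (of_int n)" for n
    by (simp add: powr_real_of_int')
  have "2 powi m \<le> r" "r < 2 powi (m + 1)"
    using r(1) unfolding m_def r_def [symmetric] powi
    by (simp_all add: powr_le_iff less_powr_iff)
  then show "2 powi m * (b - a) \<le> d - c" "d - c < 2 powi (m + 1) * (b - a)"
    using assms(1) unfolding r(2) by simp_all
qed

text \<open>At \<open>a\<close> the steeper line lies below \<open>c\<close>, and at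
  \<open>b\<close> the flatter one is at most \<open>d\<close>; these are the two inequalities of
  \<open>two_slope_exponent\<close>.\<close>

lemma two_slope_ends:
  assumes "a < b" "c < d"
  shows "two_slope a b c d a = c" "two_slope a b c d b = d"
  using two_slope_exponent [OF assms] assms
  by (auto simp: two_slope_def Let_def max_def algebra_simps)

lemma two_slope_strict_mono: "strict_mono (two_slope a b c d)"
proof (rule strict_monoI)
  fix s t :: real assume "s < t"
  then have "2 powi m * (s - p) + q < 2 powi m * (t - p) + q" for m p q
    by simp
  then show "two_slope a b c d s < two_slope a b c d t"
    unfolding two_slope_def Let_def by (meson max.strict_coboundedI1 max.strict_coboundedI2 max_less_iff_conj)
qed

lemma two_slope_shift: "two_slope (a - 1) (b - 1) (c - 1) (d - 1) (t - 1) = two_slope a b c d t - 1"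
  by (simp add: two_slope_def Let_def)

text \<open>The difference \<open>g - f\<close> is itself a dyadic affine map, of slope
  \<open>2 powi m\<close>; hence its zero, the only possible break, is dyadic. Elsewhere one line
  dominates nearby.\<close>

lemma dyadic_germ_max:
  assumes "b \<in> dyadic_rationals" "b' \<in> dyadic_rationals"
  shows "dyadic_germ (\<lambda>s. max (2 powi m * s + b) (2 powi (m + 1) * s + b')) t"
proof -
  define f where "f s = 2 powi m * s + b" for s
  define g where "g s = 2 powi (m + 1) * s + b'" for s
  have germ: "dyadic_germ f t" "dyadic_germ g t"
    unfolding f_def g_def using assms by (auto intro: dyadic_germ_affine)
  have diff: "g s - f s = 2 powi m * s + (b' - b)" for s
    by (simp add: f_def g_def power_int_add algebra_simps)
  consider "f t < g t" | "g t < f t" | "f t = g t"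
    by linarith
  then have "dyadic_germ (\<lambda>s. max (f s) (g s)) t"
  proof cases
    case 1
    have *: "\<bar>s - t\<bar> < (g t - f t) / 2 powi m \<Longrightarrow> f s < g s" for s
    proof -
      assume "\<bar>s - t\<bar> < (g t - f t) / 2 powi m"
      then have "t - s < (g t - f t) / 2 powi m"
        by linarith
      then have "(t - s) * 2 powi m < g t - f t"
        by (simp add: pos_less_divide_eq)
      moreover have "g s - f s = (g t - f t) - (t - s) * 2 powi m"
        unfolding diff by (simp add: algebra_simps)
      ultimately show "f s < g s"
        by simp
    qed
    have "(g t - f t) / 2 powi m > 0"
      using 1 by simp
    from dyadic_germ_cong [OF germ(2) this, of "\<lambda>s. max (f s) (g s)"] show ?thesis
      using * by (simp add: max_absorb2 less_imp_le)
  next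
    case 2
    have *: "\<bar>s - t\<bar> < (f t - g t) / 2 powi m \<Longrightarrow> g s < f s" for s
    proof -
      assume "\<bar>s - t\<bar> < (f t - g t) / 2 powi m"
      then have "s - t < (f t - g t) / 2 powi m"
        by linarith
      then have "(s - t) * 2 powi m < f t - g t"
        by (simp add: pos_less_divide_eq)
      moreover have "g s - f s = (s - t) * 2 powi m - (f t - g t)"
        using diff [of s] diff [of t] by (simp add: algebra_simps)
      ultimately show "g s < f s"
        by simp
    qed
    have "(f t - g t) / 2 powi m > 0"
      using 2 by simp
    from dyadic_germ_cong [OF germ(1) this, of "\<lambda>s. max (f s) (g s)"] show ?thesis
      using * by (simp add: max_absorb1 less_imp_le)
  next
    case 3
    have "2 powi m * t + (b' - b) = 0"
      using 3 diff [of t] by simp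
    then have "t \<in> dyadic_rationals"
      using dyadic_affine_iff [OF dyadic_diff [OF assms(2,1)], of m t] by simp
    moreover have "max (f s) (g s) = f s" if "s \<le> t" for s
    proof -
      have "2 powi m * s \<le> 2 powi m * t"
        using that by simp
      then have "g s \<le> f s"
        using 3 diff [of s] diff [of t] by linarith
      then show ?thesis
        by simp
    qed
    moreover have "max (f s) (g s) = g s" if "t \<le> s" for s
    proof -
      have "2 powi m * t \<le> 2 powi m * s"
        using that by simp
      then have "f s \<le> g s"
        using 3 diff [of s] diff [of t] by linarith
      then show ?thesis
        by simp
    qed
    ultimately show ?thesis
      using assms by (intro dyadic_germI [of 1 b b' t m "m + 1"]) (auto simp: f_def g_def)
  qed
  then show ?thesis
    by (simp add: f_def g_def)
qed

lemma two_slope_germ: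
  assumes "a \<in> dyadic_rationals" "b \<in> dyadic_rationals" "c \<in> dyadic_rationals" "d \<in> dyadic_rationals"
  shows "dyadic_germ (two_slope a b c d) t"
proof -
  define m where "m = \<lfloor>log 2 ((d - c) / (b - a))\<rfloor>"
  have "two_slope a b c d =
      (\<lambda>s. max (2 powi m * s + (c - 2 powi m * a)) (2 powi (m + 1) * s + (d - 2 powi (m + 1) * b)))"
    by (auto simp: fun_eq_iff two_slope_def Let_def m_def algebra_simps)
  then show ?thesis
    using assms by (simp only:) (intro dyadic_germ_max dyadic_diff dyadic_powi_mult)
qed

lemma dyadic_germ_glue:
  assumes f: "dyadic_germ f t" and g: "dyadic_germ g t" and t: "t \<in> dyadic_rationals" and "d > 0"
    and hf: "\<And>s. t - d < s \<Longrightarrow> s \<le> t \<Longrightarrow> h s = f s" and hg: "\<And>s. t \<le> s \<Longrightarrow> s < t + d \<Longrightarrow> h s = g s"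
  shows "dyadic_germ h t"
proof -
  obtain e m b where e: "e > 0" "b \<in> dyadic_rationals"
      "\<And>s. t - e < s \<Longrightarrow> s \<le> t \<Longrightarrow> f s = 2 powi m * s + b"
    using f unfolding dyadic_germ_def by blast
  obtain e' m' b' where e': "e' > 0" "b' \<in> dyadic_rationals"
      "\<And>s. t \<le> s \<Longrightarrow> s < t + e' \<Longrightarrow> g s = 2 powi m' * s + b'"
    using g unfolding dyadic_germ_def by blast
  show ?thesis
    using t e e' hf hg \<open>d > 0\<close>
    by (intro dyadic_germI [of "min d (min e e')" b b' t m m']) auto
qed

lemma dyadic_germ_isCont:
  assumes "dyadic_germ f t"
  shows "isCont f t"
proof -
  obtain e m m' b b' where e: "e > 0"
    and l: "\<And>s. t - e < s \<Longrightarrow> s \<le> t \<Longrightarrow> f s = 2 powi m * s + b"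
    and r: "\<And>s. t \<le> s \<Longrightarrow> s < t + e \<Longrightarrow> f s = 2 powi m' * s + b'"
    using assms unfolding dyadic_germ_def by blast
  have ft: "f t = 2 powi m * t + b" "f t = 2 powi m' * t + b'"
    using l [of t] r [of t] e by auto
  have "((\<lambda>s. 2 powi m * s + b) \<longlongrightarrow> 2 powi m * t + b) (at_left t)"
    by (intro tendsto_intros)
  then have "(f \<longlongrightarrow> f t) (at_left t)"
    unfolding ft(1) [symmetric]
    by (rule Lim_transform_eventually) (use e l in \<open>auto intro!: eventually_at_leftI [of "t - e"]\<close>)
  moreover have "((\<lambda>s. 2 powi m' * s + b') \<longlongrightarrow> 2 powi m' * t + b') (at_right t)"
    by (intro tendsto_intros)
  then have "(f \<longlongrightarrow> f t) (at_right t)"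
    unfolding ft(2) [symmetric]
    by (rule Lim_transform_eventually) (use e r in \<open>auto intro!: eventually_at_rightI [of _ "t + e"]\<close>)
  ultimately show ?thesis
    by (simp add: isCont_def filterlim_split_at)
qed

section \<open>Locally constant functions and the mesh construction\<close>

definition locally_const :: "('a::topological_space \<Rightarrow> 'b) \<Rightarrow> bool" where
  "locally_const f \<longleftrightarrow> (\<forall>x. \<exists>C. open C \<and> x \<in> C \<and> (\<forall>x'\<in>C. f x' = f x))"

lemma locally_constD: "locally_const f \<Longrightarrow> \<exists>C. open C \<and> x \<in> C \<and> (\<forall>x'\<in>C. f x' = f x)"
  by (simp add: locally_const_def)

text \<open>Near each point one dyadic number approximates \<open>f\<close> on a clopen set.
  Finitely many such sets cover \<open>X\<close>; overwriting the values on one after the other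
  keeps local constancy because the sets are closed as well as open.\<close>

lemma locally_const_dyadic_approx:
  fixes f :: "'a::t2_space \<Rightarrow> real"
  assumes X: "compact (UNIV :: 'a set)" "\<And>x::'a. connected_component_set UNIV x = {x}"
    and f: "continuous_on UNIV f" and "e > 0"
  obtains v where "locally_const v" "range v \<subseteq> dyadic_rationals" "\<And>x. \<bar>v x - f x\<bar> < e"
proof -
  have "\<exists>C r. open C \<and> closed C \<and> x \<in> C \<and> r \<in> dyadic_rationals \<and> (\<forall>x'\<in>C. \<bar>r - f x'\<bar> < e)" for x
  proof -
    obtain r where r: "r \<in> dyadic_rationals" "f x < r" "r < f x + e"
      using dyadic_between [of "f x" "f x + e"] \<open>e > 0\<close> by auto
    have "open (f -` ball r e)"
      using f by (rule open_vimage [OF open_ball])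
    moreover have "x \<in> f -` ball r e"
      using r by (simp add: dist_real_def)
    ultimately obtain C where "open C" "closed C" "x \<in> C" "C \<subseteq> f -` ball r e"
      using clopen_neighbourhood [OF X] by blast
    then show ?thesis
      using r(1) by (intro exI [of _ C] exI [of _ r]) (auto simp: dist_real_def)
  qed
  then have "\<forall>x. \<exists>C r. open C \<and> closed C \<and> x \<in> C \<and> r \<in> dyadic_rationals \<and> (\<forall>x'\<in>C. \<bar>r - f x'\<bar> < e)"
    by blast
  then obtain C r where "\<forall>x. open (C x) \<and> closed (C x) \<and> x \<in> C x \<and> r x \<in> dyadic_rationals \<and>
      (\<forall>x'\<in>C x. \<bar>r x - f x'\<bar> < e)"
    unfolding choice_iff by blast
  then have C: "\<And>x. open (C x)" "\<And>x. closed (C x)" "\<And>x. x \<in> C x"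
      and r: "\<And>x. r x \<in> dyadic_rationals" "\<And>x x'. x' \<in> C x \<Longrightarrow> \<bar>r x - f x'\<bar> < e"
    by blast+
  have "\<exists>v. locally_const v \<and> range v \<subseteq> dyadic_rationals \<and> (\<forall>x\<in>\<Union>(C ` K). \<bar>v x - f x\<bar> < e)"
    if "finite K" for K
    using that
  proof induction
    case empty
    have "locally_const (\<lambda>x::'a. 0::real)"
      unfolding locally_const_def by (auto intro!: exI [of _ UNIV])
    then show ?case
      by (intro exI [of _ "\<lambda>x. 0"]) auto
  next
    case (insert k K)
    then obtain v where v: "locally_const v" "range v \<subseteq> dyadic_rationals" "\<And>x. x \<in> \<Union>(C ` K) \<Longrightarrow> \<bar>v x - f x\<bar> < e"
      by blast
    define u where "u x = (if x \<in> C k then r k else v x)" for x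
    have "\<exists>D. open D \<and> x \<in> D \<and> (\<forall>x'\<in>D. u x' = u x)" for x
    proof (cases "x \<in> C k")
      case True
      show ?thesis
      proof (rule exI [of _ "C k"], intro conjI)
        show "open (C k)"
          by (rule C(1))
        show "x \<in> C k"
          by (rule True)
        show "\<forall>x'\<in>C k. u x' = u x"
          using True by (simp add: u_def)
      qed
    next
      case False
      from locally_constD [OF v(1), of x]
      obtain D where D: "open D" "x \<in> D" "\<forall>x'\<in>D. v x' = v x"
        by (elim exE conjE)
      have "u x' = u x" if "x' \<in> D - C k" for x'
        using that False bspec [OF D(3), of x'] by (simp add: u_def)
      then have const: "\<forall>x'\<in>D - C k. u x' = u x"
        by blast
      show ?thesis
      proof (rule exI [of _ "D - C k"], intro conjI)
        show "open (D - C k)"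
          by (rule open_Diff [OF D(1) C(2)])
        show "x \<in> D - C k"
          using D(2) False by blast
      qed (rule const)
    qed
    then have "locally_const u"
      by (simp add: locally_const_def)
    moreover have "range u \<subseteq> dyadic_rationals"
      using v(2) r(1) by (simp add: u_def image_subset_iff)
    moreover have "\<bar>u x - f x\<bar> < e" if "x \<in> \<Union>(C ` insert k K)" for x
      using that v(3) [of x] r(2) [of x k] by (auto simp: u_def)
    ultimately show ?case
      by blast
  qed
  moreover have cover: "UNIV \<subseteq> (\<Union>x\<in>UNIV. C x)"
    using C(3) by blast
  obtain K where "finite K" "UNIV \<subseteq> \<Union>(C ` K)"
    by (rule compactE_image [OF X(1) C(1) cover])
  ultimately obtain v where "locally_const v" "range v \<subseteq> dyadic_rationals" "\<forall>x\<in>\<Union>(C ` K). \<bar>v x - f x\<bar> < e"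
    by blast
  then show ?thesis
    using that \<open>UNIV \<subseteq> \<Union>(C ` K)\<close> by blast
qed

text \<open>The values at the points \<open>j / N\<close> of an equivariant family of functions on the line, given those
  for \<open>0 \<le> j < N\<close> (where \<open>N\<close> is the length of the list \<open>vs\<close>), and its interpolation.\<close>

definition mesh_value :: "('a \<Rightarrow> 'a) \<Rightarrow> ('a \<Rightarrow> real) list \<Rightarrow> 'a \<Rightarrow> int \<Rightarrow> real" where
  "mesh_value \<phi> vs x j =
     (vs ! nat (j mod int (length vs))) (zpow \<phi> (j div int (length vs)) x) + of_int (j div int (length vs))"

definition mesh_piece :: "('a \<Rightarrow> 'a) \<Rightarrow> ('a \<Rightarrow> real) list \<Rightarrow> 'a \<Rightarrow> int \<Rightarrow> real \<Rightarrow> real" where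
  "mesh_piece \<phi> vs x j =
     two_slope (of_int j / length vs) (of_int (j + 1) / length vs)
       (mesh_value \<phi> vs x j) (mesh_value \<phi> vs x (j + 1))"

definition mesh_line :: "('a \<Rightarrow> 'a) \<Rightarrow> ('a \<Rightarrow> real) list \<Rightarrow> 'a \<Rightarrow> real \<Rightarrow> real" where
  "mesh_line \<phi> vs x t = mesh_piece \<phi> vs x \<lfloor>t * length vs\<rfloor> t"

definition mesh_displacement :: "('a \<Rightarrow> 'a) \<Rightarrow> ('a \<Rightarrow> real) list \<Rightarrow> ('a \<times> real) set \<Rightarrow> real" where
  "mesh_displacement \<phi> vs = susp_descend (\<lambda>(x, t). mesh_line \<phi> vs x t - t)"

definition mesh_map ::
    "('a \<Rightarrow> 'a) \<Rightarrow> ('a \<Rightarrow> real) list \<Rightarrow> ('a \<times> real) set \<Rightarrow> ('a \<times> real) set" where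
  "mesh_map \<phi> vs = (\<lambda>y\<in>suspension \<phi>. susp_flow (mesh_displacement \<phi> vs y) y)"

context stone_suspension
begin

text \<open>As \<open>[x,t] = [\<phi> x, t - 1]\<close>, a lift satisfies
  \<open>F (\<phi> x) (t - 1) = F x t - 1\<close>; at mesh points the unit of time becomes a shift
  of \<open>j\<close> by the number of points per unit.\<close>

lemma mesh_value_shift:
  assumes "vs \<noteq> []"
  shows "mesh_value \<phi> vs (\<phi> x) (j - int (length vs)) = mesh_value \<phi> vs x j - 1"
proof -
  have "(j - int (length vs)) div int (length vs) = j div int (length vs) - 1"
    "(j - int (length vs)) mod int (length vs) = j mod int (length vs)"
    using assms div_add_self2 [of "int (length vs)" "j - int (length vs)"] by simp_all
  moreover have "zpow \<phi> (k - 1) (\<phi> x) = zpow \<phi> k x" for k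
    using zpow_add [OF bij_stone, of "k - 1" 1 x] by simp
  ultimately show ?thesis
    by (simp add: mesh_value_def)
qed

lemma mesh_line_shift:
  assumes "vs \<noteq> []"
  shows "mesh_line \<phi> vs (\<phi> x) (t - 1) = mesh_line \<phi> vs x t - 1"
proof -
  define N where "N = int (length vs)"
  have N: "real (length vs) = of_int N" "N > 0"
    using assms by (simp_all add: N_def)
  define j where "j = \<lfloor>t * real (length vs)\<rfloor>"
  have "\<lfloor>(t - 1) * real (length vs)\<rfloor> = j - N"
    unfolding j_def N by (simp add: left_diff_distrib)
  moreover have "real_of_int (j - N) / length vs = of_int j / length vs - 1"
      "real_of_int (j - N + 1) / length vs = of_int (j + 1) / length vs - 1"
    using N by (simp_all add: field_simps)
  moreover have "mesh_value \<phi> vs (\<phi> x) (j - N) = mesh_value \<phi> vs x j - 1"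
    "mesh_value \<phi> vs (\<phi> x) (j - N + 1) = mesh_value \<phi> vs x (j + 1) - 1"
    using mesh_value_shift [OF assms, of x j] mesh_value_shift [OF assms, of x "j + 1"]
    by (simp_all add: N_def algebra_simps)
  ultimately show ?thesis
    unfolding mesh_line_def mesh_piece_def j_def [symmetric] by (simp only: two_slope_shift)
qed

lemma mesh_displacement_class:
  assumes "vs \<noteq> []"
  shows "mesh_displacement \<phi> vs (susp_class \<phi> (x, t)) = mesh_line \<phi> vs x t - t"
proof -
  have "(\<lambda>(x, t). mesh_line \<phi> vs x t - t) (zpow \<phi> n x, t - of_int n) = (\<lambda>(x, t). mesh_line \<phi> vs x t - t) (x, t)"
    for n x t
    by (rule zpow_invariantI [OF bij_stone]) (simp add: mesh_line_shift [OF assms])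
  from susp_descend_class [of "\<lambda>(x, t). mesh_line \<phi> vs x t - t" \<phi>, OF this] show ?thesis
    by (simp add: mesh_displacement_def)
qed

end

text \<open>The length \<open>2 ^ q\<close> makes the mesh points dyadic. Monotonicity is required
  at all integers \<open>j\<close>, which includes the step from the last function of the list at
  \<open>x\<close> to the first one at \<open>\<phi> x\<close>, raised by 1.\<close>

locale stone_mesh = stone_suspension \<phi> for \<phi> :: "'a::t2_space \<Rightarrow> 'a" +
  fixes vs :: "('a \<Rightarrow> real) list" and q :: nat
  assumes length: "length vs = 2 ^ q"
    and locally_const: "\<And>v. v \<in> set vs \<Longrightarrow> locally_const v"
    and dyadic: "\<And>v. v \<in> set vs \<Longrightarrow> range v \<subseteq> dyadic_rationals"
    and increasing: "\<And>x j. mesh_value \<phi> vs x j < mesh_value \<phi> vs x (j + 1)"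
begin

lemma vs_nonempty: "vs \<noteq> []"
  using length by auto

lemma nth_mem_mod: "vs ! nat (j mod int (length vs)) \<in> set vs"
  using vs_nonempty by (intro nth_mem) (simp add: nat_less_iff)

lemma mesh_point_dyadic: "of_int j / real (length vs) \<in> dyadic_rationals"
  unfolding dyadic_rationals_iff using length by (intro exI [of _ j] exI [of _ q]) simp

lemma mesh_value_dyadic: "mesh_value \<phi> vs x j \<in> dyadic_rationals"
  unfolding mesh_value_def using dyadic [OF nth_mem_mod] by (intro dyadic_add dyadic_of_int) blast

lemma mesh_value_locally_const: "locally_const (\<lambda>x. mesh_value \<phi> vs x j)"
  unfolding locally_const_def
proof
  fix x
  define k where "k = j div int (length vs)"
  from locally_constD [OF locally_const [OF nth_mem_mod [of j]], of "zpow \<phi> k x"]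
  obtain C where C: "open C" "zpow \<phi> k x \<in> C"
    "\<forall>x'\<in>C. (vs ! nat (j mod int (length vs))) x' = (vs ! nat (j mod int (length vs))) (zpow \<phi> k x)"
    by (elim exE conjE)
  have "open (zpow \<phi> k -` C)"
    using C(1) continuous_zpow by (rule open_vimage)
  moreover have "mesh_value \<phi> vs x' j = mesh_value \<phi> vs x j" if "x' \<in> zpow \<phi> k -` C" for x'
    using bspec [OF C(3), of "zpow \<phi> k x'"] that by (simp add: mesh_value_def k_def)
  moreover have "x \<in> zpow \<phi> k -` C"
    using C(2) by simp
  ultimately show "\<exists>C. open C \<and> x \<in> C \<and> (\<forall>x'\<in>C. mesh_value \<phi> vs x' j = mesh_value \<phi> vs x j)"
    by (intro exI [of _ "zpow \<phi> k -` C"] conjI ballI)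
qed

lemma mesh_step: "of_int j / real (length vs) < of_int (j + 1) / real (length vs)"
  using length by (simp add: divide_strict_right_mono)

lemma mesh_piece_ends:
  "mesh_piece \<phi> vs x j (of_int j / length vs) = mesh_value \<phi> vs x j"
  "mesh_piece \<phi> vs x j (of_int (j + 1) / length vs) = mesh_value \<phi> vs x (j + 1)"
  unfolding mesh_piece_def using two_slope_ends [OF mesh_step increasing] by auto

text \<open>At the right end of a cell the floor already selects the next piece, but neighbouring
  pieces share the mesh value there.\<close>

lemma mesh_line_piece:
  assumes "of_int j / length vs \<le> s" "s \<le> of_int (j + 1) / length vs"
  shows "mesh_line \<phi> vs x s = mesh_piece \<phi> vs x j s"
proof (cases "s = of_int (j + 1) / length vs")
  case True
  then have "\<lfloor>s * length vs\<rfloor> = j + 1"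
    using vs_nonempty by simp
  then show ?thesis
    using True mesh_piece_ends [of x j] mesh_piece_ends [of x "j + 1"] by (simp add: mesh_line_def)
next
  case False
  then have "of_int j \<le> s * length vs" "s * length vs < of_int j + 1"
    using assms vs_nonempty by (auto simp: field_simps)
  then have "\<lfloor>s * length vs\<rfloor> = j"
    by linarith
  then show ?thesis
    by (simp add: mesh_line_def)
qed

lemma mesh_bracket:
  obtains j where "of_int j / length vs \<le> t" "t < of_int (j + 1) / length vs"
proof -
  have "of_int \<lfloor>t * length vs\<rfloor> \<le> t * length vs" "t * length vs < of_int (\<lfloor>t * length vs\<rfloor> + 1)"
    by linarith+
  then show ?thesis
    using that [of "\<lfloor>t * length vs\<rfloor>"] vs_nonempty by (simp add: field_simps)
qed

lemma mesh_line_bounds: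
  assumes "of_int j / length vs \<le> s" "s \<le> of_int (j + 1) / length vs"
  shows "mesh_value \<phi> vs x j \<le> mesh_line \<phi> vs x s" "mesh_line \<phi> vs x s \<le> mesh_value \<phi> vs x (j + 1)"
proof -
  have "mono (mesh_piece \<phi> vs x j)"
    unfolding mesh_piece_def by (rule strict_mono_mono [OF two_slope_strict_mono])
  from monoD [OF this assms(1)] monoD [OF this assms(2)]
  show "mesh_value \<phi> vs x j \<le> mesh_line \<phi> vs x s" "mesh_line \<phi> vs x s \<le> mesh_value \<phi> vs x (j + 1)"
    by (simp_all only: mesh_piece_ends mesh_line_piece [OF assms])
qed

lemma mesh_value_mono: "i \<le> j \<Longrightarrow> mesh_value \<phi> vs x i \<le> mesh_value \<phi> vs x j"
proof (induction j rule: int_ge_induct)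
  case (step j)
  then show ?case
    using increasing [of x j] by simp
qed simp

lemma mesh_line_strict_mono: "strict_mono (mesh_line \<phi> vs x)"
proof (rule strict_monoI)
  fix s t :: real assume "s < t"
  obtain i where i: "of_int i / length vs \<le> s" "s < of_int (i + 1) / length vs"
    using mesh_bracket .
  obtain j where j: "of_int j / length vs \<le> t" "t < of_int (j + 1) / length vs"
    using mesh_bracket .
  show "mesh_line \<phi> vs x s < mesh_line \<phi> vs x t"
  proof (cases "t \<le> of_int (i + 1) / length vs")
    case True
    then have "mesh_line \<phi> vs x s = mesh_piece \<phi> vs x i s" "mesh_line \<phi> vs x t = mesh_piece \<phi> vs x i t"
      using i \<open>s < t\<close> by (auto intro!: mesh_line_piece)
    then show ?thesis
      using strict_monoD [OF two_slope_strict_mono \<open>s < t\<close>] by (simp add: mesh_piece_def)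
  next
    case False
    have "of_int (i + 1) / real (length vs) < of_int (j + 1) / real (length vs)"
      using False j by linarith
    then have "i + 1 \<le> j"
      using vs_nonempty by (simp add: divide_less_cancel)
    have "mesh_line \<phi> vs x s = mesh_piece \<phi> vs x i s"
      using i by (auto intro!: mesh_line_piece)
    also have "\<dots> < mesh_piece \<phi> vs x i (of_int (i + 1) / length vs)"
      unfolding mesh_piece_def by (rule strict_monoD [OF two_slope_strict_mono i(2)])
    also have "\<dots> = mesh_value \<phi> vs x (i + 1)"
      by (rule mesh_piece_ends)
    also have "\<dots> \<le> mesh_value \<phi> vs x j"
      using \<open>i + 1 \<le> j\<close> by (rule mesh_value_mono)
    also have "\<dots> \<le> mesh_line \<phi> vs x t"
      using j by (intro mesh_line_bounds) auto
    finally show ?thesis .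
  qed
qed

lemma mesh_piece_germ: "dyadic_germ (mesh_piece \<phi> vs x j) t"
  unfolding mesh_piece_def by (intro two_slope_germ mesh_point_dyadic mesh_value_dyadic)

text \<open>Inside a cell the germ is that of its piece; at a mesh point two pieces meet, and the
  break is allowed because mesh points are dyadic.\<close>

lemma mesh_line_germ: "dyadic_germ (mesh_line \<phi> vs x) t"
proof -
  obtain j where j: "of_int j / length vs \<le> t" "t < of_int (j + 1) / length vs"
    using mesh_bracket .
  show ?thesis
  proof (cases "t = of_int j / length vs")
    case False
    define e where "e = min (t - of_int j / length vs) (of_int (j + 1) / length vs - t)"
    have "e > 0"
      using False j by (simp add: e_def)
    show ?thesis
    proof (rule dyadic_germ_cong [OF mesh_piece_germ [of x j] \<open>e > 0\<close>])
      fix s assume "\<bar>s - t\<bar> < e"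
      then have "of_int j / length vs \<le> s" "s \<le> of_int (j + 1) / length vs"
        unfolding e_def by linarith+
      then show "mesh_line \<phi> vs x s = mesh_piece \<phi> vs x j s"
        by (rule mesh_line_piece)
    qed
  next
    case True
    define e where "e = 1 / real (length vs)"
    have e: "e > 0" "of_int (j + 1) / length vs = t + e" "of_int (j - 1) / length vs = t - e"
      using vs_nonempty True by (simp_all add: e_def add_divide_distrib diff_divide_distrib)
    show ?thesis
    proof (rule dyadic_germ_glue [OF mesh_piece_germ [of x "j - 1"] mesh_piece_germ [of x j] _ e(1)])
      show "t \<in> dyadic_rationals"
        using True mesh_point_dyadic by simp
      show "mesh_line \<phi> vs x s = mesh_piece \<phi> vs x (j - 1) s" if "t - e < s" "s \<le> t" for s
        using that e True by (intro mesh_line_piece) auto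
      show "mesh_line \<phi> vs x s = mesh_piece \<phi> vs x j s" if "t \<le> s" "s < t + e" for s
        using that e True by (intro mesh_line_piece) auto
    qed
  qed
qed

text \<open>Within distance \<open>e\<close> of \<open>t\<close> only the cells \<open>j - 1\<close>
  and \<open>j\<close> occur, so constancy of three mesh values is enough. The left cell has to be
  included because \<open>t\<close> may be its right end.\<close>

lemma mesh_line_locally_const:
  "\<exists>C e. open C \<and> x \<in> C \<and> e > 0 \<and>
    (\<forall>x'\<in>C. \<forall>s. \<bar>s - t\<bar> < e \<longrightarrow> mesh_line \<phi> vs x' s = mesh_line \<phi> vs x s)"
proof -
  obtain j where j: "of_int j / length vs \<le> t" "t < of_int (j + 1) / length vs"
    using mesh_bracket .
  have "\<forall>i. \<exists>C. open C \<and> x \<in> C \<and> (\<forall>x'\<in>C. mesh_value \<phi> vs x' i = mesh_value \<phi> vs x i)"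
    by (rule allI) (rule mesh_value_locally_const [unfolded locally_const_def, THEN spec])
  from choice [OF this] obtain C where
    nbhd: "\<forall>i. open (C i) \<and> x \<in> C i \<and> (\<forall>x'\<in>C i. mesh_value \<phi> vs x' i = mesh_value \<phi> vs x i)" ..
  have C: "open (C i)" "x \<in> C i" for i
    by (rule conjunct1 [OF spec [OF nbhd]], rule conjunct1 [OF conjunct2 [OF spec [OF nbhd]]])
  have const: "mesh_value \<phi> vs x' i = mesh_value \<phi> vs x i" if "x' \<in> C i" for i x'
    using bspec [OF conjunct2 [OF conjunct2 [OF spec [OF nbhd, of i]]] that] .
  have piece: "mesh_piece \<phi> vs x' i = mesh_piece \<phi> vs x i" if "x' \<in> C i" "x' \<in> C (i + 1)" for x' i
    using const [OF that(1)] const [OF that(2)] by (simp add: mesh_piece_def)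
  define e where "e = min (1 / real (length vs)) (of_int (j + 1) / length vs - t)"
  have "e > 0"
    using j vs_nonempty by (simp add: e_def)
  have left: "of_int (j - 1) / length vs \<le> t - 1 / real (length vs)"
    using j vs_nonempty by (simp add: diff_divide_distrib)
  have nbhds: "open (C (j - 1) \<inter> C j \<inter> C (j + 1))" "x \<in> C (j - 1) \<inter> C j \<inter> C (j + 1)"
    using C(1,2) by (simp_all add: open_Int)
  have "mesh_line \<phi> vs x' s = mesh_line \<phi> vs x s"
    if x': "x' \<in> C (j - 1) \<inter> C j \<inter> C (j + 1)" and s: "\<bar>s - t\<bar> < e" for x' s
  proof (cases "of_int j / length vs \<le> s")
    case True
    moreover have "s \<le> of_int (j + 1) / length vs"
      using s unfolding e_def by linarith
    ultimately show ?thesis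
      using mesh_line_piece [of j s] piece [of x' j] x' by simp
  next
    case False
    moreover have "of_int (j - 1) / length vs \<le> s"
      using s left unfolding e_def by linarith
    ultimately show ?thesis
      using mesh_line_piece [of "j - 1" s] piece [of x' "j - 1"] x' by simp
  qed
  then show ?thesis
    using nbhds \<open>e > 0\<close>
    by (intro exI [of _ "C (j - 1) \<inter> C j \<inter> C (j + 1)"] exI [of _ e] conjI ballI allI impI)
qed

text \<open>Local independence of \<open>x\<close> reduces joint continuity to continuity in
  \<open>t\<close>.\<close>

lemma continuous_mesh_line: "continuous_on UNIV (\<lambda>(x, t). mesh_line \<phi> vs x t)"
proof -
  have nbhd: "\<exists>A. open A \<and> p \<in> A \<and> (\<forall>p'\<in>UNIV. p' \<in> A \<longrightarrow> (\<lambda>(x, t). mesh_line \<phi> vs x t) p' \<in> B)"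
    if "open B" "(\<lambda>(x, t). mesh_line \<phi> vs x t) p \<in> B" for p B
  proof -
    obtain x t where p: "p = (x, t)"
      by (cases p)
    from mesh_line_locally_const [of x t]
    obtain C e where C: "open C" "x \<in> C" "e > 0"
      "\<forall>x'\<in>C. \<forall>s. \<bar>s - t\<bar> < e \<longrightarrow> mesh_line \<phi> vs x' s = mesh_line \<phi> vs x s"
      by (elim exE conjE)
    have "isCont (mesh_line \<phi> vs x) t"
      using mesh_line_germ by (rule dyadic_germ_isCont)
    then have "\<exists>I. open I \<and> t \<in> I \<and> (\<forall>s\<in>I. mesh_line \<phi> vs x s \<in> B)"
      using that unfolding p continuous_at_open by simp
    then obtain I where I: "open I" "t \<in> I" "\<And>s. s \<in> I \<Longrightarrow> mesh_line \<phi> vs x s \<in> B"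
      by blast
    have "(\<lambda>(x, t). mesh_line \<phi> vs x t) p' \<in> B" if p': "p' \<in> C \<times> (I \<inter> ball t e)" for p'
    proof -
      obtain x' s where "p' = (x', s)" "x' \<in> C" "s \<in> I" "\<bar>s - t\<bar> < e"
        using p' by (auto simp: dist_real_def abs_minus_commute)
      then show ?thesis
        using C(4) [rule_format, of x' s] I(3) [of s] by simp
    qed
    moreover have "open (C \<times> (I \<inter> ball t e))" "p \<in> C \<times> (I \<inter> ball t e)"
      using C(1-3) I(1,2) p by (simp_all add: open_Times open_Int)
    ultimately show ?thesis
      by (intro exI [of _ "C \<times> (I \<inter> ball t e)"] conjI ballI impI)
  qed
  show ?thesis
    unfolding continuous_on_topological by (intro ballI allI impI nbhd)
qed

lemma mesh_displacement_line: "t + mesh_displacement \<phi> vs (susp_class \<phi> (x, t)) = mesh_line \<phi> vs x t"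
  by (simp add: mesh_displacement_class [OF vs_nonempty])

lemma displacement_mesh: "displacement \<phi> (mesh_map \<phi> vs) (mesh_displacement \<phi> vs)"
proof -
  have "mesh_displacement \<phi> vs \<circ> susp_class \<phi> = (\<lambda>p. (\<lambda>(x, t). mesh_line \<phi> vs x t) p - snd p)"
    by (auto simp: fun_eq_iff mesh_displacement_class [OF vs_nonempty])
  moreover have "continuous_on UNIV (\<lambda>p. (\<lambda>(x, t). mesh_line \<phi> vs x t) p - snd p)"
    by (intro continuous_intros continuous_mesh_line)
  ultimately have "continuous_map (susp_top \<phi>) euclideanreal (mesh_displacement \<phi> vs)"
    by (simp add: continuous_map_susp_top_iff)
  then show ?thesis
    by (simp add: displacement_def mesh_map_def)
qed

lemma mesh_map_T: "mesh_map \<phi> vs \<in> T_group \<phi>"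
  unfolding T_group_iff [OF displacement_mesh]
proof
  show "mesh_map \<phi> vs \<in> H0 \<phi>"
    using mesh_line_strict_mono
    by (intro H0_intro [OF _ displacement_mesh])
      (simp_all add: mesh_map_def mesh_displacement_line)
  have germ: "dyadic_germ (\<lambda>s. s + mesh_displacement \<phi> vs (susp_class \<phi> (x, s))) t" for x t
    unfolding mesh_displacement_line by (rule mesh_line_germ)
  have const: "\<exists>C e. open C \<and> x \<in> C \<and> e > 0 \<and> (\<forall>x'\<in>C. \<forall>s. \<bar>s - t\<bar> < e \<longrightarrow>
        mesh_displacement \<phi> vs (susp_class \<phi> (x', s)) = mesh_displacement \<phi> vs (susp_class \<phi> (x, s)))" for x t
  proof -
    from mesh_line_locally_const [of x t]
    obtain C e where C: "open C" "x \<in> C" "e > 0"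
      "\<forall>x'\<in>C. \<forall>s. \<bar>s - t\<bar> < e \<longrightarrow> mesh_line \<phi> vs x' s = mesh_line \<phi> vs x s"
      by (elim exE conjE)
    have "mesh_displacement \<phi> vs (susp_class \<phi> (x', s)) = mesh_displacement \<phi> vs (susp_class \<phi> (x, s))"
      if "x' \<in> C" "\<bar>s - t\<bar> < e" for x' s
      using C(4) [rule_format, OF that] by (simp add: mesh_displacement_class [OF vs_nonempty])
    then show ?thesis
      using C(1-3) by (intro exI [of _ C] exI [of _ e] conjI ballI allI impI)
  qed
  show "dyadic_displacement \<phi> (mesh_displacement \<phi> vs)"
    unfolding dyadic_displacement_def by (intro allI conjI const germ)
qed

end

section \<open>Uniform gaps and approximation in the metric\<close>

context stone_suspension
begin

lemma susp_positive_bound: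
  assumes f: "continuous_map (susp_top \<phi>) euclideanreal f" and pos: "\<And>y. y \<in> Y \<Longrightarrow> 0 < f y"
  obtains d where "d > 0" "\<And>y. y \<in> Y \<Longrightarrow> d \<le> f y"
proof -
  have "compact (f ` Y)"
    using image_compactin [OF _ f] compact_space_susp
    by (metis compact_space_def compactin_euclidean_iff topspace_susp_top)
  moreover have "f ` Y \<noteq> {}"
    by (simp add: suspension_nonempty)
  ultimately obtain m where "m \<in> f ` Y" "\<forall>r\<in>f ` Y. m \<le> r"
    using compact_attains_inf by blast
  then show ?thesis
    using that [of m] pos by auto
qed

text \<open>The advance of a lift over time \<open>e\<close> is a continuous positive function on
  the compact suspension, so it has a positive minimum. The bound serves twice: to control inverses,
  and at the mesh width to keep sampled values increasing.\<close>

lemma displacement_gap: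
  assumes "inj_on g Y" and \<tau>: "displacement \<phi> g \<tau>" and "e > 0"
  obtains d where "d > 0"
    "\<And>x t. t + \<tau> (susp_class \<phi> (x, t)) + d \<le> t + e + \<tau> (susp_class \<phi> (x, t + e))"
proof -
  have cont: "continuous_map (susp_top \<phi>) euclideanreal \<tau>"
    using \<tau> by (simp add: displacement_def)
  have "continuous_map (susp_top \<phi>) (susp_top \<phi>) (\<lambda>y. susp_flow e y)"
    by (intro continuous_map_flow) simp_all
  from continuous_map_compose [OF this cont]
  have "continuous_map (susp_top \<phi>) euclideanreal (\<lambda>y. e + \<tau> (susp_flow e y) - \<tau> y)"
    by (intro continuous_map_diff continuous_map_add cont) (simp_all add: o_def)
  moreover have "0 < e + \<tau> (susp_flow e y) - \<tau> y" if "y \<in> Y" for y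
  proof -
    obtain x t where y: "y = susp_class \<phi> (x, t)"
      using \<open>y \<in> Y\<close> by (rule suspensionE)
    have "t < t + e"
      using \<open>e > 0\<close> by simp
    from strict_monoD [OF displacement_strict_mono [OF assms(1) \<tau>, of x] this] show ?thesis
      by (simp add: y susp_flow_class)
  qed
  ultimately obtain d where d: "d > 0" "\<And>y. y \<in> Y \<Longrightarrow> d \<le> e + \<tau> (susp_flow e y) - \<tau> y"
    using susp_positive_bound by blast
  show ?thesis
  proof (rule that [OF d(1)])
    fix x t
    show "t + \<tau> (susp_class \<phi> (x, t)) + d \<le> t + e + \<tau> (susp_class \<phi> (x, t + e))"
      using d(2) [of "susp_class \<phi> (x, t)"] by (simp add: susp_flow_class)
  qed
qed

text \<open>Uniform closeness of the inverse follows from the gap of \<open>displacement_gap\<close>: where \<open>F\<close> moves by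
  more than the error when its argument moves by \<open>e\<close>, an error in the value shifts preimages by
  less than \<open>e\<close>.\<close>

lemma H0_dist_le_gap:
  assumes g: "g \<in> H0 \<phi>" and h: "h \<in> H0 \<phi>" and \<tau>: "displacement \<phi> g \<tau>" and \<sigma>: "displacement \<phi> h \<sigma>"
    and gap: "\<And>x t. t + \<tau> (susp_class \<phi> (x, t)) + d \<le> t + e + \<tau> (susp_class \<phi> (x, t + e))"
    and near: "\<And>x t. \<bar>\<tau> (susp_class \<phi> (x, t)) - \<sigma> (susp_class \<phi> (x, t))\<bar> < d" and "d \<le> e"
  shows "H0_dist \<phi> g h \<le> 2 * e"
proof -
  define \<tau>' where "\<tau>' = (\<lambda>y. - \<tau> (inv_into Y g y))"
  define \<sigma>' where "\<sigma>' = (\<lambda>y. - \<sigma> (inv_into Y h y))"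
  define F where "F x t = t + \<tau> (susp_class \<phi> (x, t))" for x t
  define G where "G x t = t + \<sigma> (susp_class \<phi> (x, t))" for x t
  have disp: "displacement \<phi> (susp_inv \<phi> g) \<tau>'" "displacement \<phi> (susp_inv \<phi> h) \<sigma>'"
    unfolding \<tau>'_def \<sigma>'_def by (rule displacement_inv [OF g \<tau>], rule displacement_inv [OF h \<sigma>])
  have mono: "strict_mono (G x)" for x
    unfolding G_def by (rule displacement_strict_mono [OF H0_inj_on [OF h] \<sigma>])
  have "dplus \<phi> g h \<le> d"
    by (rule dplus_le [OF \<tau> \<sigma>]) (use near in \<open>auto elim!: suspensionE intro: less_imp_le\<close>)
  moreover have "dplus \<phi> (susp_inv \<phi> g) (susp_inv \<phi> h) \<le> e"
  proof (rule dplus_le [OF disp])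
    fix y assume "y \<in> Y"
    then obtain x u where y: "y = susp_class \<phi> (x, u)"
      by (rule suspensionE)
    define s where "s = u + \<tau>' y"
    define s' where "s' = u + \<sigma>' y"
    have s: "F x s = u"
      using displacement_inv_line(2) [OF g \<tau>, of u x] by (simp add: F_def s_def y \<tau>'_def)
    have s': "G x s' = u"
      using displacement_inv_line(2) [OF h \<sigma>, of u x] by (simp add: G_def s'_def y \<sigma>'_def)
    have "F x s + d \<le> F x (s + e)" "F x (s - e) + d \<le> F x s"
      using gap [of s x] gap [of "s - e" x] by (simp_all add: F_def)
    moreover have "\<bar>F x t - G x t\<bar> < d" for t
      using near by (simp add: F_def G_def)
    from this [of "s + e"] this [of "s - e"] have "F x (s + e) < G x (s + e) + d" "G x (s - e) < F x (s - e) + d"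
      by linarith+
    ultimately have "G x s' < G x (s + e)" "G x (s - e) < G x s'"
      using s s' by linarith+
    then have "s' < s + e" "s - e < s'"
      using mono by (simp_all add: strict_mono_less)
    then show "\<bar>\<tau>' y - \<sigma>' y\<bar> \<le> e"
      by (simp add: s_def s'_def)
  qed
  ultimately show ?thesis
    using g h \<open>d \<le> e\<close> by (simp add: H0_dist_def)
qed

text \<open>The order of choices matters: the gap that controls inverses fixes the tolerance
  \<open>k\<close>, this fixes the mesh width, and only then does the gap over one cell fix the
  sampling error.\<close>

lemma mesh_approximation:
  assumes g: "g \<in> H0 \<phi>" and "e > 0"
  obtains vs q where "stone_mesh \<phi> vs q" "H0_dist \<phi> g (mesh_map \<phi> vs) < e"
proof -
  obtain \<tau> where \<tau>: "displacement \<phi> g \<tau>"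
    using H0_displacement [OF g] .
  have cont: "continuous_map (susp_top \<phi>) euclideanreal \<tau>"
    using \<tau> by (simp add: displacement_def)
  have inj: "inj_on g Y"
    by (rule H0_inj_on [OF g])
  define F where "F x t = t + \<tau> (susp_class \<phi> (x, t))" for x t
  have mono: "strict_mono (F x)" for x
    unfolding F_def by (rule displacement_strict_mono [OF inj \<tau>])
  \<comment> \<open>With a third of \<open>e\<close> the two summands of the distance together stay
    at most \<open>2 * (e/3)\<close>, strictly below \<open>e\<close>.\<close>
  obtain d where d: "d > 0"
    "\<And>x t. t + \<tau> (susp_class \<phi> (x, t)) + d \<le> t + e/3 + \<tau> (susp_class \<phi> (x, t + e/3))"
    using displacement_gap [OF inj \<tau>, of "e/3"] \<open>e > 0\<close> by auto
  define k where "k = min d (e/3)"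
  have k: "k > 0" "k \<le> d" "k \<le> e/3"
    using d(1) \<open>e > 0\<close> by (auto simp: k_def)
  obtain c where c: "c > 0" "\<And>y s. y \<in> Y \<Longrightarrow> \<bar>s\<bar> < c \<Longrightarrow> \<bar>\<tau> (susp_flow s y) - \<tau> y\<bar> < k/4"
    using uniform_along_flow [OF cont, of "k/4"] k(1) by auto
  \<comment> \<open>Over one cell the lift then advances by less than \<open>k/4\<close> for the
    elapsed time plus \<open>k/4\<close> for the change of \<open>\<tau>\<close>.\<close>
  obtain q where q: "(1/2) ^ q < min c (k/4)"
    using real_arch_pow_inv [of "min c (k/4)" "1/2"] c(1) k(1) by auto
  define N :: nat where "N = 2 ^ q"
  have N: "1 / real N = (1/2) ^ q" "N > 0"
    by (simp_all add: N_def power_one_over)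
  have step: "of_int (j + 1) / real N = of_int j / real N + 1 / real N" for j
    by (simp add: add_divide_distrib)
  have small: "1 / real N < c" "1 / real N < k/4"
    using q N(1) by simp_all
  have fine: "F x (of_int (j + 1) / N) < F x (of_int j / N) + k/2" for x j
  proof -
    have "\<bar>\<tau> (susp_flow (1 / real N) (susp_class \<phi> (x, of_int j / N))) - \<tau> (susp_class \<phi> (x, of_int j / N))\<bar> < k/4"
      using small(1) by (intro c(2)) simp_all
    then show ?thesis
      using small(2) unfolding F_def step susp_flow_class by linarith
  qed
  obtain d' where d': "d' > 0" "\<And>x t. F x t + d' \<le> F x (t + 1 / real N)"
    using displacement_gap [OF inj \<tau>, of "1 / real N"] N(2) by (auto simp: F_def add.assoc)
  \<comment> \<open>Neighbouring samples are at least \<open>d'\<close> apart, so errors below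
    \<open>d'/2\<close> leave them increasing; \<open>k/4\<close> is what remains tolerable beside
    the variation \<open>k/2\<close> over a cell.\<close>
  define \<mu> where "\<mu> = min (k/4) (d'/2)"
  have \<mu>: "\<mu> > 0" "\<mu> \<le> k/4" "\<mu> \<le> d'/2"
    using k(1) d'(1) by (auto simp: \<mu>_def)
  have "\<exists>v. locally_const v \<and> range v \<subseteq> dyadic_rationals \<and> (\<forall>x. \<bar>v x - F x (real i / N)\<bar> < \<mu>)" for i :: nat
  proof -
    have "continuous_on UNIV (\<lambda>x. F x (real i / N))"
      unfolding F_def
      by (intro continuous_intros continuous_on_compose2 [OF continuous_on_class_comp [OF cont]]) auto
    then show ?thesis
      using locally_const_dyadic_approx [OF compact_X totally_disconnected _ \<mu>(1)]
      by metis
  qed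
  then obtain v where v: "\<And>i. locally_const (v i)" "\<And>i. range (v i) \<subseteq> dyadic_rationals"
      "\<And>i x. \<bar>v i x - F x (real i / N)\<bar> < \<mu>"
    by metis
  define vs where "vs = map v [0..<N]"
  have len: "length vs = N"
    by (simp add: vs_def)
  have near: "\<bar>mesh_value \<phi> vs x j - F x (of_int j / N)\<bar> < \<mu>" for x j
  proof -
    \<comment> \<open>Writing \<open>j = n * N + i\<close>, equivariance carries both sides to the
      sampled point \<open>i / N\<close> over \<open>zpow \<phi> n x\<close>.\<close>
    define n where "n = j div int N"
    define i where "i = nat (j mod int N)"
    have i: "int i = j mod int N" "i < N"
      using N(2) by (simp_all add: i_def nat_less_iff)
    have "of_int j = real_of_int (n * int N + int i)"
      by (simp add: n_def i(1))
    then have "real_of_int j / N = real i / N + of_int n"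
      using N(2) by (simp add: field_simps)
    then have "susp_class \<phi> (zpow \<phi> n x, real i / N) = susp_class \<phi> (x, of_int j / N)"
      using class_shift [of n x "of_int j / N"] by simp
    then have "F x (of_int j / N) = F (zpow \<phi> n x) (real i / N) + of_int n"
      using \<open>real_of_int j / N = real i / N + of_int n\<close> by (simp add: F_def)
    moreover have "mesh_value \<phi> vs x j = v i (zpow \<phi> n x) + of_int n"
      using i(2) by (simp add: mesh_value_def len n_def [symmetric] i_def [symmetric] vs_def)
    ultimately show ?thesis
      using v(3) [of i "zpow \<phi> n x"] by simp
  qed
  have mesh: "stone_mesh \<phi> vs q"
  proof
    show "length vs = 2 ^ q"
      by (simp add: len N_def)
    show "locally_const w" "range w \<subseteq> dyadic_rationals" if "w \<in> set vs" for w
      using that v(1,2) by (auto simp: vs_def)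
    fix x j
    have "F x (of_int j / N) + d' \<le> F x (of_int (j + 1) / N)"
      unfolding step by (rule d'(2))
    then show "mesh_value \<phi> vs x j < mesh_value \<phi> vs x (j + 1)"
      using near [of x j] near [of x "j + 1"] \<mu>(3) by linarith
  qed
  then interpret stone_mesh \<phi> vs q .
  \<comment> \<open>Both lifts are monotone, so in a cell they are squeezed between their values at
    its ends, with total error below \<open>k/2 + k/4\<close>.\<close>
  have "\<bar>mesh_line \<phi> vs x t - F x t\<bar> < k" for x t
  proof -
    obtain j where j: "of_int j / real N \<le> t" "t < of_int (j + 1) / real N"
      using mesh_bracket [of t] len by metis
    then have "mesh_value \<phi> vs x j \<le> mesh_line \<phi> vs x t" "mesh_line \<phi> vs x t \<le> mesh_value \<phi> vs x (j + 1)"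
      using mesh_line_bounds [of j t x] len by simp_all
    moreover have "F x (of_int j / N) \<le> F x t" "F x t \<le> F x (of_int (j + 1) / N)"
      using j mono by (simp_all add: strict_mono_less_eq)
    ultimately show ?thesis
      using near [of x j] near [of x "j + 1"] fine [of x j] \<mu>(2) by linarith
  qed
  note line = this
  have "H0_dist \<phi> g (mesh_map \<phi> vs) \<le> 2 * (e/3)"
  proof (rule H0_dist_le_gap [OF g _ \<tau> displacement_mesh])
    show "mesh_map \<phi> vs \<in> H0 \<phi>"
      using mesh_map_T T_group_subset_H0 by blast
    show "k \<le> e/3" by (rule k(3))
    fix x t
    show "t + \<tau> (susp_class \<phi> (x, t)) + k \<le> t + e/3 + \<tau> (susp_class \<phi> (x, t + e/3))"
      using d(2) [of t x] k(2) by linarith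
    show "\<bar>\<tau> (susp_class \<phi> (x, t)) - mesh_displacement \<phi> vs (susp_class \<phi> (x, t))\<bar> < k"
      using line [of x t] mesh_displacement_line [of t x] unfolding F_def by linarith
  qed
  then show ?thesis
    using that [OF mesh] \<open>e > 0\<close> by linarith
qed

end

section \<open>The Polish group\<close>

text \<open>Finite nets at the scales \<open>1 / (n + 1)\<close> give a countable base of balls. A
  clopen set is open, hence a union of such balls, and compact, hence a union of finitely
  many.\<close>

lemma countable_clopen:
  assumes X: "compact (UNIV :: 'a::t2_space set)" and "metrizable_space (euclidean :: 'a topology)"
  shows "countable {C :: 'a set. open C \<and> closed C}"
proof -
  obtain M d where "Metric_space M d" and top: "(euclidean :: 'a topology) = Metric_space.mtopology M d"
    using assms(2) by (auto simp: metrizable_space_def)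
  interpret Metric_space M d by fact
  have M: "M = UNIV"
    using topspace_mtopology top by (metis topspace_euclidean)
  have open_ball: "open (mball x r)" for x r
    using openin_mball [of x r] by (simp flip: top)
  have "\<forall>n. \<exists>K. finite K \<and> UNIV \<subseteq> (\<Union>x\<in>K. mball x (1 / real (Suc n)))"
  proof
    fix n
    have "x \<in> mball x (1 / real (Suc n))" for x
      unfolding centre_in_mball_iff by (simp add: M)
    then have "UNIV \<subseteq> (\<Union>x\<in>UNIV. mball x (1 / real (Suc n)))"
      by blast
    then obtain K where "finite K" "UNIV \<subseteq> (\<Union>x\<in>K. mball x (1 / real (Suc n)))"
      by (rule compactE_image [OF X open_ball])
    then show "\<exists>K. finite K \<and> UNIV \<subseteq> (\<Union>x\<in>K. mball x (1 / real (Suc n)))"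
      by blast
  qed
  from choice [OF this] obtain K where
    K: "\<And>n. finite (K n)" "\<And>n. UNIV \<subseteq> (\<Union>x\<in>K n. mball x (1 / real (Suc n)))"
    by auto
  define B where "B = (\<Union>n. (\<lambda>x. mball x (1 / real (Suc n))) ` K n)"
  have "countable B"
    unfolding B_def using K(1) by (simp add: countable_finite)
  have basis: "\<exists>V\<in>B. y \<in> V \<and> V \<subseteq> C" if C: "open C" and y: "y \<in> C" for C y
  proof -
    have "openin mtopology C"
      using C by (simp flip: top)
    then obtain r where r: "r > 0" "mball y r \<subseteq> C"
      using y by (auto simp: openin_mtopology)
    \<comment> \<open>A ball of radius below \<open>r/2\<close> that contains \<open>y\<close> lies
      within distance \<open>r\<close> of \<open>y\<close>.\<close>
    obtain n where n: "1 / real (Suc n) < r/2"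
      using nat_approx_posE [of "r/2"] r(1) by auto
    obtain x where x: "x \<in> K n" "y \<in> mball x (1 / real (Suc n))"
      using K(2) [of n] by blast
    have "mball x (1 / real (Suc n)) \<subseteq> mball y r"
    proof
      fix z assume "z \<in> mball x (1 / real (Suc n))"
      then have "d x z < r/2" "d y x < r/2"
        using x(2) n commute [of x y] by auto
      moreover have "d y z \<le> d y x + d x z"
        by (rule triangle) (simp_all add: M)
      ultimately have "d y z < r"
        by linarith
      then show "z \<in> mball y r"
        unfolding in_mball by (simp add: M)
    qed
    then show ?thesis
      using x r(2) by (intro bexI [of _ "mball x (1 / real (Suc n))"]) (auto simp: B_def)
  qed
  have "{C. open C \<and> closed C} \<subseteq> Union ` {F. finite F \<and> F \<subseteq> B}"
  proof
    fix C :: "'a set" assume "C \<in> {C. open C \<and> closed C}"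
    then have C: "open C" "closed C"
      by auto
    have "compact C"
      using X C(2) by (metis compact_Int_closed inf_top_left)
    moreover have "C \<subseteq> \<Union>{V \<in> B. V \<subseteq> C}"
      using basis [OF C(1)] by blast
    moreover have "open V" if "V \<in> {V \<in> B. V \<subseteq> C}" for V
      using that open_ball by (auto simp: B_def)
    ultimately obtain F where "F \<subseteq> {V \<in> B. V \<subseteq> C}" "finite F" "C \<subseteq> \<Union>F"
      by (meson compactE)
    then have "C = \<Union>F" "F \<in> {F. finite F \<and> F \<subseteq> B}"
      by auto
    then show "C \<in> Union ` {F. finite F \<and> F \<subseteq> B}"
      by (rule image_eqI)
  qed
  moreover have "countable (Union ` {F. finite F \<and> F \<subseteq> B})"
    using \<open>countable B\<close> by (intro countable_image countable_Collect_finite_subset)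
  ultimately show ?thesis
    by (rule countable_subset)
qed

lemma locally_const_vimage_clopen:
  assumes "locally_const f"
  shows "open (f -` A)" "closed (f -` A)"
proof -
  have "open (f -` A)" for A
  proof (subst open_subopen, rule ballI)
    fix x assume x: "x \<in> f -` A"
    from locally_constD [OF assms, of x] obtain C where C: "open C" "x \<in> C" "\<forall>x'\<in>C. f x' = f x"
      by (elim exE conjE)
    have "C \<subseteq> f -` A"
      using x bspec [OF C(3)] by (metis subsetI vimage_eq)
    then show "\<exists>T. open T \<and> x \<in> T \<and> T \<subseteq> f -` A"
      using C(1,2) by (intro exI [of _ C] conjI)
  qed
  note op = this
  show "open (f -` A)" by (rule op)
  show "closed (f -` A)"
    using op [of "- A"] by (simp add: closed_def vimage_Compl)
qed

text \<open>The fibres form an open cover; the values belonging to a finite subcover are all the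
  values.\<close>

lemma locally_const_finite_range:
  fixes f :: "'a::topological_space \<Rightarrow> 'b"
  assumes "compact (UNIV :: 'a set)" "locally_const f"
  shows "finite (range f)"
proof -
  have "UNIV \<subseteq> (\<Union>r\<in>UNIV. f -` {r})"
    by auto
  then obtain K where K: "finite K" "UNIV \<subseteq> (\<Union>r\<in>K. f -` {r})"
    by (rule compactE_image [OF assms(1) locally_const_vimage_clopen(1) [OF assms(2)]])
  then have "range f \<subseteq> K"
    by auto
  then show ?thesis
    using K(1) by (rule finite_subset)
qed

lemma countable_dyadic_rationals: "countable dyadic_rationals"
proof -
  have eq: "dyadic_rationals = (\<lambda>(p, q). of_int p / 2 powi q) ` (UNIV :: (int \<times> int) set)"
    by (auto simp: dyadic_rationals_def)
  show ?thesis
    unfolding eq by (intro countable_image countableI_type)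
qed

text \<open>A locally constant function is recovered from the finitely many pairs of a fibre and its value.\<close>

lemma countable_locally_const:
  fixes R :: "'b set"
  assumes "compact (UNIV :: 'a::t2_space set)" "metrizable_space (euclidean :: 'a topology)" "countable R"
  shows "countable {v :: 'a \<Rightarrow> 'b. locally_const v \<and> range v \<subseteq> R}"
proof (rule countable_image_inj_on)
  define graph where "graph v = (\<lambda>r. (v -` {r}, r)) ` range v" for v :: "'a \<Rightarrow> 'b"
  let ?S = "{C :: 'a set. open C \<and> closed C} \<times> R"
  have "graph ` {v. locally_const v \<and> range v \<subseteq> R} \<subseteq> {F. finite F \<and> F \<subseteq> ?S}"
    unfolding graph_def
    using locally_const_finite_range [OF assms(1)] locally_const_vimage_clopen by blast
  moreover have "countable {F. finite F \<and> F \<subseteq> ?S}"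
    by (intro countable_Collect_finite_subset countable_SIGMA countable_clopen assms)
  ultimately show "countable (graph ` {v. locally_const v \<and> range v \<subseteq> R})"
    by (rule countable_subset)
  have "v x = w x" if eq: "graph v = graph w" for v w x
  proof -
    have "(v -` {v x}, v x) \<in> graph w"
      unfolding eq [symmetric] by (simp add: graph_def)
    then have "v -` {v x} = w -` {v x}"
      by (auto simp: graph_def)
    then have "x \<in> w -` {v x}"
      by blast
    then show ?thesis
      by simp
  qed
  then show "inj_on graph {v. locally_const v \<and> range v \<subseteq> R}"
    by (meson ext inj_onI)
qed

context stone_suspension
begin

section \<open>Density, separability and continuity of the group operations\<close>

interpretation H0: Metric_space "H0 \<phi>" "H0_dist \<phi>"
  by (rule Metric_space_H0)

lemma topspace_H0_top: "topspace (H0_top \<phi>) = H0 \<phi>"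
  by (simp add: H0_top_def)

lemma H0_closure_eqI:
  assumes "\<And>g e. g \<in> H0 \<phi> \<Longrightarrow> e > 0 \<Longrightarrow> \<exists>h\<in>S. h \<in> H0 \<phi> \<and> H0_dist \<phi> g h < e"
  shows "H0_top \<phi> closure_of S = H0 \<phi>"
  unfolding H0_top_def H0.metric_closure_of using assms by auto

lemma T_group_dense: "H0_top \<phi> closure_of T_group \<phi> = H0 \<phi>"
proof (rule H0_closure_eqI)
  fix g and e :: real assume "g \<in> H0 \<phi>" "e > 0"
  then obtain vs q where mesh: "stone_mesh \<phi> vs q" "H0_dist \<phi> g (mesh_map \<phi> vs) < e"
    by (rule mesh_approximation)
  show "\<exists>h\<in>T_group \<phi>. h \<in> H0 \<phi> \<and> H0_dist \<phi> g h < e"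
    using stone_mesh.mesh_map_T [OF mesh(1)] T_group_subset_H0 mesh(2) by blast
qed

lemma separable_H0_top:
  assumes "metrizable_space (euclidean :: 'a topology)"
  shows "separable_space (H0_top \<phi>)"
proof -
  define L where "L = {v :: 'a \<Rightarrow> real. locally_const v \<and> range v \<subseteq> dyadic_rationals}"
  \<comment> \<open>Lists over \<open>L\<close> need not have increasing mesh values, so their maps
    may fall outside the group; the intersection discards those.\<close>
  define S where "S = mesh_map \<phi> ` lists L \<inter> H0 \<phi>"
  have "countable S"
    unfolding S_def L_def
    by (intro countable_Int1 countable_image countable_lists countable_locally_const
        compact_X assms countable_dyadic_rationals)
  moreover have "H0_top \<phi> closure_of S = H0 \<phi>"
  proof (rule H0_closure_eqI)
    fix g and e :: real assume "g \<in> H0 \<phi>" "e > 0"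
    then obtain vs q where mesh: "stone_mesh \<phi> vs q" "H0_dist \<phi> g (mesh_map \<phi> vs) < e"
      by (rule mesh_approximation)
    then interpret stone_mesh \<phi> vs q by simp
    have H0: "mesh_map \<phi> vs \<in> H0 \<phi>"
      using mesh_map_T T_group_subset_H0 by blast
    have "vs \<in> lists L"
      using locally_const dyadic by (simp add: L_def in_lists_conv_set)
    then have "mesh_map \<phi> vs \<in> S"
      using H0 by (simp add: S_def)
    then show "\<exists>h\<in>S. h \<in> H0 \<phi> \<and> H0_dist \<phi> g h < e"
      using H0 mesh(2) by blast
  qed
  ultimately show ?thesis
    unfolding separable_space_def topspace_H0_top by (intro exI [of _ S]) (auto simp: S_def)
qed

text \<open>The displacement \<open>\<tau> (h y) + \<sigma> y\<close> changes in three ways: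
  \<open>h' y\<close> lies a short flow time from \<open>h y\<close>, over which the fixed function
  \<open>\<tau>\<close> varies little, and both \<open>\<tau>\<close> and \<open>\<sigma>\<close>
  are replaced by close functions for \<open>g'\<close> and \<open>h'\<close>. Each change costs
  less than \<open>e/3\<close>.\<close>

lemma dplus_compose_continuous:
  assumes g: "g \<in> H0 \<phi>" and h: "h \<in> H0 \<phi>" and "e > 0"
  obtains d where "d > 0"
    "\<And>g' h'. g' \<in> H0 \<phi> \<Longrightarrow> h' \<in> H0 \<phi> \<Longrightarrow> dplus \<phi> g g' < d \<Longrightarrow> dplus \<phi> h h' < d \<Longrightarrow>
       dplus \<phi> (compose Y g h) (compose Y g' h') \<le> e"
proof -
  obtain \<tau> where \<tau>: "displacement \<phi> g \<tau>"
    using H0_displacement [OF g] .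
  obtain \<sigma> where \<sigma>: "displacement \<phi> h \<sigma>"
    using H0_displacement [OF h] .
  have "continuous_map (susp_top \<phi>) euclideanreal \<tau>"
    using \<tau> by (simp add: displacement_def)
  then obtain c where c: "c > 0" "\<And>y s. y \<in> Y \<Longrightarrow> \<bar>s\<bar> < c \<Longrightarrow> \<bar>\<tau> (susp_flow s y) - \<tau> y\<bar> < e/3"
    using uniform_along_flow [of \<tau> "e/3"] \<open>e > 0\<close> by auto
  define d where "d = min c (e/3)"
  have "d > 0"
    using c(1) \<open>e > 0\<close> by (simp add: d_def)
  moreover have "dplus \<phi> (compose Y g h) (compose Y g' h') \<le> e"
    if g': "g' \<in> H0 \<phi>" and h': "h' \<in> H0 \<phi>" and dg: "dplus \<phi> g g' < d" and dh: "dplus \<phi> h h' < d" for g' h'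
  proof -
    obtain \<tau>0 where \<tau>0: "displacement \<phi> g' \<tau>0"
      using H0_displacement [OF g'] .
    obtain \<sigma>0 where \<sigma>0: "displacement \<phi> h' \<sigma>0"
      using H0_displacement [OF h'] .
    obtain \<tau>' where \<tau>': "displacement \<phi> g' \<tau>'" "\<And>y. y \<in> Y \<Longrightarrow> \<bar>\<tau> y - \<tau>' y\<bar> < d"
      using dplus_lessE [OF dg \<tau> \<tau>0] by blast
    obtain \<sigma>' where \<sigma>': "displacement \<phi> h' \<sigma>'" "\<And>y. y \<in> Y \<Longrightarrow> \<bar>\<sigma> y - \<sigma>' y\<bar> < d"
      using dplus_lessE [OF dh \<sigma> \<sigma>0] by blast
    show ?thesis
    proof (rule dplus_le [OF displacement_compose [OF \<tau> \<sigma> H0_continuous [OF h]]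
          displacement_compose [OF \<tau>'(1) \<sigma>'(1) H0_continuous [OF h']]])
      fix y assume y: "y \<in> Y"
      have hy: "h y \<in> Y" "h' y \<in> Y"
        using displacement_mem [OF \<sigma> y] displacement_mem [OF \<sigma>'(1) y] .
      have "h' y = susp_flow (\<sigma>' y - \<sigma> y) (h y)"
        using \<sigma> \<sigma>'(1) y by (simp add: displacement_def susp_flow_add)
      moreover have "\<bar>\<sigma>' y - \<sigma> y\<bar> < c"
        using \<sigma>'(2) [OF y] by (simp add: d_def abs_minus_commute)
      ultimately have "\<bar>\<tau> (h' y) - \<tau> (h y)\<bar> < e/3"
        using c(2) [OF hy(1)] by simp
      moreover have "\<bar>\<tau> (h' y) - \<tau>' (h' y)\<bar> < e/3" "\<bar>\<sigma> y - \<sigma>' y\<bar> < e/3"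
        using \<tau>'(2) [OF hy(2)] \<sigma>'(2) [OF y] by (simp_all add: d_def)
      ultimately show "\<bar>\<tau> (h y) + \<sigma> y - (\<tau>' (h' y) + \<sigma>' y)\<bar> \<le> e"
        by linarith
    qed
  qed
  ultimately show ?thesis
    using that by blast
qed

lemma H0_inv_compose:
  assumes g: "g \<in> H0 \<phi>" and h: "h \<in> H0 \<phi>"
  shows "susp_inv \<phi> (compose Y g h) = compose Y (susp_inv \<phi> h) (susp_inv \<phi> g)"
proof (rule H0_inv_eqI [OF H0_compose [OF g h] compose_extensional])
  fix y assume y: "y \<in> Y"
  have gy: "inv_into Y g y \<in> Y" "g (inv_into Y g y) = y"
    using y H0_image [OF g] by (simp_all add: inv_into_into f_inv_into_f)
  have "inv_into Y h z \<in> Y" "h (inv_into Y h z) = z"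
    if "z \<in> Y" for z
    using that H0_image [OF h] by (simp_all add: inv_into_into f_inv_into_f)
  then show "compose Y (susp_inv \<phi> h) (susp_inv \<phi> g) y \<in> Y \<and>
      compose Y g h (compose Y (susp_inv \<phi> h) (susp_inv \<phi> g) y) = y"
    using gy y by (simp add: compose_def)
qed

text \<open>Inverses compose in reverse order, so the one-sided estimate is applied once more, to
  \<open>susp_inv \<phi> h\<close> and \<open>susp_inv \<phi> g\<close>.\<close>

lemma H0_dist_compose_continuous:
  assumes g: "g \<in> H0 \<phi>" and h: "h \<in> H0 \<phi>" and "e > 0"
  obtains d where "d > 0"
    "\<And>g' h'. g' \<in> H0 \<phi> \<Longrightarrow> h' \<in> H0 \<phi> \<Longrightarrow> H0_dist \<phi> g g' < d \<Longrightarrow> H0_dist \<phi> h h' < d \<Longrightarrow>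
       H0_dist \<phi> (compose Y g h) (compose Y g' h') < e"
proof -
  note inv = H0_restrict_inv_into
  have "e/3 > 0"
    using \<open>e > 0\<close> by simp
  obtain d1 where d1: "d1 > 0"
    "\<And>g' h'. g' \<in> H0 \<phi> \<Longrightarrow> h' \<in> H0 \<phi> \<Longrightarrow> dplus \<phi> g g' < d1 \<Longrightarrow> dplus \<phi> h h' < d1 \<Longrightarrow>
       dplus \<phi> (compose Y g h) (compose Y g' h') \<le> e/3"
    using dplus_compose_continuous [OF g h \<open>e/3 > 0\<close>] by metis
  obtain d2 where d2: "d2 > 0"
    "\<And>g' h'. g' \<in> H0 \<phi> \<Longrightarrow> h' \<in> H0 \<phi> \<Longrightarrow> dplus \<phi> (susp_inv \<phi> h) g' < d2 \<Longrightarrow> dplus \<phi> (susp_inv \<phi> g) h' < d2 \<Longrightarrow>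
       dplus \<phi> (compose Y (susp_inv \<phi> h) (susp_inv \<phi> g)) (compose Y g' h') \<le> e/3"
    using dplus_compose_continuous [OF inv [OF h] inv [OF g] \<open>e/3 > 0\<close>] by metis
  show ?thesis
  proof (rule that [of "min d1 d2"])
    show "0 < min d1 d2"
      using d1(1) d2(1) by simp
    fix g' h' assume g': "g' \<in> H0 \<phi>" and h': "h' \<in> H0 \<phi>"
      and "H0_dist \<phi> g g' < min d1 d2" "H0_dist \<phi> h h' < min d1 d2"
    then have "dplus \<phi> g g' < d1" "dplus \<phi> h h' < d1"
      "dplus \<phi> (susp_inv \<phi> g) (susp_inv \<phi> g') < d2" "dplus \<phi> (susp_inv \<phi> h) (susp_inv \<phi> h') < d2"
      using dplus_le_H0_dist [OF g g'] dplus_le_H0_dist [OF h h'] by linarith+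
    then have "dplus \<phi> (compose Y g h) (compose Y g' h') \<le> e/3"
      "dplus \<phi> (susp_inv \<phi> (compose Y g h)) (susp_inv \<phi> (compose Y g' h')) \<le> e/3"
      using d1(2) [OF g' h'] d2(2) [OF inv [OF h'] inv [OF g']]
      by (simp_all add: H0_inv_compose g h g' h')
    then show "H0_dist \<phi> (compose Y g h) (compose Y g' h') < e"
      using \<open>e > 0\<close> H0_compose [OF g h] H0_compose [OF g' h'] by (simp add: H0_dist_def)
  qed
qed

lemma H0_mult: "g \<in> H0 \<phi> \<Longrightarrow> h \<in> H0 \<phi> \<Longrightarrow> g \<otimes>\<^bsub>H0_group \<phi>\<^esub> h = compose Y g h"
  by (simp add: H0_group_def BijGroup_def H0_Bij)

lemma H0_group_inv: "g \<in> H0 \<phi> \<Longrightarrow> inv\<^bsub>H0_group \<phi>\<^esub> g = susp_inv \<phi> g"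
  unfolding H0_group_def
  using group.m_inv_consistent [OF group_BijGroup H0_subgroup]
  by (simp add: inv_BijGroup H0_Bij)

lemma group_H0: "group (H0_group \<phi>)"
  unfolding H0_group_def
  by (rule subgroup.subgroup_is_group [OF H0_subgroup group_BijGroup])

lemma carrier_H0_group: "carrier (H0_group \<phi>) = H0 \<phi>"
  by (simp add: H0_group_def)

lemma continuous_map_H0_mult:
  "continuous_map (prod_topology (H0_top \<phi>) (H0_top \<phi>)) (H0_top \<phi>) (\<lambda>(g, h). g \<otimes>\<^bsub>H0_group \<phi>\<^esub> h)"
  unfolding H0_top_def H0.continuous_map_to_metric
proof (intro ballI allI impI)
  fix p and e :: real
  assume "p \<in> topspace (prod_topology H0.mtopology H0.mtopology)" and "e > 0"
  then obtain g h where p: "p = (g, h)" and g: "g \<in> H0 \<phi>" and h: "h \<in> H0 \<phi>"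
    by auto
  obtain d where d: "d > 0"
    "\<And>g' h'. g' \<in> H0 \<phi> \<Longrightarrow> h' \<in> H0 \<phi> \<Longrightarrow> H0_dist \<phi> g g' < d \<Longrightarrow> H0_dist \<phi> h h' < d \<Longrightarrow>
       H0_dist \<phi> (compose Y g h) (compose Y g' h') < e"
    using H0_dist_compose_continuous [OF g h \<open>e > 0\<close>] by metis
  have "openin (prod_topology H0.mtopology H0.mtopology) (H0.mball g d \<times> H0.mball h d)"
    by (simp add: openin_prod_Times_iff H0.openin_mball)
  moreover have "p \<in> H0.mball g d \<times> H0.mball h d"
    using p g h d(1) by simp
  moreover have "(\<lambda>(g, h). g \<otimes>\<^bsub>H0_group \<phi>\<^esub> h) p' \<in> H0.mball ((\<lambda>(g, h). g \<otimes>\<^bsub>H0_group \<phi>\<^esub> h) p) e"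
    if p': "p' \<in> H0.mball g d \<times> H0.mball h d" for p'
  proof -
    obtain g' h' where "p' = (g', h')" "g' \<in> H0 \<phi>" "h' \<in> H0 \<phi>" "H0_dist \<phi> g g' < d" "H0_dist \<phi> h h' < d"
      using p' by auto
    then show ?thesis
      using d(2) [of g' h'] g h H0_compose by (simp add: p H0_mult)
  qed
  ultimately show "\<exists>U. openin (prod_topology H0.mtopology H0.mtopology) U \<and> p \<in> U \<and>
      (\<forall>p'\<in>U. (\<lambda>(g, h). g \<otimes>\<^bsub>H0_group \<phi>\<^esub> h) p' \<in> H0.mball ((\<lambda>(g, h). g \<otimes>\<^bsub>H0_group \<phi>\<^esub> h) p) e)"
    by blast
qed

text \<open>Inversion is an isometry, so the ball of the same radius works.\<close>

lemma continuous_map_H0_inv: "continuous_map (H0_top \<phi>) (H0_top \<phi>) (\<lambda>g. inv\<^bsub>H0_group \<phi>\<^esub> g)"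
  unfolding H0_top_def H0.continuous_map_to_metric
proof (intro ballI allI impI)
  fix g and e :: real
  assume "g \<in> topspace H0.mtopology" and "e > 0"
  then have g: "g \<in> H0 \<phi>"
    by simp
  have "(\<lambda>g. inv\<^bsub>H0_group \<phi>\<^esub> g) g' \<in> H0.mball (inv\<^bsub>H0_group \<phi>\<^esub> g) e" if "g' \<in> H0.mball g e" for g'
    using that g H0_restrict_inv_into by (simp add: H0_group_inv H0_dist_inv)
  moreover have "openin H0.mtopology (H0.mball g e)" "g \<in> H0.mball g e"
    using g \<open>e > 0\<close> by simp_all
  ultimately show "\<exists>U. openin H0.mtopology U \<and> g \<in> U \<and>
      (\<forall>g'\<in>U. inv\<^bsub>H0_group \<phi>\<^esub> g' \<in> H0.mball (inv\<^bsub>H0_group \<phi>\<^esub> g) e)"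
    by blast
qed

lemma completely_metrizable_H0_top: "completely_metrizable_space (H0_top \<phi>)"
  unfolding completely_metrizable_space_def H0_top_def
  using H0.Metric_space_axioms mcomplete_H0 by blast

lemma polish_group_H0:
  assumes "metrizable_space (euclidean :: 'a topology)"
  shows "polish_group (H0_group \<phi>) (H0_top \<phi>)"
  unfolding polish_group_def
  by (simp add: group_H0 topspace_H0_top carrier_H0_group continuous_map_H0_mult continuous_map_H0_inv
      completely_metrizable_H0_top separable_H0_top [OF assms])

lemma T_group_subgroup_H0: "subgroup (T_group \<phi>) (H0_group \<phi>)"
  unfolding H0_group_def
  by (rule group.subgroup_incl [OF group_BijGroup T_group_subgroup H0_subgroup
        T_group_subset_H0])

end

theorem propositionA2:
  fixes \<phi> :: "'a::t2_space \<Rightarrow> 'a"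
  assumes "stone_system \<phi>"
  shows "Metric_space (H0 \<phi>) (H0_dist \<phi>) \<and>
         Metric_space.mcomplete (H0 \<phi>) (H0_dist \<phi>) \<and>
         group (H0_group \<phi>) \<and>
         subgroup (T_group \<phi>) (H0_group \<phi>) \<and>
         H0_top \<phi> closure_of T_group \<phi> = H0 \<phi> \<and>
         (metrizable_space (euclidean :: 'a topology) \<longrightarrow>
            polish_group (H0_group \<phi>) (H0_top \<phi>))"
proof -
  interpret stone_suspension \<phi>
    by unfold_locales (rule assms)
  show ?thesis
    using Metric_space_H0 mcomplete_H0 group_H0 T_group_subgroup_H0 T_group_dense polish_group_H0
    by blast
qed

end
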